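(* Let $1<p\le\infty$, $1\le q\le\infty$, $\frac12<\alpha<\frac14\left(5-\frac3p\right)$ and $\nu>0$. Put $I=[0,\infty)$ and $\mathcal X=\mathcal L^\infty(I;\dot{FB}^{4-2\alpha-\frac3p}_{p,q})$, and let $K>0$ be a constant independent of $\Omega$ such that $\|B_\Omega(u,v)\|_{\mathcal X}\le K\|u\|_{\mathcal X}\|v\|_{\mathcal X}$ for all $u,v\in\mathcal X$ and all $\Omega\in\mathbb R$. Then there is a constant $0<\varepsilon<\frac1{4K}$, independent of $\Omega$, such that the following holds for every $\Omega\in\mathbb R$. Let $u_0,v_0\in\dot{FB}^{4-2\alpha-\frac3p}_{p,q}$ and $F,G\in\mathcal L^\infty(I;\dot{FB}^{4-4\alpha-\frac3p}_{p,q})$ satisfy $$\|u_0\|_{\dot{FB}^{4-2\alpha-\frac3p}_{p,q}}+\|F\|_{\mathcal L^\infty(I;\dot{FB}^{4-4\alpha-\frac3p}_{p,q})}<\varepsilon,\qquad\|v_0\|_{\dot{FB}^{4-2\alpha-\frac3p}_{p,q}}+\|G\|_{\mathcal L^\infty(I;\dot{FB}^{4-4\alpha-\frac3p}_{p,q})}<\varepsilon,$$ and let $u,v\in\mathcal X$ with $\|u\|_{\mathcal X}\le2\varepsilon$, $\|v\|_{\mathcal X}\le2\varepsilon$ be the global mild solutions of the fractional Navier-Stokes-Coriolis system with data $(u_0,F)$ and $(v_0,G)$, respectively. If $$\lim_{t\to\infty}\|S^\alpha_\Omega(t)(u_0-v_0)\|_{\dot{FB}^{4-2\alpha-\frac3p}_{p,q}}=0\quad\text{and}\quad\lim_{t\to\infty}\|F(t)-G(t)\|_{\dot{FB}^{4-4\alpha-\frac3p}_{p,q}}=0,$$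 then $$\lim_{t\to\infty}\|u(\cdot,t)-v(\cdot,t)\|_{\dot{FB}^{4-2\alpha-\frac3p}_{p,q}}=0.$$
   Context: Fourier-Besov spaces on $\mathbb R^3$: fix a radially symmetric $\varphi\in\mathcal S(\mathbb R^3)$ supported in $\{\xi:\frac34\le|\xi|\le\frac83\}$ with $\sum_{j\in\mathbb Z}\varphi(2^{-j}\xi)=1$ for all $\xi\ne0$, and put $\varphi_j(\xi)=\varphi(2^{-j}\xi)$. For $s\in\mathbb R$, $1\le p,q\le\infty$, $\dot{FB}^s_{p,q}$ is the set of $f\in\mathcal S'$ with $\hat f\in L^1_{loc}$ and $\|f\|_{\dot{FB}^s_{p,q}}=\big\|\big(2^{js}\|\varphi_j\hat f\|_{L^p}\big)_{j\in\mathbb Z}\big\|_{\ell^q}<\infty$ (vector-valued versions are understood). With $I=[0,\infty)$, $\mathcal L^\infty(I;\dot{FB}^s_{p,q})$ is the space of Bochner measurable $f:I\to\dot{FB}^s_{p,q}$ with $\|f\|=\big\|\big(2^{js}\|\varphi_j\hat f\|_{L^\infty(I;L^p)}\big)_{j\in\mathbb Z}\big\|_{\ell^q}<\infty$. The fractional Navier-Stokes-Coriolis system is $\partial_tu+\nu(-\Delta)^\alpha u+u\cdot\nabla u+\Omega e_3\times u+\nabla p=F$, $\mathrm{div}\,u=0$ in $\mathbb R^3\times(0,\infty)$, $u(\cdot,0)=u_0$, with $\nu>0$, $\Omega\in\mathbb R$, $e_3=(0,0,1)$. Semigroup: $(S^\alpha_\Omega(t)f)^\wedge(\xi)=e^{-\nu|\xi|^{2\alpha}t}\big[\cos(\Omega\tfrac{\xi_3}{|\xi|}t)\,I_3+\sin(\Omega\tfrac{\xi_3}{|\xi|}t)\,R(\xi)\big]\hat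 f(\xi)$, where $I_3$ is the identity matrix and $R(\xi)=\frac1{|\xi|}\begin{pmatrix}0&\xi_3&-\xi_2\\-\xi_3&0&\xi_1\\\xi_2&-\xi_1&0\end{pmatrix}$. $\mathbb P$ is the Leray projector, with symbol $\hat{\mathbb P}(\xi)_{mk}=\delta_{mk}-\xi_m\xi_k/|\xi|^2$. Bilinear operator: $B_\Omega(v,w)(t)=-\int_0^tS^\alpha_\Omega(t-\tau)\mathbb P\nabla\cdot(v\otimes w)(\tau)\,d\tau$, understood in Fourier variables, i.e. $[B_\Omega(v,w)]^\wedge(\xi,t)=-\int_0^t[S^\alpha_\Omega(t-\tau)]^\wedge(\xi)\hat{\mathbb P}(\xi)\,[i\xi\cdot(v\otimes w)^\wedge(\xi,\tau)]\,d\tau$ with $((v\otimes w)^\wedge)_{mk}=\hat v_m*\hat w_k$. A mild solution (in a given space) with data $(u_0,F)$ is a solution $u$ of $u(t)=S^\alpha_\Omega(t)u_0+B_\Omega(u,u)(t)+\int_0^tS^\alpha_\Omega(t-\tau)\mathbb PF(\tau)\,d\tau$. *)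

theory Defs
  imports "HOL-Analysis.Analysis" "HOL-Probability.Essential_Supremum"
begin

section \<open>Schwartz functions and tempered distributions on \<open>\<real>\<^sup>3\<close>\<close>

definition pderiv_dir :: "3 \<Rightarrow> (real^3 \<Rightarrow> complex) \<Rightarrow> real^3 \<Rightarrow> complex" where
  "pderiv_dir i f x = frechet_derivative f (at x) (axis i 1)"

definition pderivs :: "3 list \<Rightarrow> (real^3 \<Rightarrow> complex) \<Rightarrow> real^3 \<Rightarrow> complex" where
  "pderivs is f = foldr pderiv_dir is f"

definition smooth_fun :: "(real^3 \<Rightarrow> complex) \<Rightarrow> bool" where
  "smooth_fun f \<longleftrightarrow> (\<forall>is x. pderivs is f differentiable (at x))"

definition test_fun :: "(real^3 \<Rightarrow> complex) \<Rightarrow> bool" where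
  "test_fun f \<longleftrightarrow> smooth_fun f \<and> compact (closure {x. f x \<noteq> 0})"

definition schwartz :: "(real^3 \<Rightarrow> complex) \<Rightarrow> bool" where
  "schwartz f \<longleftrightarrow> smooth_fun f \<and>
     (\<forall>k is. bounded (range (\<lambda>x. norm x ^ k *\<^sub>R pderivs is f x)))"

definition schwartz_seminorm :: "nat \<times> 3 list \<Rightarrow> (real^3 \<Rightarrow> complex) \<Rightarrow> real" where
  "schwartz_seminorm = (\<lambda>(k, is) f. SUP x. norm (norm x ^ k *\<^sub>R pderivs is f x))"

lemma schwartz_seminorm_nonneg:
  assumes "schwartz f"
  shows "0 \<le> schwartz_seminorm a f"
proof -
  obtain k "is" where a: "a = (k, is)"
    by (cases a)
  have "bounded (range (\<lambda>x. norm x ^ k *\<^sub>R pderivs is f x))"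
    using assms unfolding schwartz_def by blast
  then have "bdd_above (range (\<lambda>x. norm (norm x ^ k *\<^sub>R pderivs is f x)))"
    by (auto simp: bounded_iff bdd_above_def)
  then have "norm (norm (0::real^3) ^ k *\<^sub>R pderivs is f 0)
      \<le> (SUP x. norm (norm x ^ k *\<^sub>R pderivs is f x))"
    by (intro cSUP_upper) auto
  from order_trans[OF norm_ge_zero this] show ?thesis
    unfolding schwartz_seminorm_def a by simp
qed

text \<open>
  \<open>\<C>\<^sup>3\<close>-valued tempered distributions: complex-linear maps from Schwartz space to \<open>\<C>\<^sup>3\<close> that
  are bounded by a finite sum of Schwartz seminorms.  The value outside Schwartz space is fixed
  to be 0 only so that equality of functionals is equality on Schwartz space.
\<close>

definition tempered :: "((real^3 \<Rightarrow> complex) \<Rightarrow> complex^3) \<Rightarrow> bool" where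
  "tempered T \<longleftrightarrow>
     (\<forall>f. \<not> schwartz f \<longrightarrow> T f = 0) \<and>
     (\<forall>f g a b. schwartz f \<longrightarrow> schwartz g \<longrightarrow> T (\<lambda>x. a * f x + b * g x) = a *s T f + b *s T g) \<and>
     (\<exists>C A. finite A \<and> (\<forall>f. schwartz f \<longrightarrow> norm (T f) \<le> C * (\<Sum>a\<in>A. schwartz_seminorm a f)))"

typedef tdist = "{T. tempered T}"
  morphisms tdist_apply Abs_tdist
proof
  show "(\<lambda>f. 0) \<in> {T. tempered T}"
    unfolding tempered_def by (auto intro!: exI[of _ "0::real"] exI[of _ "{}"])
qed

setup_lifting type_definition_tdist

instantiation tdist :: minus
begin

lift_definition minus_tdist :: "tdist \<Rightarrow> tdist \<Rightarrow> tdist" is "\<lambda>T U f. T f - U f"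
proof -
  fix T U :: "(real^3 \<Rightarrow> complex) \<Rightarrow> complex^3"
  assume T: "tempered T" and U: "tempered U"
  obtain C A where A: "finite A"
    "\<And>f. schwartz f \<Longrightarrow> norm (T f) \<le> C * (\<Sum>a\<in>A. schwartz_seminorm a f)"
    using T unfolding tempered_def by blast
  obtain D B where B: "finite B"
    "\<And>f. schwartz f \<Longrightarrow> norm (U f) \<le> D * (\<Sum>a\<in>B. schwartz_seminorm a f)"
    using U unfolding tempered_def by blast
  have bd: "norm (T f - U f) \<le> (\<bar>C\<bar> + \<bar>D\<bar>) * (\<Sum>a\<in>A \<union> B. schwartz_seminorm a f)"
    if f: "schwartz f" for f
  proof -
    note nn = schwartz_seminorm_nonneg[OF f]
    have "norm (T f) \<le> \<bar>C\<bar> * (\<Sum>a\<in>A. schwartz_seminorm a f)"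
      by (rule order_trans[OF A(2)[OF f]]) (auto intro!: mult_right_mono sum_nonneg nn)
    also have "\<dots> \<le> \<bar>C\<bar> * (\<Sum>a\<in>A \<union> B. schwartz_seminorm a f)"
      using A(1) B(1) nn by (intro mult_left_mono sum_mono2) auto
    finally have 1: "norm (T f) \<le> \<bar>C\<bar> * (\<Sum>a\<in>A \<union> B. schwartz_seminorm a f)" .
    have "norm (U f) \<le> \<bar>D\<bar> * (\<Sum>a\<in>B. schwartz_seminorm a f)"
      by (rule order_trans[OF B(2)[OF f]]) (auto intro!: mult_right_mono sum_nonneg nn)
    also have "\<dots> \<le> \<bar>D\<bar> * (\<Sum>a\<in>A \<union> B. schwartz_seminorm a f)"
      using A(1) B(1) nn by (intro mult_left_mono sum_mono2) auto
    finally have 2: "norm (U f) \<le> \<bar>D\<bar> * (\<Sum>a\<in>A \<union> B. schwartz_seminorm a f)" .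
    show ?thesis
      using 1 2 norm_triangle_ineq4[of "T f" "U f"] by (simp add: distrib_right)
  qed
  have lin: "T (\<lambda>x. a * f x + b * g x) - U (\<lambda>x. a * f x + b * g x)
      = a *s (T f - U f) + b *s (T g - U g)" if "schwartz f" "schwartz g" for f g a b
  proof -
    have "T (\<lambda>x. a * f x + b * g x) = a *s T f + b *s T g"
      using T that unfolding tempered_def by blast
    moreover have "U (\<lambda>x. a * f x + b * g x) = a *s U f + b *s U g"
      using U that unfolding tempered_def by blast
    ultimately show ?thesis
      by (simp add: vec_eq_iff algebra_simps)
  qed
  have zero: "T f - U f = 0" if "\<not> schwartz f" for f
    using T U that unfolding tempered_def by simp
  have fin: "finite (A \<union> B)"
    using A(1) B(1) by simp
  show "tempered (\<lambda>f. T f - U f)"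
    unfolding tempered_def using zero lin bd fin by blast
qed

instance ..

end

section \<open>Fourier transform\<close>

text \<open>
  The normalisation \<open>(2\<pi>)\<^sup>-\<^sup>3\<close> is the one for which the transform of a product is the
  convolution of the transforms with constant 1 and \<open>\<partial>\<^sub>k\<close> has symbol \<open>i\<xi>\<^sub>k\<close>, as in the Fourier
  formula for the bilinear operator below.
\<close>

definition fourier :: "(real^3 \<Rightarrow> complex) \<Rightarrow> real^3 \<Rightarrow> complex" where
  "fourier f \<xi> = complex_of_real (1 / (2 * pi) ^ 3) * (LINT x|lborel. cis (- (x \<bullet> \<xi>)) * f x)"

text \<open>
  \<open>has_ft T g\<close>: the distributional Fourier transform of \<open>T\<close>, that is \<open>\<psi> \<mapsto> T (fourier \<psi>)\<close>, is the
  locally integrable function \<open>g\<close>.  The integral against \<open>g\<close> need only exist for compactly supported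
  \<open>\<psi>\<close>; those are dense in Schwartz space.
\<close>

definition has_ft :: "tdist \<Rightarrow> (real^3 \<Rightarrow> complex^3) \<Rightarrow> bool" where
  "has_ft T g \<longleftrightarrow>
     g \<in> borel_measurable lborel \<and>
     (\<forall>S. compact S \<longrightarrow> set_integrable lborel S g) \<and>
     (\<forall>\<psi>. test_fun \<psi> \<longrightarrow> tdist_apply T (fourier \<psi>) = (LINT \<xi>|lborel. \<psi> \<xi> *s g \<xi>))"

definition ft :: "tdist \<Rightarrow> real^3 \<Rightarrow> complex^3" where
  "ft T = (SOME g. has_ft T g)"

text \<open>
  For a time-dependent distribution, the Fourier transform as a function of \<open>(t, \<xi>)\<close>.  Since
  \<open>ft (f t)\<close> is chosen separately for each \<open>t\<close>, up to a null set in \<open>\<xi>\<close>, a jointly measurable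
  representative is needed before one can integrate in \<open>t\<close> at fixed \<open>\<xi>\<close>.  It exists for Bochner
  measurable \<open>f\<close> and is unique almost everywhere in \<open>(t, \<xi>)\<close>.
\<close>

definition ft_time :: "(real \<Rightarrow> tdist) \<Rightarrow> real \<Rightarrow> real^3 \<Rightarrow> complex^3" where
  "ft_time f = (SOME g. case_prod g \<in> borel_measurable (lborel \<Otimes>\<^sub>M lborel) \<and>
     (AE t in lborel. 0 \<le> t \<longrightarrow> has_ft (f t) (g t)))"

section \<open>Fourier-Besov spaces\<close>

definition ennreal_powr :: "ennreal \<Rightarrow> real \<Rightarrow> ennreal" where
  "ennreal_powr x r = (if x = \<infinity> then \<infinity> else ennreal (enn2real x powr r))"

definition Lp_norm :: "'a measure \<Rightarrow> ennreal \<Rightarrow> ('a \<Rightarrow> ennreal) \<Rightarrow> ennreal" where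
  "Lp_norm M p f = (if p = \<infinity> then esssup M f
     else ennreal_powr (\<integral>\<^sup>+x. ennreal_powr (f x) (enn2real p) \<partial>M) (1 / enn2real p))"

definition LP_cutoff :: "(real^3 \<Rightarrow> complex) \<Rightarrow> bool" where
  "LP_cutoff \<phi> \<longleftrightarrow> schwartz \<phi> \<and>
     (\<forall>\<xi> \<eta>. norm \<xi> = norm \<eta> \<longrightarrow> \<phi> \<xi> = \<phi> \<eta>) \<and>
     closure {\<xi>. \<phi> \<xi> \<noteq> 0} \<subseteq> {\<xi>. 3/4 \<le> norm \<xi> \<and> norm \<xi> \<le> 8/3} \<and>
     (\<forall>\<xi>. \<xi> \<noteq> 0 \<longrightarrow> ((\<lambda>j::int. \<phi> (2 powr (- of_int j) *\<^sub>R \<xi>)) has_sum 1) UNIV)"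

definition block_norm :: "(real^3 \<Rightarrow> complex) \<Rightarrow> ennreal \<Rightarrow> int \<Rightarrow> (real^3 \<Rightarrow> complex^3) \<Rightarrow> ennreal" where
  "block_norm \<phi> p j g =
     Lp_norm lborel p (\<lambda>\<xi>. ennreal (norm (\<phi> (2 powr (- of_int j) *\<^sub>R \<xi>) *s g \<xi>)))"

text \<open>
  The norms below are written as functions of the Fourier transform, since semigroup and bilinear
  operator are given by their Fourier transforms.
\<close>

definition FB_norm_ft ::
    "(real^3 \<Rightarrow> complex) \<Rightarrow> real \<Rightarrow> ennreal \<Rightarrow> ennreal \<Rightarrow> (real^3 \<Rightarrow> complex^3) \<Rightarrow> ennreal" where
  "FB_norm_ft \<phi> s p q g =
     Lp_norm (count_space UNIV) q (\<lambda>j::int. ennreal (2 powr (of_int j * s)) * block_norm \<phi> p j g)"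

definition FB_norm ::
    "(real^3 \<Rightarrow> complex) \<Rightarrow> real \<Rightarrow> ennreal \<Rightarrow> ennreal \<Rightarrow> tdist \<Rightarrow> ennreal" where
  "FB_norm \<phi> s p q f = FB_norm_ft \<phi> s p q (ft f)"

definition FB_space ::
    "(real^3 \<Rightarrow> complex) \<Rightarrow> real \<Rightarrow> ennreal \<Rightarrow> ennreal \<Rightarrow> tdist set" where
  "FB_space \<phi> s p q = {f. (\<exists>g. has_ft f g) \<and> FB_norm \<phi> s p q f < \<infinity>}"

definition LFB_norm_ft ::
    "(real^3 \<Rightarrow> complex) \<Rightarrow> real \<Rightarrow> ennreal \<Rightarrow> ennreal \<Rightarrow> (real \<Rightarrow> real^3 \<Rightarrow> complex^3) \<Rightarrow> ennreal" where
  "LFB_norm_ft \<phi> s p q g =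
     Lp_norm (count_space UNIV) q (\<lambda>j::int. ennreal (2 powr (of_int j * s)) *
       esssup (lebesgue_on {0..}) (\<lambda>t. block_norm \<phi> p j (g t)))"

definition LFB_norm ::
    "(real^3 \<Rightarrow> complex) \<Rightarrow> real \<Rightarrow> ennreal \<Rightarrow> ennreal \<Rightarrow> (real \<Rightarrow> tdist) \<Rightarrow> ennreal" where
  "LFB_norm \<phi> s p q f = LFB_norm_ft \<phi> s p q (\<lambda>t. ft (f t))"

definition bochner_measurable_FB ::
    "(real^3 \<Rightarrow> complex) \<Rightarrow> real \<Rightarrow> ennreal \<Rightarrow> ennreal \<Rightarrow> (real \<Rightarrow> tdist) \<Rightarrow> bool" where
  "bochner_measurable_FB \<phi> s p q f \<longleftrightarrow>
     (\<exists>\<sigma>. (\<forall>n::nat. simple_function (lebesgue_on {0..}) (\<sigma> n) \<and> (\<forall>t\<ge>0. \<sigma> n t \<in> FB_space \<phi> s p q)) \<and>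
          (AE t in lebesgue_on {0..}. (\<lambda>n. FB_norm \<phi> s p q (\<sigma> n t - f t)) \<longlonglongrightarrow> 0))"

text \<open>Elements are functions defined at every \<open>t \<ge> 0\<close>; values at negative times are irrelevant.\<close>

definition LFB_space ::
    "(real^3 \<Rightarrow> complex) \<Rightarrow> real \<Rightarrow> ennreal \<Rightarrow> ennreal \<Rightarrow> (real \<Rightarrow> tdist) set" where
  "LFB_space \<phi> s p q = {f. (\<forall>t\<ge>0. f t \<in> FB_space \<phi> s p q) \<and>
     bochner_measurable_FB \<phi> s p q f \<and> LFB_norm \<phi> s p q f < \<infinity>}"

section \<open>The fractional Navier-Stokes-Coriolis system\<close>

definition mat_apply :: "real^3^3 \<Rightarrow> complex^3 \<Rightarrow> complex^3" where
  "mat_apply M z = (\<chi> m. \<Sum>k\<in>UNIV. (M $ m $ k) *\<^sub>R (z $ k))"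

definition coriolis_matrix :: "real^3 \<Rightarrow> real^3^3" where
  "coriolis_matrix \<xi> = (1 / norm \<xi>) *\<^sub>R
     vector [vector [0, \<xi>$3, - \<xi>$2],
             vector [- \<xi>$3, 0, \<xi>$1],
             vector [\<xi>$2, - \<xi>$1, 0]]"

definition semigroup_symbol :: "real \<Rightarrow> real \<Rightarrow> real \<Rightarrow> real \<Rightarrow> real^3 \<Rightarrow> real^3^3" where
  "semigroup_symbol \<nu> \<alpha> \<Omega> t \<xi> = exp (- \<nu> * norm \<xi> powr (2 * \<alpha>) * t) *\<^sub>R
     (cos (\<Omega> * (\<xi>$3 / norm \<xi>) * t) *\<^sub>R mat 1 + sin (\<Omega> * (\<xi>$3 / norm \<xi>) * t) *\<^sub>R coriolis_matrix \<xi>)"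

definition leray_symbol :: "real^3 \<Rightarrow> real^3^3" where
  "leray_symbol \<xi> = (\<chi> m k. (if m = k then 1 else 0) - \<xi>$m * \<xi>$k / (norm \<xi>)\<^sup>2)"

text \<open>Fourier transform of \<open>S(t)f\<close>.\<close>

definition semigroup_ft :: "real \<Rightarrow> real \<Rightarrow> real \<Rightarrow> real \<Rightarrow> tdist \<Rightarrow> real^3 \<Rightarrow> complex^3" where
  "semigroup_ft \<nu> \<alpha> \<Omega> t f \<xi> = mat_apply (semigroup_symbol \<nu> \<alpha> \<Omega> t \<xi>) (ft f \<xi>)"

definition convolution :: "(real^3 \<Rightarrow> complex) \<Rightarrow> (real^3 \<Rightarrow> complex) \<Rightarrow> real^3 \<Rightarrow> complex" where
  "convolution f g \<xi> = (LINT \<eta>|lborel. f (\<xi> - \<eta>) * g \<eta>)"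

text \<open>
  Fourier transform of \<open>\<nabla> \<cdot> (v \<otimes> w)\<close>, contracting \<open>\<xi>\<close> with the first index, so that
  \<open>\<nabla> \<cdot> (u \<otimes> u) = u \<cdot> \<nabla>u\<close> for divergence-free \<open>u\<close>.  Contracting with the second index would
  merely exchange \<open>v\<close> and \<open>w\<close>.
\<close>

definition div_tensor_ft ::
    "(real \<Rightarrow> tdist) \<Rightarrow> (real \<Rightarrow> tdist) \<Rightarrow> real \<Rightarrow> real^3 \<Rightarrow> complex^3" where
  "div_tensor_ft v w \<tau> \<xi> = (\<chi> k. \<Sum>m\<in>UNIV. \<i> * complex_of_real (\<xi>$m) *
     convolution (\<lambda>\<eta>. ft_time v \<tau> \<eta> $ m) (\<lambda>\<eta>. ft_time w \<tau> \<eta> $ k) \<xi>)"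

text \<open>Fourier transform of the bilinear operator \<open>B(v,w)(t)\<close>.\<close>

definition bilinear_ft ::
    "real \<Rightarrow> real \<Rightarrow> real \<Rightarrow> (real \<Rightarrow> tdist) \<Rightarrow> (real \<Rightarrow> tdist) \<Rightarrow> real \<Rightarrow> real^3 \<Rightarrow> complex^3" where
  "bilinear_ft \<nu> \<alpha> \<Omega> v w t \<xi> = - (LINT \<tau>:{0..t}|lborel.
     mat_apply (semigroup_symbol \<nu> \<alpha> \<Omega> (t - \<tau>) \<xi>)
       (mat_apply (leray_symbol \<xi>) (div_tensor_ft v w \<tau> \<xi>)))"

definition forcing_ft ::
    "real \<Rightarrow> real \<Rightarrow> real \<Rightarrow> (real \<Rightarrow> tdist) \<Rightarrow> real \<Rightarrow> real^3 \<Rightarrow> complex^3" where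
  "forcing_ft \<nu> \<alpha> \<Omega> F t \<xi> = (LINT \<tau>:{0..t}|lborel.
     mat_apply (semigroup_symbol \<nu> \<alpha> \<Omega> (t - \<tau>) \<xi>)
       (mat_apply (leray_symbol \<xi>) (ft_time F \<tau> \<xi>)))"

definition mild_solution ::
    "real \<Rightarrow> real \<Rightarrow> real \<Rightarrow> tdist \<Rightarrow> (real \<Rightarrow> tdist) \<Rightarrow> (real \<Rightarrow> tdist) \<Rightarrow> bool" where
  "mild_solution \<nu> \<alpha> \<Omega> u0 F u \<longleftrightarrow> (\<forall>t\<ge>0. AE \<xi> in lborel.
     ft (u t) \<xi> = semigroup_ft \<nu> \<alpha> \<Omega> t u0 \<xi> + bilinear_ft \<nu> \<alpha> \<Omega> u u t \<xi> + forcing_ft \<nu> \<alpha> \<Omega> F t \<xi>)"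

end

theory Submission
  imports Defs
begin

text \<open>
  Let \<open>w = u - v\<close> and let \<open>X T\<close> be the norm of \<open>w\<close> cut off to times \<open>t \<ge> T\<close>.  For \<open>t \<ge> T\<close> the
  difference of the two mild equations expresses \<open>w t\<close> by the linear evolution of \<open>u0 - v0\<close>, the
  forcing term of \<open>F - G\<close>, the part of the bilinear integral over \<open>[0, T]\<close>, and the bilinear
  operator applied to the late part of \<open>w\<close>.  By the assumed estimate with \<open>\<epsilon> = 1 / (8 K)\<close> the last
  contribution is at most \<open>X T / 2\<close>.  The other three decay in every frequency block uniformly in the
  block, the integral over \<open>[0, T]\<close> like \<open>T / (t - T)\<close> by the smoothing of the semigroup and the
  product estimate, and they have an \<open>\<ell>\<^sup>q\<close> majorant; hence their late-time norms tend to 0.  Thus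
  \<open>X T' \<le> o(1) + X T / 2\<close> as \<open>T' \<rightarrow> \<infinity>\<close>, which forces \<open>X\<close> to have infimum 0.

  Two points need care.  The Fourier transform of a distribution is only chosen up to null sets, so its
  uniqueness and the existence of a representative jointly measurable in time and frequency have to be
  proved.  The assumed estimate holds for almost every time; the conclusion at every time follows from
  Fatou's lemma, because the bilinear term is continuous in time for almost every frequency.
\<close>

section \<open>Powers and norms with values in the extended reals\<close>

text \<open>The assumed estimate controls only complete Duhamel integrals over [0, t] of functions
  on the whole half-line. The late part of \<open>w\<close> is therefore a new element of the space,
  equal to 0 before \<open>T\<close>. The integral over [0, T] is not covered by the hypothesis and
  needs two tools. Its decay comes from a product estimate proved here, uniform in the block index
  but without summability; its l^q majorant comes from the hypothesis, since it is a complete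
  integral minus a late one. The range of \<alpha> enters in the product estimate: \<alpha> > 1/2
  sums the low frequencies of one factor, and \<alpha> < (5 - 3/p)/4 sums the interactions at
  frequencies above the output.

  The difference of the nonlinear terms is B(w, u) + B(v, w); with \<open>u\<close> and
  \<open>v\<close> of norm at most 2\<epsilon> the late contribution has the factor 4K\<epsilon>,
  which explains \<epsilon> = 1/(8K). The norm takes the supremum over time before the l^q sum, so
  smallness at each single time is too weak, and all decay is stated for suprema over late
  times.\<close>

lemma ennreal_powr_ennreal: "0 \<le> x \<Longrightarrow> ennreal_powr (ennreal x) r = ennreal (x powr r)"
  by (simp add: ennreal_powr_def)

lemma ennreal_powr_top [simp]: "ennreal_powr top r = top"
  by (simp add: ennreal_powr_def)

lemma ennreal_powr_0 [simp]: "ennreal_powr 0 r = 0"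
  by (simp add: ennreal_powr_def)

lemma ennreal_powr_one [simp]: "ennreal_powr x 1 = x"
  by (cases x) (auto simp: ennreal_powr_ennreal)

lemma ennreal_powr_eq_0_iff [simp]: "ennreal_powr x r = 0 \<longleftrightarrow> x = 0"
  by (cases x) (auto simp: ennreal_powr_ennreal)

lemma ennreal_powr_eq_top_iff [simp]: "ennreal_powr x r = top \<longleftrightarrow> x = top"
  by (cases x) (auto simp: ennreal_powr_ennreal)

lemma ennreal_powr_powr:
  "ennreal_powr (ennreal_powr x a) b = ennreal_powr x (a * b)"
  by (cases x) (auto simp: ennreal_powr_ennreal powr_powr)

lemma ennreal_powr_mult:
  "ennreal_powr (x * y) r = ennreal_powr x r * ennreal_powr y r"
proof (cases "x = top \<or> y = top")
  case True
  then show ?thesis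
    by (auto simp: ennreal_top_mult ennreal_mult_top)
next
  case False
  then show ?thesis
    by (cases x; cases y)
      (auto simp: ennreal_powr_ennreal powr_mult ennreal_mult'[symmetric])
qed

lemma ennreal_powr_mono: "0 < r \<Longrightarrow> x \<le> y \<Longrightarrow> ennreal_powr x r \<le> ennreal_powr y r"
  by (cases x; cases y) (auto simp: ennreal_powr_ennreal powr_mono2 top_unique)

lemma ennreal_powr_le_iff: "0 < r \<Longrightarrow> ennreal_powr x r \<le> ennreal_powr y r \<longleftrightarrow> x \<le> y"
  using ennreal_powr_mono[of r x y] ennreal_powr_mono[of "1/r" "ennreal_powr x r" "ennreal_powr y r"]
  by (auto simp: ennreal_powr_powr)

lemma ennreal_powr_less_iff: "0 < r \<Longrightarrow> ennreal_powr x r < ennreal_powr y r \<longleftrightarrow> x < y"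
  using ennreal_powr_le_iff[of r y x] by (simp add: not_le[symmetric])

lemma ennreal_powr_le_swap: "0 < r \<Longrightarrow> ennreal_powr x (1 / r) \<le> y \<longleftrightarrow> x \<le> ennreal_powr y r"
  using ennreal_powr_le_iff[of r "ennreal_powr x (1 / r)" y] by (simp add: ennreal_powr_powr)

lemma borel_measurable_ennreal_powr [measurable]:
  assumes [measurable]: "f \<in> borel_measurable M"
  shows "(\<lambda>x. ennreal_powr (f x) r) \<in> borel_measurable M"
  unfolding ennreal_powr_def by measurable

text \<open>For a positive exponent the power is an order isomorphism with inverse exponent
  \<open>1 / r\<close>, so order neighbourhoods are carried over directly and the value
  \<open>top\<close> needs no separate treatment.\<close>

lemma tendsto_ennreal_powr:
  assumes r: "0 < r" and f: "(f \<longlongrightarrow> x) F"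
  shows "((\<lambda>i. ennreal_powr (f i) r) \<longlongrightarrow> ennreal_powr x r) F"
proof (rule order_tendstoI)
  have inv: "a = ennreal_powr (ennreal_powr a (1 / r)) r" for a
    using r by (simp add: ennreal_powr_powr)
  {
    fix a assume "a < ennreal_powr x r"
    then have "ennreal_powr a (1 / r) < x"
      by (subst (asm) inv) (simp add: ennreal_powr_less_iff r)
    then have "\<forall>\<^sub>F i in F. ennreal_powr a (1 / r) < f i"
      by (rule order_tendstoD(1)[OF f])
    then show "\<forall>\<^sub>F i in F. a < ennreal_powr (f i) r"
      by (subst inv) (simp add: ennreal_powr_less_iff r)
  next
    fix a assume "ennreal_powr x r < a"
    then have "x < ennreal_powr a (1 / r)"
      by (subst (asm) inv) (simp add: ennreal_powr_less_iff r)
    then have "\<forall>\<^sub>F i in F. f i < ennreal_powr a (1 / r)"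
      by (rule order_tendstoD(2)[OF f])
    then show "\<forall>\<^sub>F i in F. ennreal_powr (f i) r < a"
      by (subst inv) (simp add: ennreal_powr_less_iff r)
  }
qed

lemma enn2real_ge_1: "1 \<le> p \<Longrightarrow> p \<noteq> top \<Longrightarrow> 1 \<le> enn2real p"
  by (cases p) auto

section \<open>Lebesgue norms of extended-valued functions\<close>

lemma Lp_norm_top_le_iff:
  assumes [measurable]: "f \<in> borel_measurable M"
  shows "Lp_norm M top f \<le> c \<longleftrightarrow> (AE x in M. f x \<le> c)"
proof
  assume "Lp_norm M top f \<le> c"
  then have "esssup M f \<le> c"
    by (simp add: Lp_norm_def)
  with esssup_AE[of f M] show "AE x in M. f x \<le> c"
    by (auto elim: eventually_mono)
qed (auto simp: Lp_norm_def intro: esssup_I)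

text \<open>Comparison with an arbitrary \<open>c\<close> removes the outer root: for finite
  \<open>p\<close> norm bounds become bounds of integrals, parallel to the pointwise bound at
  infinity.\<close>

lemma Lp_norm_finite_le_iff:
  assumes "1 \<le> p" "p \<noteq> top"
  shows "Lp_norm M p f \<le> c \<longleftrightarrow>
    (\<integral>\<^sup>+x. ennreal_powr (f x) (enn2real p) \<partial>M) \<le> ennreal_powr c (enn2real p)"
  using enn2real_ge_1[OF assms] assms by (simp add: Lp_norm_def ennreal_powr_le_swap)

lemma Lp_norm_mono_AE:
  assumes p: "1 \<le> p" and [measurable]: "f \<in> borel_measurable M" and le: "AE x in M. f x \<le> g x"
  shows "Lp_norm M p f \<le> Lp_norm M p g"
proof (cases "p = top")
  case True
  then show ?thesis
    using le by (auto simp: Lp_norm_def intro: esssup_AE_mono)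
next
  case False
  note P = enn2real_ge_1[OF p False]
  show ?thesis
    unfolding Lp_norm_def using False P
    by (auto intro!: ennreal_powr_mono nn_integral_mono_AE eventually_mono[OF le])
qed

lemma Lp_norm_mono:
  assumes "1 \<le> p" "f \<in> borel_measurable M" "\<And>x. f x \<le> g x"
  shows "Lp_norm M p f \<le> Lp_norm M p g"
  using assms by (intro Lp_norm_mono_AE) auto

lemma Lp_norm_cmult_le:
  assumes p: "1 \<le> p" and [measurable]: "f \<in> borel_measurable M"
  shows "Lp_norm M p (\<lambda>x. c * f x) \<le> c * Lp_norm M p f"
proof (cases "p = top")
  case True
  have "AE x in M. f x \<le> Lp_norm M p f"
    using Lp_norm_top_le_iff[of f M "Lp_norm M p f"] True by simp
  then show ?thesis
    unfolding True by (subst Lp_norm_top_le_iff) (auto elim!: eventually_mono intro: mult_left_mono)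
next
  case False
  note P = enn2real_ge_1[OF p False]
  have "(\<integral>\<^sup>+x. ennreal_powr (f x) (enn2real p) \<partial>M) \<le> ennreal_powr (Lp_norm M p f) (enn2real p)"
    using Lp_norm_finite_le_iff[OF p False] by blast
  then show ?thesis
    unfolding Lp_norm_finite_le_iff[OF p False] ennreal_powr_mult
    by (subst nn_integral_cmult) (auto intro: mult_left_mono)
qed

lemma Lp_norm_zero_AE:
  assumes p: "1 \<le> p" and [measurable]: "f \<in> borel_measurable M"
  shows "Lp_norm M p f = 0 \<longleftrightarrow> (AE x in M. f x = 0)"
proof (cases "p = top")
  case True
  then show ?thesis
    using Lp_norm_top_le_iff[of f M 0] by simp
next
  case False
  note P = enn2real_ge_1[OF p False]
  have "Lp_norm M p f = 0 \<longleftrightarrow> Lp_norm M p f \<le> 0"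
    by simp
  also have "\<dots> \<longleftrightarrow> (AE x in M. f x = 0)"
    unfolding Lp_norm_finite_le_iff[OF p False] by (simp add: nn_integral_0_iff_AE)
  finally show ?thesis .
qed

lemma AE_finite_of_Lp_norm:
  assumes p: "1 \<le> p" and [measurable]: "f \<in> borel_measurable M" and fin: "Lp_norm M p f < top"
  shows "AE x in M. f x < top"
proof (cases "p = top")
  case True
  with fin Lp_norm_top_le_iff[of f M "Lp_norm M p f"] show ?thesis
    by (auto elim!: eventually_mono)
next
  case False
  note P = enn2real_ge_1[OF p False]
  have "(\<integral>\<^sup>+x. ennreal_powr (f x) (enn2real p) \<partial>M) \<noteq> \<infinity>"
    using fin False by (auto simp: Lp_norm_def)
  then have "AE x in M. ennreal_powr (f x) (enn2real p) \<noteq> \<infinity>"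
    by (intro nn_integral_PInf_AE) auto
  then show ?thesis
    by (auto elim!: eventually_mono simp: less_top)
qed

text \<open>For infinite \<open>p\<close> the bounds hold together off one null set and pass to the
  limit; otherwise this is Fatou's lemma for the powers, which uses continuity of
  \<open>ennreal_powr\<close> also at infinity.\<close>

lemma Lp_norm_Fatou:
  fixes f :: "nat \<Rightarrow> 'a \<Rightarrow> ennreal"
  assumes p: "1 \<le> p" and [measurable]: "\<And>n. f n \<in> borel_measurable M" "g \<in> borel_measurable M"
    and conv: "AE x in M. (\<lambda>n. f n x) \<longlonglongrightarrow> g x" and le: "\<And>n. Lp_norm M p (f n) \<le> c"
  shows "Lp_norm M p g \<le> c"
proof (cases "p = top")
  case True
  have "AE x in M. \<forall>n. f n x \<le> c"
    unfolding AE_all_countable using le[unfolded True] by (simp add: Lp_norm_top_le_iff)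
  with conv have "AE x in M. g x \<le> c"
    by eventually_elim (auto intro: LIMSEQ_le_const2)
  then show ?thesis
    unfolding True by (simp add: Lp_norm_top_le_iff)
next
  case False
  note P = enn2real_ge_1[OF p False]
  let ?P = "enn2real p"
  have "(\<integral>\<^sup>+x. ennreal_powr (g x) ?P \<partial>M) = (\<integral>\<^sup>+x. liminf (\<lambda>n. ennreal_powr (f n x) ?P) \<partial>M)"
  proof (rule nn_integral_cong_AE)
    from conv show "AE x in M. ennreal_powr (g x) ?P = liminf (\<lambda>n. ennreal_powr (f n x) ?P)"
    proof eventually_elim
      case (elim x)
      from tendsto_ennreal_powr[OF _ elim, of ?P] P show ?case
        by (intro lim_imp_Liminf[symmetric]) auto
    qed
  qed
  also have "\<dots> \<le> liminf (\<lambda>n. \<integral>\<^sup>+x. ennreal_powr (f n x) ?P \<partial>M)"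
    by (rule nn_integral_liminf) simp
  also have "\<dots> \<le> ennreal_powr c ?P"
    using le unfolding Lp_norm_finite_le_iff[OF p False]
    by (intro Liminf_le) (auto intro: always_eventually)
  finally show ?thesis
    unfolding Lp_norm_finite_le_iff[OF p False] .
qed

text \<open>The convex function x^P lies above its tangent at \<open>l\<close>, solved here for
  \<open>x\<close>. The right-hand side is affine in x^P, so it can be integrated against a
  weight.\<close>

lemma powr_tangent_bound:
  fixes x l P :: real
  assumes "0 \<le> x" "0 < l" "1 \<le> P"
  shows "x \<le> l * (1 - 1 / P) + l powr (1 - P) / P * x powr P"
proof (cases "x = 0")
  case False
  have "(x powr P) powr (1/P) * (l powr P) powr (1 - 1/P) \<le> 1/P * x powr P + (1 - 1/P) * l powr P"
    using assms False by (intro Youngs_inequality_0) auto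
  moreover have "(x powr P) powr (1/P) = x" "(l powr P) powr (1 - 1/P) = l powr (P - 1)"
    using assms by (auto simp: powr_powr algebra_simps)
  ultimately have "l powr (1 - P) * (x * l powr (P - 1)) \<le>
      l powr (1 - P) * (1/P * x powr P + (1 - 1/P) * l powr P)"
    by (intro mult_left_mono) auto
  moreover have "l powr (1 - P) * l powr (P - 1) = 1" "l powr (1 - P) * l powr P = l"
    using assms by (auto simp flip: powr_add)
  then have "l powr (1 - P) * (x * l powr (P - 1)) = x"
    "l powr (1 - P) * (1/P * x powr P + (1 - 1/P) * l powr P) =
      l * (1 - 1 / P) + l powr (1 - P) / P * x powr P"
    by (simp_all only: distrib_left mult.left_commute[of "l powr (1 - P)"]) (simp_all add: algebra_simps)
  ultimately show ?thesis
    by simp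
qed (use assms in auto)

text \<open>The tangent bound is integrated against \<open>k\<close>, instead of normalising
  \<open>k\<close> to a probability measure; this also copes with infinite values of
  \<open>f\<close>.\<close>

lemma Jensen_powr_nn_integral:
  assumes [measurable]: "k \<in> borel_measurable M" "f \<in> borel_measurable M"
    and P: "1 \<le> P" and K: "(\<integral>\<^sup>+x. k x \<partial>M) = K" "0 < K" "K < top"
  shows "ennreal_powr (\<integral>\<^sup>+x. k x * f x \<partial>M) P
    \<le> ennreal_powr K P * ((\<integral>\<^sup>+x. k x * ennreal_powr (f x) P \<partial>M) / K)"
proof -
  define A where "A = (\<integral>\<^sup>+x. k x * ennreal_powr (f x) P \<partial>M) / K"
  have KA: "(\<integral>\<^sup>+x. k x * ennreal_powr (f x) P \<partial>M) = K * A"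
    unfolding A_def using K(2,3)
    by (subst ennreal_times_divide, subst mult.commute) (auto simp: mult_divide_eq_ennreal)
  obtain m where m: "K = ennreal m" "0 < m"
    using K by (cases K) auto
  consider "A = top" | "A = 0" | "0 < A" "A < top"
    by (metis less_top not_gr_zero)
  then have "ennreal_powr (\<integral>\<^sup>+x. k x * f x \<partial>M) P \<le> ennreal_powr K P * A"
  proof cases
    case 1
    then show ?thesis
      using K by (simp add: ennreal_mult_top)
  next
    case 2
    then have "AE x in M. k x * ennreal_powr (f x) P = 0"
      using KA by (subst nn_integral_0_iff_AE[symmetric]) auto
    then have "AE x in M. k x * f x = 0"
      by eventually_elim auto
    then have "(\<integral>\<^sup>+x. k x * f x \<partial>M) = 0"
      by (subst nn_integral_0_iff_AE) auto
    then show ?thesis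
      by simp
  next
    case 3
    then obtain a where a: "A = ennreal a" "0 < a"
      by (cases A) auto
    \<comment> \<open>The tangent point is the weighted P-mean of \<open>f\<close>, for which the
      integrated bound collapses to \<open>m * l\<close>.\<close>
    define l where "l = a powr (1 / P)"
    have l: "0 < l" "l powr P = a"
      using a P by (auto simp: l_def powr_powr)
    have pw: "f x \<le> ennreal (l * (1 - 1 / P)) + ennreal (l powr (1 - P) / P) * ennreal_powr (f x) P" for x
    proof (cases "f x")
      case (real y)
      have "y \<le> l * (1 - 1 / P) + l powr (1 - P) / P * y powr P"
        using real l P by (intro powr_tangent_bound) auto
      then show ?thesis
        using real l P by (simp add: ennreal_powr_ennreal flip: ennreal_plus ennreal_mult'')
    next
      case top
      then show ?thesis
        using l P by (simp add: ennreal_mult_top)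
    qed
    have "(\<integral>\<^sup>+x. k x * f x \<partial>M) \<le>
       (\<integral>\<^sup>+x. ennreal (l * (1 - 1 / P)) * k x + ennreal (l powr (1 - P) / P) * (k x * ennreal_powr (f x) P) \<partial>M)"
      by (intro nn_integral_mono order_trans[OF mult_left_mono[OF pw]]) (auto simp: algebra_simps)
    also have "\<dots> = ennreal (l * (1 - 1 / P)) * K + ennreal (l powr (1 - P) / P) * (K * A)"
      by (simp add: nn_integral_add nn_integral_cmult KA K)
    also have "\<dots> = ennreal (m * l)"
    proof -
      have "l powr (1 - P) * a = l"
        using l by (simp flip: l(2) powr_add)
      then have "l * (1 - 1 / P) * m + l powr (1 - P) / P * (m * a) = m * l"
        using P by (simp add: field_simps)
      then show ?thesis
        using l P m a by (simp flip: ennreal_plus ennreal_mult'')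
    qed
    finally have "ennreal_powr (\<integral>\<^sup>+x. k x * f x \<partial>M) P \<le> ennreal_powr (ennreal (m * l)) P"
      using P by (intro ennreal_powr_mono) auto
    also have "\<dots> = ennreal_powr K P * A"
      using l m a by (simp add: ennreal_powr_ennreal powr_mult flip: ennreal_mult'')
    finally show ?thesis .
  qed
  then show ?thesis
    by (simp add: A_def)
qed

text \<open>The common source of the triangle inequality, of Young's inequality and of the Duhamel
  bounds, by the choice of \<open>M\<close> and \<open>k\<close>. With one bound \<open>c\<close>
  for all slices, Jensen in the first variable and Tonelli suffice. Slices with
  \<open>k x = 0\<close> are exempt because in a time integral the bound is known only on the
  window.\<close>

lemma Minkowski_integral_kernel:
  assumes p: "1 \<le> p" and M: "sigma_finite_measure M" and N: "sigma_finite_measure N"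
    and [measurable]: "k \<in> borel_measurable M" "case_prod h \<in> borel_measurable (M \<Otimes>\<^sub>M N)"
    and K: "(\<integral>\<^sup>+x. k x \<partial>M) < top"
    and le: "AE x in M. k x \<noteq> 0 \<longrightarrow> Lp_norm N p (h x) \<le> c"
  shows "Lp_norm N p (\<lambda>y. \<integral>\<^sup>+x. k x * h x y \<partial>M) \<le> (\<integral>\<^sup>+x. k x \<partial>M) * c"
proof -
  interpret M: sigma_finite_measure M by fact
  interpret N: sigma_finite_measure N by fact
  interpret pair_sigma_finite M N ..
  define K where "K = (\<integral>\<^sup>+x. k x \<partial>M)"
  show ?thesis
  proof (cases "K = 0")
    case True
    then have "AE x in M. k x = 0"
      unfolding K_def by (subst nn_integral_0_iff_AE[symmetric]) auto
    then have "(\<integral>\<^sup>+x. k x * h x y \<partial>M) = (\<integral>\<^sup>+x. 0 \<partial>M)" for y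
      by (intro nn_integral_cong_AE) (auto elim: eventually_mono)
    moreover have "Lp_norm N p (\<lambda>y. 0) = 0"
      using p by (subst Lp_norm_zero_AE) auto
    ultimately show ?thesis
      by simp
  next
    case False
    show ?thesis
    proof (cases "p = top")
      case True
      have "AE x in M. AE y in N. k x * h x y \<le> k x * c"
        using le AE_space
      proof eventually_elim
        case (elim x)
        have [measurable]: "h x \<in> borel_measurable N"
          using elim(2) by measurable
        show ?case
        proof (cases "k x = 0")
          case False
          with elim True have "AE y in N. h x y \<le> c"
            by (simp add: Lp_norm_top_le_iff)
          then show ?thesis
            by eventually_elim (rule mult_left_mono, auto)
        qed auto
      qed
      then have "AE y in N. AE x in M. k x * h x y \<le> k x * c"
        by (subst AE_commute[symmetric]) auto
      then have "AE y in N. (\<integral>\<^sup>+x. k x * h x y \<partial>M) \<le> K * c"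
        using AE_space
      proof eventually_elim
        case (elim y)
        have "(\<integral>\<^sup>+x. k x * h x y \<partial>M) \<le> (\<integral>\<^sup>+x. k x * c \<partial>M)"
          using elim by (intro nn_integral_mono_AE) auto
        then show ?case
          by (simp add: nn_integral_multc K_def)
      qed
      then show ?thesis
        unfolding True K_def by (subst Lp_norm_top_le_iff) auto
    next
      case fin: False
      note P = enn2real_ge_1[OF p fin]
      let ?P = "enn2real p"
      have K0: "0 < K" "K < top"
        using False K by (auto simp: K_def zero_less_iff_neq_zero)
      have "(\<integral>\<^sup>+y. ennreal_powr (\<integral>\<^sup>+x. k x * h x y \<partial>M) ?P \<partial>N) \<le>
        (\<integral>\<^sup>+y. ennreal_powr K ?P * ((\<integral>\<^sup>+x. k x * ennreal_powr (h x y) ?P \<partial>M) / K) \<partial>N)"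
        using K0 P by (intro nn_integral_mono Jensen_powr_nn_integral) (auto simp: K_def)
      also have "\<dots> = ennreal_powr K ?P * ((\<integral>\<^sup>+y. \<integral>\<^sup>+x. k x * ennreal_powr (h x y) ?P \<partial>M \<partial>N) / K)"
        by (simp add: nn_integral_cmult nn_integral_divide)
      also have "(\<integral>\<^sup>+y. \<integral>\<^sup>+x. k x * ennreal_powr (h x y) ?P \<partial>M \<partial>N) =
          (\<integral>\<^sup>+x. \<integral>\<^sup>+y. k x * ennreal_powr (h x y) ?P \<partial>N \<partial>M)"
        by (rule Fubini') measurable
      also have "\<dots> \<le> (\<integral>\<^sup>+x. k x * ennreal_powr c ?P \<partial>M)"
      proof (rule nn_integral_mono_AE, use le AE_space in eventually_elim)
        fix x assume x: "k x \<noteq> 0 \<longrightarrow> Lp_norm N p (h x) \<le> c" "x \<in> space M"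
        then have [measurable]: "h x \<in> borel_measurable N"
          by measurable
        have "(\<integral>\<^sup>+y. k x * ennreal_powr (h x y) ?P \<partial>N) = k x * (\<integral>\<^sup>+y. ennreal_powr (h x y) ?P \<partial>N)"
          by (rule nn_integral_cmult) measurable
        also have "\<dots> \<le> k x * ennreal_powr c ?P"
          using x by (cases "k x = 0") (auto simp: Lp_norm_finite_le_iff[OF p fin] intro: mult_left_mono)
        finally show "(\<integral>\<^sup>+y. k x * ennreal_powr (h x y) ?P \<partial>N) \<le> k x * ennreal_powr c ?P" .
      qed
      also have "\<dots> = K * ennreal_powr c ?P"
        by (simp add: nn_integral_multc K_def)
      also have "K * ennreal_powr c ?P / K = ennreal_powr c ?P"
        using K0 by (subst mult.commute) (auto simp: mult_divide_eq_ennreal)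
      finally show ?thesis
        unfolding K_def[symmetric] Lp_norm_finite_le_iff[OF p fin] ennreal_powr_mult
        by (simp add: divide_right_mono_ennreal mult_left_mono)
    qed
  qed
qed

lemma Lp_norm_weighted_sum:
  fixes w :: "'i::countable \<Rightarrow> ennreal"
  assumes p: "1 \<le> p" and N: "sigma_finite_measure N"
    and [measurable]: "\<And>i. h i \<in> borel_measurable N"
    and K: "(\<integral>\<^sup>+i. w i \<partial>count_space UNIV) < top"
    and le: "\<And>i. Lp_norm N p (h i) \<le> c"
  shows "Lp_norm N p (\<lambda>y. \<integral>\<^sup>+i. w i * h i y \<partial>count_space UNIV) \<le> (\<integral>\<^sup>+i. w i \<partial>count_space UNIV) * c"
proof (rule Minkowski_integral_kernel[OF p _ N _ _ K])
  show "sigma_finite_measure (count_space (UNIV :: 'i set))"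
    by (rule sigma_finite_measure_count_space_countable) auto
  show "case_prod h \<in> borel_measurable (count_space UNIV \<Otimes>\<^sub>M N)"
    by (rule measurable_pair_measure_countable1) auto
qed (use le in auto)

text \<open>Minkowski on a two-point space: \<open>f\<close> and \<open>g\<close> are divided by
  slightly more than their norms, which then return as weights.\<close>

lemma Lp_norm_triangle:
  assumes p: "1 \<le> p" and N: "sigma_finite_measure N"
    and [measurable]: "f \<in> borel_measurable N" "g \<in> borel_measurable N"
  shows "Lp_norm N p (\<lambda>x. f x + g x) \<le> Lp_norm N p f + Lp_norm N p g"
proof (rule ennreal_le_epsilon)
  fix e :: real assume e: "0 < e" and fin: "Lp_norm N p f + Lp_norm N p g < top"
  \<comment> \<open>The extra \<open>e / 2\<close> keeps both weights positive, so they can be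
    inverted even if a norm vanishes.\<close>
  define a where "a = Lp_norm N p f + ennreal (e / 2)"
  define b where "b = Lp_norm N p g + ennreal (e / 2)"
  define w where "w = (\<lambda>i. if i then a else b)"
  define h where "h = (\<lambda>i x. if i then inverse a * f x else inverse b * g x)"
  have ab: "0 < a" "a < top" "0 < b" "b < top"
    using fin e by (auto simp: a_def b_def add_pos_nonneg intro!: add_nonneg_pos)
  have unit: "c * (inverse c * y) = y" if "0 < c" "c < top" for c y :: ennreal
    using that ennreal_divide_self[of c] by (simp add: divide_ennreal_def mult.assoc[symmetric])
  have unit': "inverse c * y \<le> 1" if "0 < c" "c < top" "y \<le> c" for c y :: ennreal
    using that ennreal_divide_self[of c] divide_right_mono_ennreal[of y c c]
    by (simp add: divide_ennreal_def mult.commute)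
  have "Lp_norm N p (\<lambda>y. \<integral>\<^sup>+i. w i * h i y \<partial>count_space UNIV) \<le> (\<integral>\<^sup>+i. w i \<partial>count_space UNIV) * 1"
  proof (rule Lp_norm_weighted_sum[OF p N])
    show "h i \<in> borel_measurable N" for i
      by (cases i) (auto simp: h_def)
    show "(\<integral>\<^sup>+i. w i \<partial>count_space UNIV) < top"
      using ab by (simp add: nn_integral_count_space_finite UNIV_bool w_def)
    have "Lp_norm N p (\<lambda>x. inverse a * f x) \<le> inverse a * Lp_norm N p f"
      using p by (intro Lp_norm_cmult_le) auto
    also have "\<dots> \<le> 1"
      using ab by (intro unit') (auto simp: a_def)
    finally have 1: "Lp_norm N p (\<lambda>x. inverse a * f x) \<le> 1" .
    have "Lp_norm N p (\<lambda>x. inverse b * g x) \<le> inverse b * Lp_norm N p g"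
      using p by (intro Lp_norm_cmult_le) auto
    also have "\<dots> \<le> 1"
      using ab by (intro unit') (auto simp: b_def)
    finally show "Lp_norm N p (h i) \<le> 1" for i
      using 1 by (cases i) (auto simp: h_def)
  qed
  then have "Lp_norm N p (\<lambda>x. f x + g x) \<le> a + b"
    using ab by (simp add: nn_integral_count_space_finite UNIV_bool w_def h_def unit add.commute)
  also have "\<dots> = Lp_norm N p f + Lp_norm N p g + ennreal e"
    using e by (simp add: a_def b_def algebra_simps flip: ennreal_plus)
  finally show "Lp_norm N p (\<lambda>x. f x + g x) \<le> Lp_norm N p f + Lp_norm N p g + ennreal e" .
qed

text \<open>For finite \<open>p\<close> the integrals of the p-th powers are summable, so the sum of
  the powers is finite almost everywhere and its terms tend to 0.\<close>

lemma Lp_norm_fast_convergence_AE: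
  assumes p: "1 \<le> p" and [measurable]: "\<And>n. h n \<in> borel_measurable M"
    and le: "\<And>n. Lp_norm M p (h n) \<le> c * ennreal ((1/2) ^ n)" and c: "c < top"
  shows "AE x in M. (\<lambda>n. h n x) \<longlonglongrightarrow> 0"
proof (cases "p = top")
  case True
  have lim: "(\<lambda>n. c * ennreal ((1/2) ^ n)) \<longlonglongrightarrow> c * ennreal 0"
    using c by (intro ennreal_tendsto_cmult tendsto_ennrealI LIMSEQ_power_zero) auto
  have "AE x in M. \<forall>n. h n x \<le> c * ennreal ((1/2) ^ n)"
    unfolding AE_all_countable using le[unfolded True] by (simp add: Lp_norm_top_le_iff)
  then show ?thesis
  proof eventually_elim
    case (elim x)
    then show ?case
      using lim by (intro tendsto_sandwich[of "\<lambda>_. 0" "\<lambda>n. h n x" _ "\<lambda>n. c * ennreal ((1/2) ^ n)"]) auto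
  qed
next
  case False
  note P = enn2real_ge_1[OF p False]
  let ?P = "enn2real p"
  obtain C where C: "c = ennreal C" "0 \<le> C"
    using c by (cases c) auto
  have ratio: "((1/2::real) powr ?P) ^ n = ((1/2) ^ n) powr ?P" for n
    by (simp add: powr_powr powr_realpow[symmetric] mult.commute)
  have "(\<integral>\<^sup>+x. (\<Sum>n. ennreal_powr (h n x) ?P) \<partial>M) = (\<Sum>n. \<integral>\<^sup>+x. ennreal_powr (h n x) ?P \<partial>M)"
    by (rule nn_integral_suminf) simp
  also have "\<dots> \<le> (\<Sum>n. ennreal (C powr ?P * ((1/2) powr ?P) ^ n))"
  proof (intro suminf_le allI)
    fix n
    have "(\<integral>\<^sup>+x. ennreal_powr (h n x) ?P \<partial>M) \<le> ennreal_powr (c * ennreal ((1/2) ^ n)) ?P"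
      using le unfolding Lp_norm_finite_le_iff[OF p False] .
    then show "(\<integral>\<^sup>+x. ennreal_powr (h n x) ?P \<partial>M) \<le> ennreal (C powr ?P * ((1/2) powr ?P) ^ n)"
      using C by (simp add: ennreal_powr_mult ennreal_powr_ennreal ratio ennreal_mult')
  qed auto
  also have "\<dots> < top"
  proof -
    have "summable (\<lambda>n. C powr ?P * ((1/2) powr ?P) ^ n)"
      using P powr_less_mono2_neg[of "-?P" 1 2]
      by (intro summable_mult summable_geometric) (auto simp: powr_minus_divide powr_divide)
    then show ?thesis
      by (subst suminf_ennreal2) auto
  qed
  finally have "AE x in M. (\<Sum>n. ennreal_powr (h n x) ?P) \<noteq> \<infinity>"
    by (intro nn_integral_PInf_AE) (auto simp: less_top)
  then show ?thesis
  proof eventually_elim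
    case (elim x)
    have fin: "ennreal_powr (h n x) ?P \<noteq> top" for n
      using elim sum_le_suminf[of "\<lambda>n. ennreal_powr (h n x) ?P" "{n}"] by (auto simp: top_unique)
    define y where "y = (\<lambda>n. enn2real (ennreal_powr (h n x) ?P))"
    have y: "ennreal_powr (h n x) ?P = ennreal (y n)" "0 \<le> y n" for n
      using fin[of n] unfolding y_def by (auto simp: less_top simp del: ennreal_powr_eq_top_iff)
    have "summable y"
      using elim y by (intro summable_suminf_not_top) auto
    then have "(\<lambda>n. ennreal_powr (h n x) ?P) \<longlonglongrightarrow> 0"
      unfolding y using tendsto_ennrealI[OF summable_LIMSEQ_zero] by fastforce
    then have "(\<lambda>n. ennreal_powr (ennreal_powr (h n x) ?P) (1 / ?P)) \<longlonglongrightarrow> ennreal_powr 0 (1 / ?P)"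
      using P by (intro tendsto_ennreal_powr) auto
    then show ?case
      using P by (simp add: ennreal_powr_powr)
  qed
qed

lemma le_lq_norm:
  fixes a :: "'i \<Rightarrow> ennreal"
  assumes q: "1 \<le> q"
  shows "a i \<le> Lp_norm (count_space UNIV) q a"
proof (cases "q = top")
  case True
  then show ?thesis
    using Lp_norm_top_le_iff[of a "count_space UNIV" "Lp_norm (count_space UNIV) q a"]
    by (auto simp: AE_count_space)
next
  case False
  note Q = enn2real_ge_1[OF q False]
  let ?Q = "enn2real q"
  have "ennreal_powr (a i) ?Q = (\<integral>\<^sup>+j. ennreal_powr (a j) ?Q * indicator {i} j \<partial>count_space UNIV)"
    by (subst nn_integral_indicator_singleton) auto
  also have "\<dots> \<le> (\<integral>\<^sup>+j. ennreal_powr (a j) ?Q \<partial>count_space UNIV)"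
    by (intro nn_integral_mono) (auto split: split_indicator)
  also have "\<dots> \<le> ennreal_powr (Lp_norm (count_space UNIV) q a) ?Q"
    using Lp_norm_finite_le_iff[OF q False] by blast
  finally show ?thesis
    using Q by (simp add: ennreal_powr_le_iff)
qed

lemma lq_norm_top: "Lp_norm (count_space UNIV) top a = (SUP i. a i)"
proof (rule antisym)
  show "Lp_norm (count_space UNIV) top a \<le> (SUP i. a i)"
    by (subst Lp_norm_top_le_iff) (auto simp: AE_count_space intro: SUP_upper)
  show "(SUP i. a i) \<le> Lp_norm (count_space UNIV) top a"
    by (intro SUP_least le_lq_norm) auto
qed

lemma lq_norm_tendsto_zero:
  fixes a :: "nat \<Rightarrow> 'i \<Rightarrow> ennreal"
  assumes q: "1 \<le> q" and fin: "Lp_norm (count_space UNIV) q b < top"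
    and dom: "\<And>n i. a n i \<le> b i" and lim: "(\<lambda>n. SUP i. a n i) \<longlonglongrightarrow> 0"
  shows "(\<lambda>n. Lp_norm (count_space UNIV) q (a n)) \<longlonglongrightarrow> 0"
proof (cases "q = top")
  case True
  with lim show ?thesis
    by (simp only: lq_norm_top)
next
  case False
  note Q = enn2real_ge_1[OF q False]
  let ?Q = "enn2real q"
  have lim': "(\<lambda>n. a n i) \<longlonglongrightarrow> 0" for i
    by (rule tendsto_sandwich[OF _ _ tendsto_const lim]) (auto intro: always_eventually SUP_upper)
  have "(\<lambda>n. \<integral>\<^sup>+i. ennreal_powr (a n i) ?Q \<partial>count_space UNIV) \<longlonglongrightarrow> (\<integral>\<^sup>+(i::'i). ennreal_powr 0 ?Q \<partial>count_space UNIV)"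
  proof (rule nn_integral_dominated_convergence[where w="\<lambda>i. ennreal_powr (b i) ?Q"])
    show "(\<integral>\<^sup>+i. ennreal_powr (b i) ?Q \<partial>count_space UNIV) < \<infinity>"
      using fin False by (auto simp: Lp_norm_def less_top[symmetric])
    show "AE i in count_space UNIV. ennreal_powr (a n i) ?Q \<le> ennreal_powr (b i) ?Q" for n
      using dom Q by (auto simp: AE_count_space intro!: ennreal_powr_mono)
    show "AE i in count_space UNIV. (\<lambda>n. ennreal_powr (a n i) ?Q) \<longlonglongrightarrow> ennreal_powr 0 ?Q"
      using tendsto_ennreal_powr[OF _ lim', of ?Q] Q by (simp add: AE_count_space)
  qed auto
  then have "(\<lambda>n. ennreal_powr (\<integral>\<^sup>+i. ennreal_powr (a n i) ?Q \<partial>count_space UNIV) (1/?Q)) \<longlonglongrightarrow> ennreal_powr 0 (1/?Q)"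
    using Q by (intro tendsto_ennreal_powr) auto
  with False show ?thesis
    by (simp add: Lp_norm_def)
qed

section \<open>Uniqueness of the Fourier transform\<close>

text \<open>\<open>smooth_fun\<close> quantifies over lists of derivatives, for which products would
  call for the full Leibniz rule. A class closed under the operations that build the test functions
  is closed under one derivative by the product and chain rules, hence under all of them by
  induction on the list.\<close>

inductive_set smooth_algebra :: "(real^3 \<Rightarrow> complex) set" where
  base: "smooth_fun f \<Longrightarrow> f \<in> smooth_algebra"
| add: "f \<in> smooth_algebra \<Longrightarrow> g \<in> smooth_algebra \<Longrightarrow> (\<lambda>x. f x + g x) \<in> smooth_algebra"
| mult: "f \<in> smooth_algebra \<Longrightarrow> g \<in> smooth_algebra \<Longrightarrow> (\<lambda>x. f x * g x) \<in> smooth_algebra"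
| cnj: "f \<in> smooth_algebra \<Longrightarrow> (\<lambda>x. cnj (f x)) \<in> smooth_algebra"
| affine: "f \<in> smooth_algebra \<Longrightarrow> (\<lambda>x. a *\<^sub>R f (c *\<^sub>R x + b)) \<in> smooth_algebra"

lemma pderivs_pderiv_dir: "pderivs is (pderiv_dir i f) = pderivs (is @ [i]) f"
  by (simp add: pderivs_def)

lemma smooth_fun_pderiv_dir: "smooth_fun f \<Longrightarrow> smooth_fun (pderiv_dir i f)"
  by (simp add: smooth_fun_def pderivs_pderiv_dir)

lemma smooth_fun_differentiable: "smooth_fun f \<Longrightarrow> f differentiable (at x)"
  unfolding smooth_fun_def pderivs_def by (metis foldr.simps(1) id_apply)

lemma pderiv_dir_eq: "(f has_derivative f') (at x) \<Longrightarrow> pderiv_dir i f x = f' (axis i 1)"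
  unfolding pderiv_dir_def by (metis frechet_derivative_at)

lemma differentiable_has_derivative:
  "f differentiable (at x) \<Longrightarrow> (f has_derivative frechet_derivative f (at x)) (at x)"
  by (simp add: frechet_derivative_works)

lemma smooth_algebra_differentiable: "f \<in> smooth_algebra \<Longrightarrow> f differentiable (at x)"
proof (induction arbitrary: x rule: smooth_algebra.induct)
  case (base f)
  then show ?case
    by (rule smooth_fun_differentiable)
next
  case (cnj f)
  then show ?case
    unfolding differentiable_def by (blast intro: has_derivative_cnj)
next
  case (affine f a c b)
  have "(\<lambda>x. f (c *\<^sub>R x + b)) differentiable (at x)"
    using affine.IH[of "c *\<^sub>R x + b"]
    by (intro differentiable_compose[of f "\<lambda>x. c *\<^sub>R x + b"]) auto
  then show ?case
    by (intro differentiable_scaleR) auto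
qed auto

lemma smooth_algebra_pderiv_dir:
  "f \<in> smooth_algebra \<Longrightarrow> pderiv_dir i f \<in> smooth_algebra"
proof (induction rule: smooth_algebra.induct)
  case (base f)
  then show ?case
    by (intro smooth_algebra.base smooth_fun_pderiv_dir)
next
  case (add f g)
  have "pderiv_dir i (\<lambda>x. f x + g x) = (\<lambda>x. pderiv_dir i f x + pderiv_dir i g x)"
  proof
    fix x
    show "pderiv_dir i (\<lambda>x. f x + g x) x = pderiv_dir i f x + pderiv_dir i g x"
      using add.hyps[THEN smooth_algebra_differentiable, THEN differentiable_has_derivative, of x]
      by (subst pderiv_dir_eq[OF has_derivative_add]) (auto simp: pderiv_dir_def)
  qed
  with add show ?case
    by (simp add: smooth_algebra.add)
next
  case (mult f g)
  have "pderiv_dir i (\<lambda>x. f x * g x) = (\<lambda>x. f x * pderiv_dir i g x + pderiv_dir i f x * g x)"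
  proof
    fix x
    show "pderiv_dir i (\<lambda>x. f x * g x) x = f x * pderiv_dir i g x + pderiv_dir i f x * g x"
      using mult.hyps[THEN smooth_algebra_differentiable, THEN differentiable_has_derivative, of x]
      by (subst pderiv_dir_eq[OF has_derivative_mult]) (auto simp: pderiv_dir_def)
  qed
  with mult show ?case
    by (simp add: smooth_algebra.add smooth_algebra.mult)
next
  case (cnj f)
  have "pderiv_dir i (\<lambda>x. cnj (f x)) = (\<lambda>x. cnj (pderiv_dir i f x))"
  proof
    fix x
    show "pderiv_dir i (\<lambda>x. cnj (f x)) x = cnj (pderiv_dir i f x)"
      using cnj.hyps[THEN smooth_algebra_differentiable, THEN differentiable_has_derivative, of x]
      by (subst pderiv_dir_eq[OF has_derivative_cnj]) (auto simp: pderiv_dir_def)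
  qed
  with cnj show ?case
    by (simp add: smooth_algebra.cnj)
next
  case (affine f a c b)
  have "pderiv_dir i (\<lambda>x. a *\<^sub>R f (c *\<^sub>R x + b)) = (\<lambda>x. (a * c) *\<^sub>R pderiv_dir i f (c *\<^sub>R x + b))"
  proof
    fix x
    let ?D = "frechet_derivative f (at (c *\<^sub>R x + b))"
    have D: "(f has_derivative ?D) (at (c *\<^sub>R x + b))"
      using affine.hyps by (intro differentiable_has_derivative smooth_algebra_differentiable)
    have "((\<lambda>x. c *\<^sub>R x + b) has_derivative (\<lambda>h. c *\<^sub>R h)) (at x)"
      by (auto intro!: derivative_eq_intros)
    from has_derivative_compose[OF this D]
    have "((\<lambda>x. a *\<^sub>R f (c *\<^sub>R x + b)) has_derivative (\<lambda>h. a *\<^sub>R ?D (c *\<^sub>R h))) (at x)"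
      by (rule has_derivative_scaleR_right)
    then have "pderiv_dir i (\<lambda>x. a *\<^sub>R f (c *\<^sub>R x + b)) x = a *\<^sub>R ?D (c *\<^sub>R axis i 1)"
      by (rule pderiv_dir_eq)
    also have "?D (c *\<^sub>R axis i 1) = c *\<^sub>R ?D (axis i 1)"
      by (rule linear_cmul[OF has_derivative_linear[OF D]])
    finally show "pderiv_dir i (\<lambda>x. a *\<^sub>R f (c *\<^sub>R x + b)) x = (a * c) *\<^sub>R pderiv_dir i f (c *\<^sub>R x + b)"
      by (simp add: pderiv_dir_def)
  qed
  with affine show ?case
    by (simp add: smooth_algebra.affine)
qed

lemma smooth_algebra_smooth_fun:
  assumes "f \<in> smooth_algebra"
  shows "smooth_fun f"
proof -
  have "pderivs is f \<in> smooth_algebra" for "is"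
    by (induction "is") (use assms in \<open>auto simp: pderivs_def intro: smooth_algebra_pderiv_dir\<close>)
  then show ?thesis
    unfolding smooth_fun_def by (blast intro: smooth_algebra_differentiable)
qed

section \<open>Elementary properties of the Littlewood-Paley cutoff and of Lebesgue
  integrals\<close>

lemma LP_cutoff_support:
  assumes "LP_cutoff \<phi>" "\<phi> \<xi> \<noteq> 0"
  shows "3/4 \<le> norm \<xi>" "norm \<xi> \<le> 8/3"
  using assms closure_subset[of "{\<xi>. \<phi> \<xi> \<noteq> 0}"] unfolding LP_cutoff_def by blast+

lemma LP_cutoff_continuous:
  assumes "LP_cutoff \<phi>"
  shows "continuous_on UNIV \<phi>"
proof -
  have "smooth_fun \<phi>"
    using assms unfolding LP_cutoff_def schwartz_def by blast
  from smooth_fun_differentiable[OF this] show ?thesis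
    by (simp add: continuous_on_eq_continuous_at differentiable_imp_continuous_within)
qed

lemma LP_cutoff_measurable [measurable]: "LP_cutoff \<phi> \<Longrightarrow> \<phi> \<in> borel_measurable borel"
  by (rule borel_measurable_continuous_onI[OF LP_cutoff_continuous])

lemma LP_cutoff_bounded:
  assumes "LP_cutoff \<phi>"
  obtains B where "1 \<le> B" "\<And>\<xi>. norm (\<phi> \<xi>) \<le> B"
proof -
  have "bounded (range (\<lambda>x. norm x ^ 0 *\<^sub>R pderivs [] \<phi> x))"
    using assms unfolding LP_cutoff_def schwartz_def by blast
  then obtain B where "\<And>\<xi>. norm (\<phi> \<xi>) \<le> B"
    by (auto simp: pderivs_def bounded_iff)
  then show thesis
    by (intro that[of "max 1 B"]) (auto simp: le_max_iff_disj)
qed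

lemma LP_cutoff_partition:
  assumes "LP_cutoff \<phi>" "\<xi> \<noteq> 0"
  obtains j :: int where "\<phi> (2 powr (- of_int j) *\<^sub>R \<xi>) \<noteq> 0"
proof -
  have "((\<lambda>j::int. \<phi> (2 powr (- of_int j) *\<^sub>R \<xi>)) has_sum 1) UNIV"
    using assms unfolding LP_cutoff_def by blast
  moreover have "((\<lambda>j::int. 0 :: complex) has_sum 0) UNIV"
    by simp
  ultimately have "\<not> (\<forall>j::int. \<phi> (2 powr (- of_int j) *\<^sub>R \<xi>) = 0)"
    using has_sum_unique by fastforce
  then show thesis
    using that by blast
qed

lemma lborel_integral_affine:
  fixes f :: "'a::euclidean_space \<Rightarrow> 'b::{banach, second_countable_topology}"
  assumes c: "c \<noteq> 0" and [measurable]: "f \<in> borel_measurable borel"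
  shows "(\<integral>x. f x \<partial>lborel) = (\<bar>c\<bar> ^ DIM('a)) *\<^sub>R (\<integral>x. f (t + c *\<^sub>R x) \<partial>lborel)"
proof -
  have "(\<integral>x. f x \<partial>lborel) = (\<integral>x. f x \<partial>density (distr lborel borel (\<lambda>x. t + c *\<^sub>R x)) (\<lambda>_. ennreal (\<bar>c\<bar> ^ DIM('a))))"
    using lborel_affine[OF c, of t] by simp
  also have "\<dots> = (\<integral>x. (\<bar>c\<bar> ^ DIM('a)) *\<^sub>R f x \<partial>distr lborel borel (\<lambda>x. t + c *\<^sub>R x))"
    by (subst integral_density) auto
  also have "\<dots> = (\<integral>x. (\<bar>c\<bar> ^ DIM('a)) *\<^sub>R f (t + c *\<^sub>R x) \<partial>lborel)"
    by (subst integral_distr) auto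
  finally show ?thesis
    by simp
qed

lemma lborel_integrable_compact_support:
  fixes f :: "'a::euclidean_space \<Rightarrow> real"
  assumes f: "continuous_on UNIV f" and supp: "\<And>x. r < norm x \<Longrightarrow> f x = 0"
  shows "integrable lborel f"
proof -
  have "integrable lborel (\<lambda>x. indicator (cball 0 r) x *\<^sub>R f x)"
    by (intro borel_integrable_compact) (auto intro: continuous_on_subset[OF f])
  also have "(\<lambda>x. indicator (cball 0 r) x *\<^sub>R f x) = f"
    using supp by (auto simp: indicator_def fun_eq_iff not_le)
  finally show ?thesis .
qed

lemma complex_smult_of_real: "complex_of_real a *s (v :: complex^'n) = a *\<^sub>R v"
  by (simp add: vec_eq_iff vector_scaleR_component) (simp add: scaleR_conv_of_real)

lemma norm_complex_smult: "norm (c *s (v :: complex^'n)) = norm c * norm v"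
  by (simp add: norm_vec_def norm_mult L2_set_right_distrib)

lemma borel_measurable_vec_componentwise:
  fixes f :: "'a \<Rightarrow> complex^'n"
  assumes "\<And>i. (\<lambda>x. f x $ i) \<in> borel_measurable M"
  shows "f \<in> borel_measurable M"
proof (subst borel_measurable_euclidean_space, intro ballI)
  fix b :: "complex^'n" assume "b \<in> Basis"
  then obtain i c where b: "b = axis i c" "c \<in> Basis"
    by (auto simp: Basis_vec_def)
  have "(\<lambda>x. f x $ i \<bullet> c) \<in> borel_measurable M"
    using assms[of i] by measurable
  then show "(\<lambda>x. f x \<bullet> b) \<in> borel_measurable M"
    by (simp add: b inner_axis)
qed

lemma borel_measurable_vec_nth [measurable (raw)]:
  fixes f :: "'a \<Rightarrow> complex^'n"
  shows "f \<in> borel_measurable M \<Longrightarrow> (\<lambda>x. f x $ i) \<in> borel_measurable M"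
  by (rule borel_measurable_continuous_on[OF continuous_on_component]) auto

lemma borel_measurable_smult_vec [measurable (raw)]:
  fixes f :: "'a \<Rightarrow> complex^'n"
  assumes [measurable]: "c \<in> borel_measurable M" "f \<in> borel_measurable M"
  shows "(\<lambda>x. c x *s f x) \<in> borel_measurable M"
  by (rule borel_measurable_vec_componentwise) (simp add: vector_smult_component)

text \<open>Setting of the fundamental lemma of the calculus of variations. The cutoff belongs to it
  because it supplies a concrete nontrivial test function.\<close>

locale weakly_null =
  fixes \<phi> :: "real^3 \<Rightarrow> complex" and d :: "real^3 \<Rightarrow> complex^3"
  assumes cutoff: "LP_cutoff \<phi>"
    and meas: "d \<in> borel_measurable borel"
    and loc: "\<And>S. compact S \<Longrightarrow> set_integrable lborel S d"
    and null: "\<And>\<psi>. test_fun \<psi> \<Longrightarrow> (LINT \<xi>|lborel. \<psi> \<xi> *s d \<xi>) = 0"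
begin

declare meas [measurable]

text \<open>The mollifier: the squared modulus of the cutoff is nonnegative, compactly supported
  and, as the product of the cutoff and its conjugate, smooth. It is not normalised; its positive
  mass is divided out at the end.\<close>

definition bump :: "real^3 \<Rightarrow> real" where
  "bump x = (norm (\<phi> x))\<^sup>2"

lemma bump_nonneg: "0 \<le> bump x"
  by (simp add: bump_def)

lemma bump_continuous: "continuous_on UNIV bump"
  unfolding bump_def by (intro continuous_intros LP_cutoff_continuous[OF cutoff])

lemma bump_measurable [measurable]: "bump \<in> borel_measurable borel"
  by (rule borel_measurable_continuous_onI[OF bump_continuous])

lemma bump_support: "3 < norm x \<Longrightarrow> bump x = 0"
  using LP_cutoff_support(2)[OF cutoff, of x] by (auto simp: bump_def)

lemma bump_integrable: "integrable lborel bump"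
  by (rule lborel_integrable_compact_support[OF bump_continuous bump_support])

lemma bump_bounded: obtains B where "\<And>x. bump x \<le> B"
proof -
  obtain B where "\<And>\<xi>. norm (\<phi> \<xi>) \<le> B"
    using LP_cutoff_bounded[OF cutoff] by blast
  then show thesis
    by (intro that[of "B\<^sup>2"]) (auto simp: bump_def intro: power_mono)
qed

text \<open>The partition of unity yields a point where the continuous \<open>bump\<close> is
  nonzero, and a nonempty open set is not negligible.\<close>

lemma bump_integral_pos: "0 < (LINT x|lborel. bump x)"
proof -
  obtain x where "bump x \<noteq> 0"
  proof -
    have "axis 1 1 \<noteq> (0 :: real^3)"
      by (simp add: axis_eq_0_iff)
    with that show thesis
      using LP_cutoff_partition[OF cutoff] by (metis bump_def norm_eq_zero zero_eq_power2)
  qed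
  have "\<not> (AE x in lborel. bump x = 0)"
  proof
    assume *: "AE x in lborel. bump x = 0"
    have "open (bump -` (- {0}))"
      by (intro open_vimage bump_continuous) auto
    moreover have "emeasure lborel (bump -` (- {0})) = 0"
    proof -
      have "emeasure lborel {x \<in> space lborel. \<not> bump x = 0} = 0"
        using * by (subst (asm) AE_iff_measurable[OF _ refl]) auto
      moreover have "{x \<in> space lborel. \<not> bump x = 0} = bump -` (- {0})"
        by auto
      ultimately show ?thesis
        by simp
    qed
    ultimately have "negligible (bump -` (- {0}))" "open (bump -` (- {0}))"
      by (auto simp: negligible_iff_null_sets null_sets_def emeasure_completion)
    then have "bump -` (- {0}) = {}"
      using open_not_negligible by blast
    with \<open>bump x \<noteq> 0\<close> show False
      by auto
  qed
  then have "(LINT x|lborel. bump x) \<noteq> 0"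
    by (subst integral_nonneg_eq_0_iff_AE) (auto intro: bump_integrable simp: bump_nonneg)
  moreover have "0 \<le> (LINT x|lborel. bump x)"
    by (simp add: bump_nonneg)
  ultimately show ?thesis
    by linarith
qed

lemma test_fun_bump:
  assumes c: "c \<noteq> 0"
  shows "test_fun (\<lambda>x. complex_of_real (bump (c *\<^sub>R x + b)))"
proof -
  have "smooth_fun \<phi>"
    using cutoff unfolding LP_cutoff_def schwartz_def by blast
  then have "\<phi> \<in> smooth_algebra"
    by (rule smooth_algebra.base)
  then have "(\<lambda>x. 1 *\<^sub>R (\<lambda>x. \<phi> x * cnj (\<phi> x)) (c *\<^sub>R x + b)) \<in> smooth_algebra"
    by (intro smooth_algebra.affine smooth_algebra.mult smooth_algebra.cnj)
  then have smooth: "smooth_fun (\<lambda>x. complex_of_real (bump (c *\<^sub>R x + b)))"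
    using smooth_algebra_smooth_fun by (simp add: bump_def complex_norm_square del: of_real_power)
  have "{x. complex_of_real (bump (c *\<^sub>R x + b)) \<noteq> 0} \<subseteq> cball 0 ((3 + norm b) / \<bar>c\<bar>)"
  proof
    fix x assume "x \<in> {x. complex_of_real (bump (c *\<^sub>R x + b)) \<noteq> 0}"
    then have "norm (c *\<^sub>R x + b) \<le> 3"
      using bump_support[of "c *\<^sub>R x + b"] by force
    then have "norm (c *\<^sub>R x) \<le> 3 + norm b"
      using norm_triangle_ineq4[of "c *\<^sub>R x + b" b] by simp
    then show "x \<in> cball 0 ((3 + norm b) / \<bar>c\<bar>)"
      using c by (simp add: field_simps)
  qed
  then have "bounded {x. complex_of_real (bump (c *\<^sub>R x + b)) \<noteq> 0}"
    using bounded_cball bounded_subset by blast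
  with smooth show ?thesis
    by (simp add: test_fun_def compact_eq_bounded_closed bounded_closure)
qed

lemma bump_null:
  assumes "c \<noteq> 0"
  shows "(LINT y|lborel. bump (c *\<^sub>R y + b) *\<^sub>R d y) = 0"
  using null[OF test_fun_bump[OF assms]] by (simp add: complex_smult_of_real)

text \<open>Mollification: \<open>\<integral> g d\<close> is the limit of averages over \<open>z\<close> of the vanishing integrals of \<open>d\<close>
  against bumps of width \<open>h\<close> centred at \<open>z\<close>.\<close>

lemma mollified_null:
  fixes g :: "real^3 \<Rightarrow> real"
  assumes g: "continuous_on UNIV g" and supp: "\<And>x. r < norm x \<Longrightarrow> g x = 0" and h: "0 < h"
  shows "(LINT y|lborel. (LINT x|lborel. g (y - h *\<^sub>R x) * bump x) *\<^sub>R d y) = 0"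
proof -
  have [measurable]: "g \<in> borel_measurable borel"
    by (rule borel_measurable_continuous_onI[OF g])
  have int_g: "integrable lborel g"
    by (rule lborel_integrable_compact_support[OF g supp])
  obtain B where B: "\<And>x. bump x \<le> B"
    using bump_bounded by blast
  \<comment> \<open>\<open>k z y\<close> below vanishes unless \<open>z\<close> has norm at most
    \<open>r\<close> and \<open>y\<close> lies within \<open>3 * h\<close> of \<open>z\<close>.
    Local integrability of \<open>d\<close> on this ball is what justifies Fubini.\<close>
  define S where "S = cball (0::real^3) (r + 3 * h)"
  have [measurable]: "S \<in> sets borel"
    by (simp add: S_def)
  have int_d: "integrable lborel (\<lambda>y. indicator S y *\<^sub>R d y)"
    using loc[of S] by (simp add: S_def set_integrable_def)
  define k where "k = (\<lambda>z y. (g z * bump ((1/h) *\<^sub>R y + (- 1/h) *\<^sub>R z)) *\<^sub>R d y)"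
  have bd: "norm (k z y) \<le> norm ((\<bar>g z\<bar> * B) *\<^sub>R (indicator S y *\<^sub>R d y))" for z y
  proof (cases "k z y = 0")
    case False
    then have nz: "g z \<noteq> 0" "bump ((1/h) *\<^sub>R y + (- 1/h) *\<^sub>R z) \<noteq> 0"
      by (auto simp: k_def)
    then have z: "norm z \<le> r" and "norm ((1/h) *\<^sub>R y + (- 1/h) *\<^sub>R z) \<le> 3"
      using supp bump_support by force+
    moreover have "(1/h) *\<^sub>R y + (- 1/h) *\<^sub>R z = (1/h) *\<^sub>R (y - z)"
      by (simp add: algebra_simps)
    ultimately have "norm ((1/h) *\<^sub>R (y - z)) \<le> 3"
      by simp
    then have "norm (y - z) \<le> 3 * h"
      using h by (simp only: norm_scaleR) (simp add: field_simps)
    with z have "y \<in> S"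
      using norm_triangle_ineq[of z "y - z"] by (simp add: S_def)
    then show ?thesis
      using B[of "(1/h) *\<^sub>R y + (- 1/h) *\<^sub>R z"] bump_nonneg[of "(1/h) *\<^sub>R y + (- 1/h) *\<^sub>R z"]
      by (auto simp: k_def abs_mult intro!: mult_right_mono mult_left_mono)
  qed auto
  have "integrable (lborel \<Otimes>\<^sub>M lborel) (\<lambda>(z, y). (\<bar>g z\<bar> * B) *\<^sub>R (indicator S y *\<^sub>R d y))"
  proof (rule lborel_pair.Fubini_integrable)
    show "integrable lborel (\<lambda>z. LINT y|lborel. norm (case (z, y) of (z, y) \<Rightarrow> (\<bar>g z\<bar> * B) *\<^sub>R (indicator S y *\<^sub>R d y)))"
      using int_g by (simp add: abs_mult mult.assoc)
    show "AE z in lborel. integrable lborel (\<lambda>y. case (z, y) of (z, y) \<Rightarrow> (\<bar>g z\<bar> * B) *\<^sub>R (indicator S y *\<^sub>R d y))"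
      unfolding prod.case by (intro AE_I2 integrable_scaleR_right) (rule int_d)
  qed measurable
  then have int_k: "integrable (lborel \<Otimes>\<^sub>M lborel) (case_prod k)"
    by (rule Bochner_Integration.integrable_bound) (use bd in \<open>auto simp: k_def\<close>)
  have "(LINT z|lborel. LINT y|lborel. k z y) = (LINT z|lborel. g z *\<^sub>R 0)"
  proof (rule Bochner_Integration.integral_cong[OF refl])
    fix z
    have "(LINT y|lborel. k z y) = g z *\<^sub>R (LINT y|lborel. bump ((1/h) *\<^sub>R y + (- 1/h) *\<^sub>R z) *\<^sub>R d y)"
      unfolding k_def scaleR_scaleR[symmetric] by (simp del: scaleR_scaleR)
    then show "(LINT y|lborel. k z y) = g z *\<^sub>R 0"
      using bump_null[of "1/h" "(- 1/h) *\<^sub>R z"] h by simp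
  qed
  then have "0 = (LINT y|lborel. LINT z|lborel. k z y)"
    using lborel_pair.integral_fst[OF int_k] lborel_pair.integral_snd[OF int_k] by simp
  also have "\<dots> = (LINT y|lborel. (h ^ 3) *\<^sub>R ((LINT x|lborel. g (y - h *\<^sub>R x) * bump x) *\<^sub>R d y))"
  proof (rule Bochner_Integration.integral_cong[OF refl])
    fix y
    have "integrable lborel (\<lambda>z. g z * bump ((1/h) *\<^sub>R y + (- 1/h) *\<^sub>R z))"
      using int_g B bump_nonneg
      by (intro Bochner_Integration.integrable_bound[OF integrable_mult_left[of B, OF integrable_abs[OF int_g]]])
        (auto simp: abs_mult intro!: mult_left_mono order_trans[OF B])
    then have "(LINT z|lborel. k z y) = (LINT z|lborel. g z * bump ((1/h) *\<^sub>R y + (- 1/h) *\<^sub>R z)) *\<^sub>R d y"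
      unfolding k_def by (simp add: integral_scaleR_left)
    \<comment> \<open>Substitution z = y - h x, whose Jacobian \<open>h ^ 3\<close> does not depend
      on \<open>y\<close> and cancels at the end.\<close>
    also have "(LINT z|lborel. g z * bump ((1/h) *\<^sub>R y + (- 1/h) *\<^sub>R z)) =
        h ^ 3 * (LINT x|lborel. g (y + (- h) *\<^sub>R x) * bump ((1/h) *\<^sub>R y + (- 1/h) *\<^sub>R (y + (- h) *\<^sub>R x)))"
      using h by (subst lborel_integral_affine[where c="-h" and t=y]) auto
    also have "\<dots> = h ^ 3 * (LINT x|lborel. g (y - h *\<^sub>R x) * bump x)"
    proof -
      have "(1/h) *\<^sub>R y + (- 1/h) *\<^sub>R (y + (- h) *\<^sub>R x) = x" for x
        using h by (simp add: algebra_simps)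
      then show ?thesis
        by simp
    qed
    finally show "(LINT z|lborel. k z y) = (h ^ 3) *\<^sub>R ((LINT x|lborel. g (y - h *\<^sub>R x) * bump x) *\<^sub>R d y)"
      by simp
  qed
  also have "\<dots> = (h ^ 3) *\<^sub>R (LINT y|lborel. (LINT x|lborel. g (y - h *\<^sub>R x) * bump x) *\<^sub>R d y)"
    by (simp del: scaleR_scaleR)
  finally show ?thesis
    using h by simp
qed

text \<open>The width in \<open>mollified_null\<close> tends to 0. The mollified functions are
  uniformly bounded, supported in one ball, and converge to \<open>g\<close> times the mass of the
  bump, which is positive and cancels.\<close>

lemma continuous_null:
  fixes g :: "real^3 \<Rightarrow> real"
  assumes g: "continuous_on UNIV g" and supp: "\<And>x. r < norm x \<Longrightarrow> g x = 0"
  shows "(LINT y|lborel. g y *\<^sub>R d y) = 0"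
proof -
  have [measurable]: "g \<in> borel_measurable borel"
    by (rule borel_measurable_continuous_onI[OF g])
  obtain G where G: "\<And>x. \<bar>g x\<bar> \<le> G" "0 \<le> G"
  proof -
    have "compact (g ` cball 0 r)"
      by (intro compact_continuous_image continuous_on_subset[OF g]) auto
    then obtain G where "\<forall>x\<in>cball 0 r. \<bar>g x\<bar> \<le> G"
      by (auto dest!: compact_imp_bounded simp: bounded_iff)
    with supp show thesis
      by (intro that[of "max 0 G"]) (auto simp: le_max_iff_disj not_le[symmetric])
  qed
  define m where "m = (LINT x|lborel. bump x)"
  define J where "J = (\<lambda>n y. LINT x|lborel. g (y - (1 / real (Suc n)) *\<^sub>R x) * bump x)"
  have [measurable]: "J n \<in> borel_measurable borel" for n
    unfolding J_def by measurable
  have J_lim: "(\<lambda>n. J n y) \<longlonglongrightarrow> g y * m" for y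
  proof -
    have "(\<lambda>n. LINT x|lborel. g (y - (1 / real (Suc n)) *\<^sub>R x) * bump x) \<longlonglongrightarrow> (LINT x|lborel. g y * bump x)"
    proof (rule integral_dominated_convergence[where w="\<lambda>x. G * bump x"])
      show "AE x in lborel. (\<lambda>n. g (y - (1 / real (Suc n)) *\<^sub>R x) * bump x) \<longlonglongrightarrow> g y * bump x"
      proof (intro AE_I2 tendsto_mult tendsto_const)
        fix x
        have "(\<lambda>n. y - (1 / real (Suc n)) *\<^sub>R x) \<longlonglongrightarrow> y - 0 *\<^sub>R x"
          by (intro tendsto_intros LIMSEQ_Suc lim_1_over_n)
        then show "(\<lambda>n. g (y - (1 / real (Suc n)) *\<^sub>R x)) \<longlonglongrightarrow> g y"
          using g by (intro isCont_tendsto_compose[of y g]) (auto simp: continuous_on_eq_continuous_at)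
      qed
      show "AE x in lborel. norm (g (y - (1 / real (Suc n)) *\<^sub>R x) * bump x) \<le> G * bump x" for n
        using G(1) bump_nonneg by (auto simp: abs_mult intro!: mult_right_mono)
    qed (use bump_integrable in auto)
    then show ?thesis
      by (simp add: J_def m_def)
  qed
  have J_bd: "\<bar>J n y\<bar> \<le> G * m" for n y
  proof -
    have "norm (J n y) \<le> (LINT x|lborel. norm (g (y - (1 / real (Suc n)) *\<^sub>R x) * bump x))"
      unfolding J_def by (rule integral_norm_bound)
    also have "\<dots> \<le> (LINT x|lborel. G * bump x)"
      using bump_integrable G bump_nonneg
      by (intro integral_mono' integrable_mult_right) (auto simp: abs_mult intro!: mult_right_mono)
    finally show ?thesis
      by (simp add: m_def)
  qed
  have J_supp: "J n y = 0" if y: "y \<notin> cball 0 (r + 3)" for n y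
  proof -
    have "g (y - (1 / real (Suc n)) *\<^sub>R x) * bump x = 0" for x
    proof (cases "norm x \<le> 3")
      case True
      have "norm ((1 / real (Suc n)) *\<^sub>R x) \<le> 1 * norm x"
        unfolding norm_scaleR by (intro mult_right_mono) auto
      then have "r < norm (y - (1 / real (Suc n)) *\<^sub>R x)"
        using True y norm_triangle_ineq2[of y "(1 / real (Suc n)) *\<^sub>R x"] by simp
      with supp show ?thesis
        by simp
    qed (simp add: bump_support)
    then show ?thesis
      unfolding J_def by (simp only: Bochner_Integration.integral_zero)
  qed
  have int_d: "integrable lborel (\<lambda>y. indicator (cball 0 (r + 3)) y *\<^sub>R d y)"
    using loc[of "cball 0 (r + 3)"] by (simp add: set_integrable_def)
  have "(\<lambda>n. LINT y|lborel. J n y *\<^sub>R d y) \<longlonglongrightarrow> (LINT y|lborel. (g y * m) *\<^sub>R d y)"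
  proof (rule integral_dominated_convergence[where w="\<lambda>y. (G * m) * norm (indicator (cball 0 (r + 3)) y *\<^sub>R d y)"])
    show "AE y in lborel. (\<lambda>n. J n y *\<^sub>R d y) \<longlonglongrightarrow> (g y * m) *\<^sub>R d y"
      by (intro AE_I2 tendsto_intros J_lim)
    show "AE y in lborel. norm (J n y *\<^sub>R d y) \<le> G * m * norm (indicator (cball 0 (r + 3)) y *\<^sub>R d y)" for n
      using J_bd J_supp by (intro AE_I2) (auto simp: indicator_def intro!: mult_right_mono)
    show "integrable lborel (\<lambda>y. (G * m) * norm (indicator (cball 0 (r + 3)) y *\<^sub>R d y))"
      by (intro integrable_mult_right integrable_norm int_d)
  qed auto
  moreover have "(LINT y|lborel. J n y *\<^sub>R d y) = 0" for n
    unfolding J_def by (rule mollified_null[OF g supp]) auto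
  ultimately have "(LINT y|lborel. (g y * m) *\<^sub>R d y) = 0"
    by (simp add: LIMSEQ_const_iff)
  then have "m *\<^sub>R (LINT y|lborel. g y *\<^sub>R d y) = 0"
    by (simp add: mult.commute[of _ m] flip: scaleR_scaleR)
  then show ?thesis
    using bump_integral_pos by (simp add: m_def)
qed

text \<open>The indicator of a bounded open set is the limit of continuous functions built from the
  distance to the complement, to which \<open>continuous_null\<close> applies.\<close>

lemma open_null:
  assumes U: "open U" "U \<subseteq> ball 0 r"
  shows "(LINT y|lborel. indicator U y *\<^sub>R d y) = 0"
proof -
  define g where "g = (\<lambda>(n::nat) y. min 1 (real n * infdist y (- U)))"
  \<comment> \<open>\<open>infdist\<close> to the empty set is 0, so the distance detects membership
    in \<open>U\<close> only if the complement is nonempty.\<close>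
  have ne: "- U \<noteq> {}"
  proof
    assume "- U = {}"
    then have "UNIV \<subseteq> ball (0::real^3) r"
      using U(2) by auto
    then show False
      using bounded_subset[OF bounded_ball] not_bounded_UNIV by blast
  qed
  have inU: "infdist y (- U) = 0 \<longleftrightarrow> y \<notin> U" for y
    using in_closed_iff_infdist_zero[of "- U" y] U ne by auto
  have cont: "continuous_on UNIV (g n)" for n
    unfolding g_def by (intro continuous_intros)
  have [measurable]: "g n \<in> borel_measurable borel" for n
    by (rule borel_measurable_continuous_onI[OF cont])
  have [measurable]: "U \<in> sets borel"
    using U by auto
  have int_d: "integrable lborel (\<lambda>y. indicator (cball 0 r) y *\<^sub>R d y)"
    using loc[of "cball 0 r"] by (simp add: set_integrable_def)
  have g01: "0 \<le> g n y" "g n y \<le> 1" for n y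
    by (auto simp: g_def infdist_nonneg)
  have g0: "g n y = 0" if "y \<notin> U" for n y
    using that inU by (simp add: g_def)
  have "(\<lambda>n. LINT y|lborel. g n y *\<^sub>R d y) \<longlonglongrightarrow> (LINT y|lborel. indicator U y *\<^sub>R d y)"
  proof (rule integral_dominated_convergence[where w="\<lambda>y. norm (indicator (cball 0 r) y *\<^sub>R d y)"])
    show "AE y in lborel. (\<lambda>n. g n y *\<^sub>R d y) \<longlonglongrightarrow> indicator U y *\<^sub>R d y"
    proof (intro AE_I2 tendsto_intros)
      fix y
      show "(\<lambda>n. g n y) \<longlonglongrightarrow> indicator U y"
      proof (cases "y \<in> U")
        case True
        then have pos: "0 < infdist y (- U)"
          using inU[of y] infdist_nonneg[of y "- U"] by linarith
        have "\<forall>\<^sub>F n in sequentially. g n y = 1"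
        proof -
          obtain N :: nat where "1 / infdist y (- U) < real N"
            using reals_Archimedean2 by blast
          then have N: "1 \<le> real N * infdist y (- U)"
            using pos by (simp add: field_simps)
          have "1 \<le> real n * infdist y (- U)" if "N \<le> n" for n
            using N by (rule order_trans) (use that pos in \<open>auto intro: mult_right_mono\<close>)
          then show ?thesis
            unfolding eventually_sequentially g_def by (intro exI[of _ N]) auto
        qed
        with True show ?thesis
          by (simp add: tendsto_eventually)
      qed (simp add: g0)
    qed
    show "AE y in lborel. norm (g n y *\<^sub>R d y) \<le> norm (indicator (cball 0 r) y *\<^sub>R d y)" for n
    proof (intro AE_I2)
      fix y
      show "norm (g n y *\<^sub>R d y) \<le> norm (indicator (cball 0 r) y *\<^sub>R d y)"
        using U(2) g01[of n y] g0[of y n]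
        by (cases "y \<in> U") (auto simp: indicator_def mult_left_le_one_le)
    qed
    show "integrable lborel (\<lambda>y. norm (indicator (cball 0 r) y *\<^sub>R d y))"
      by (intro integrable_norm int_d)
  qed auto
  moreover have "(LINT y|lborel. g n y *\<^sub>R d y) = 0" for n
    using U(2) by (intro continuous_null[OF cont, of r] g0) auto
  ultimately show ?thesis
    by (simp add: LIMSEQ_const_iff)
qed

text \<open>Open sets are stable under intersection and generate the Borel sets, so Dynkin's theorem
  extends \<open>open_null\<close>. The restriction to a ball makes \<open>d\<close> integrable,
  which complements and countable unions require.\<close>

lemma borel_null:
  assumes "A \<in> sets borel"
  shows "(LINT y:A|lborel. indicator (ball 0 r) y *\<^sub>R d y) = 0"
proof -
  let ?d = "\<lambda>y. indicator (ball 0 r) y *\<^sub>R d y"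
  have int_d: "integrable lborel ?d"
  proof -
    have "set_integrable lborel (ball 0 r) d"
      using loc[of "cball 0 r"] by (rule set_integrable_subset) auto
    then show ?thesis
      by (simp add: set_integrable_def)
  qed
  have set_int: "set_integrable lborel A ?d" if "A \<in> sets borel" for A
    unfolding set_integrable_def by (rule integrable_mult_indicator[OF _ int_d]) (use that in simp)
  have Int: "Int_stable (Collect open :: (real^3) set set)"
    by (auto simp: Int_stable_def)
  have Pow: "Collect open \<subseteq> Pow (UNIV :: (real^3) set)"
    by simp
  have "A \<in> sigma_sets UNIV (Collect open)"
    using assms by (simp add: borel_def)
  then show ?thesis
  proof (induction rule: sigma_sets_induct_disjoint[OF Int Pow, consumes 1, case_names basic empty compl union])
    case (basic A)
    then have "(LINT y|lborel. indicator (A \<inter> ball 0 r) y *\<^sub>R d y) = 0"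
      by (intro open_null[of _ r]) auto
    then show ?case
      by (simp add: set_lebesgue_integral_def indicator_inter_arith)
  next
    case (compl A)
    then have [measurable]: "A \<in> sets borel"
      by (simp add: borel_def)
    have "(LINT y:UNIV|lborel. ?d y) = (LINT y:A|lborel. ?d y) + (LINT y:UNIV - A|lborel. ?d y)"
      using set_integral_Un[OF _ set_int set_int, of A "UNIV - A"] by auto
    moreover have "(LINT y:UNIV|lborel. ?d y) = 0"
      using open_null[of "ball 0 r" r] by (simp add: set_lebesgue_integral_def)
    ultimately show ?case
      using compl by simp
  next
    case (union A)
    then have [measurable]: "\<And>i. A i \<in> sets borel"
      by (auto simp: borel_def)
    have "(LINT y:(\<Union>i. A i)|lborel. ?d y) = (\<Sum>i. LINT y:A i|lborel. ?d y)"
      using union(1) by (intro lebesgue_integral_countable_add set_int) (auto simp: disjoint_family_on_def)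
    with union show ?case
      by simp
  qed (simp_all add: set_lebesgue_integral_def)
qed

lemma AE_null: "AE y in lborel. d y = 0"
proof -
  have "AE y in lborel. indicator (ball 0 (real n)) y *\<^sub>R d y = 0" for n
  proof (rule sigma_finite_measure.density_zero[OF sigma_finite_lborel])
    show "integrable lborel (\<lambda>y. indicat_real (ball 0 (real n)) y *\<^sub>R d y)"
      using set_integrable_subset[OF loc[of "cball 0 (real n)"], of "ball 0 (real n)"]
      by (auto simp: set_integrable_def)
  qed (use borel_null in auto)
  then have "AE y in lborel. \<forall>n. indicator (ball 0 (real n)) y *\<^sub>R d y = 0"
    unfolding AE_all_countable by blast
  then show ?thesis
  proof eventually_elim
    case (elim y)
    obtain n :: nat where "norm y < real n"
      using reals_Archimedean2 by blast
    with elim[rule_format, of n] show ?case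
      by simp
  qed
qed

end

section \<open>Differences and uniqueness of distributional transforms\<close>

lemma set_integrable_test_fun:
  assumes "test_fun \<psi>" and g: "g \<in> borel_measurable lborel" "\<And>S. compact S \<Longrightarrow> set_integrable lborel S g"
  shows "integrable lborel (\<lambda>\<xi>. \<psi> \<xi> *s (g \<xi> :: complex^3))"
proof -
  let ?S = "closure {x. \<psi> x \<noteq> 0}"
  have S: "compact ?S" and "smooth_fun \<psi>"
    using assms(1) by (auto simp: test_fun_def)
  from smooth_fun_differentiable[OF this(2)] have cont: "continuous_on UNIV \<psi>"
    by (simp add: continuous_on_eq_continuous_at differentiable_imp_continuous_within)
  have [measurable]: "\<psi> \<in> borel_measurable borel" "g \<in> borel_measurable borel"
    using borel_measurable_continuous_onI[OF cont] g by auto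
  have "compact (\<psi> ` ?S)"
    by (intro compact_continuous_image continuous_on_subset[OF cont] S) auto
  then obtain B where B: "\<And>x. x \<in> ?S \<Longrightarrow> norm (\<psi> x) \<le> B"
    using compact_imp_bounded bounded_iff by (metis imageI)
  have "integrable lborel (\<lambda>\<xi>. B * norm (indicator ?S \<xi> *\<^sub>R g \<xi>))"
    using g(2)[OF S] unfolding set_integrable_def by (intro integrable_mult_right integrable_norm)
  then show ?thesis
  proof (rule Bochner_Integration.integrable_bound)
    show "(\<lambda>\<xi>. \<psi> \<xi> *s g \<xi>) \<in> borel_measurable lborel"
      by (rule borel_measurable_smult_vec) auto
    show "AE \<xi> in lborel. norm (\<psi> \<xi> *s g \<xi>) \<le> norm (B * norm (indicator ?S \<xi> *\<^sub>R g \<xi>))"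
    proof (intro AE_I2)
      fix \<xi>
      show "norm (\<psi> \<xi> *s g \<xi>) \<le> norm (B * norm (indicator ?S \<xi> *\<^sub>R g \<xi>))"
      proof (cases "\<psi> \<xi> = 0")
        case False
        then have "\<xi> \<in> ?S"
          by (intro subsetD[OF closure_subset]) simp
        with B[OF this] show ?thesis
          by (auto simp: norm_complex_smult abs_mult intro!: mult_right_mono order_trans[OF B])
      qed (simp add: norm_complex_smult)
    qed
  qed
qed

lemma has_ft_minus:
  assumes T: "has_ft T g" and U: "has_ft U h"
  shows "has_ft (T - U) (\<lambda>\<xi>. g \<xi> - h \<xi>)"
  unfolding has_ft_def
proof (intro conjI allI impI)
  show "(\<lambda>\<xi>. g \<xi> - h \<xi>) \<in> borel_measurable lborel"
    using T U unfolding has_ft_def by (intro borel_measurable_diff) auto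
  show "set_integrable lborel S (\<lambda>\<xi>. g \<xi> - h \<xi>)" if "compact S" for S
    using T U that unfolding has_ft_def by (intro set_integral_diff(1)) auto
  fix \<psi> assume \<psi>: "test_fun \<psi>"
  have "integrable lborel (\<lambda>\<xi>. \<psi> \<xi> *s g \<xi>)" "integrable lborel (\<lambda>\<xi>. \<psi> \<xi> *s h \<xi>)"
    using T U unfolding has_ft_def by (auto intro!: set_integrable_test_fun[OF \<psi>])
  then have "(LINT \<xi>|lborel. \<psi> \<xi> *s g \<xi> - \<psi> \<xi> *s h \<xi>) = tdist_apply T (fourier \<psi>) - tdist_apply U (fourier \<psi>)"
    using T U \<psi> by (subst Bochner_Integration.integral_diff) (auto simp: has_ft_def)
  moreover have "\<psi> \<xi> *s g \<xi> - \<psi> \<xi> *s h \<xi> = \<psi> \<xi> *s (g \<xi> - h \<xi>)" for \<xi>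
    by (simp add: vec_eq_iff algebra_simps)
  ultimately show "tdist_apply (T - U) (fourier \<psi>) = (LINT \<xi>|lborel. \<psi> \<xi> *s (g \<xi> - h \<xi>))"
    unfolding minus_tdist.rep_eq by (simp only:)
qed

text \<open>The difference of two representatives represents \<open>T - T\<close>, which is 0 on
  every test function.\<close>

lemma has_ft_unique:
  assumes \<phi>: "LP_cutoff \<phi>" and T: "has_ft T g" "has_ft T h"
  shows "AE \<xi> in lborel. g \<xi> = h \<xi>"
proof -
  interpret weakly_null \<phi> "\<lambda>\<xi>. g \<xi> - h \<xi>"
  proof
    note D = has_ft_minus[OF T]
    show "(\<lambda>\<xi>. g \<xi> - h \<xi>) \<in> borel_measurable borel"
      "\<And>S. compact S \<Longrightarrow> set_integrable lborel S (\<lambda>\<xi>. g \<xi> - h \<xi>)"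
      using D by (auto simp: has_ft_def)
    fix \<psi> assume "test_fun \<psi>"
    then show "(LINT \<xi>|lborel. \<psi> \<xi> *s (g \<xi> - h \<xi>)) = 0"
      using D by (simp add: has_ft_def minus_tdist.rep_eq)
  qed fact
  show ?thesis
    using AE_null by eventually_elim simp
qed

lemma has_ft_ft: "has_ft T g \<Longrightarrow> has_ft T (ft T)"
  unfolding ft_def by (rule someI[where P="has_ft T"])

lemma ft_eq_AE:
  assumes "LP_cutoff \<phi>" "has_ft T g"
  shows "AE \<xi> in lborel. ft T \<xi> = g \<xi>"
  using has_ft_unique[OF assms(1) has_ft_ft[OF assms(2)] assms(2)] .

lemma has_ft_cong_AE:
  assumes T: "has_ft T g" and eq: "AE \<xi> in lborel. g \<xi> = h \<xi>" and h: "h \<in> borel_measurable lborel"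
  shows "has_ft T h"
  unfolding has_ft_def
proof (intro conjI allI impI)
  have [measurable]: "g \<in> borel_measurable lborel"
    using T by (simp add: has_ft_def)
  note [measurable] = h
  show "set_integrable lborel S h" if S: "compact S" for S
  proof -
    have [measurable]: "S \<in> sets borel"
      using S by (simp add: borel_compact)
    have "set_integrable lborel S g"
      using T S by (simp add: has_ft_def)
    then show ?thesis
      unfolding set_integrable_def
      by (rule integrable_cong_AE_imp) (use eq in \<open>auto elim: eventually_mono\<close>)
  qed
  fix \<psi> assume \<psi>: "test_fun \<psi>"
  then have \<psi>_cont: "continuous_on UNIV \<psi>"
    using smooth_fun_differentiable[of \<psi>]
    by (simp add: test_fun_def continuous_on_eq_continuous_at differentiable_imp_continuous_within)
  have [measurable]: "\<psi> \<in> borel_measurable borel"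
    by (rule borel_measurable_continuous_onI[OF \<psi>_cont])
  have "(LINT \<xi>|lborel. \<psi> \<xi> *s g \<xi>) = (LINT \<xi>|lborel. \<psi> \<xi> *s h \<xi>)"
    by (rule integral_cong_AE) (use eq in \<open>auto elim: eventually_mono intro!: borel_measurable_smult_vec\<close>)
  then show "tdist_apply T (fourier \<psi>) = (LINT \<xi>|lborel. \<psi> \<xi> *s h \<xi>)"
    using T \<psi> by (simp add: has_ft_def)
qed fact

section \<open>Fourier-Besov spaces and measurable representatives\<close>

text \<open>The space norms use the completed measure on the half-line, whereas Fubini and joint
  measurability are used with Borel sets; null sets are translated here.\<close>

lemma AE_time_iff: "(AE t in lebesgue_on {0::real..}. P t) \<longleftrightarrow> (AE t in lborel. 0 \<le> t \<longrightarrow> P t)"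
  by (simp add: AE_restrict_space_iff AE_completion_iff)

lemma complete_measure_lebesgue_on:
  assumes S: "S \<in> sets lebesgue"
  shows "complete_measure (lebesgue_on S)"
proof
  fix A B :: "'a set" assume "B \<subseteq> A" "A \<in> null_sets (lebesgue_on S)"
  then have "A \<in> null_sets lebesgue" "B \<subseteq> S"
    using S by (auto simp: null_sets_restrict_space)
  moreover from this have "B \<in> sets lebesgue"
    using \<open>B \<subseteq> A\<close> by (auto intro: completion.complete)
  ultimately show "B \<in> sets (lebesgue_on S)"
    using S by (simp add: sets_restrict_space_iff)
qed

lemma (in complete_measure) measurable_AE_eq:
  assumes f: "f \<in> M \<rightarrow>\<^sub>M N" and eq: "AE x in M. f x = g x" and g: "g \<in> space M \<rightarrow> space N"
  shows "g \<in> M \<rightarrow>\<^sub>M N"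
proof (rule measurableI)
  fix A assume A: "A \<in> sets N"
  have "AE x in M. x \<in> f -` A \<inter> space M \<longleftrightarrow> x \<in> g -` A \<inter> space M"
    using eq by eventually_elim auto
  then show "g -` A \<inter> space M \<in> sets M"
    by (rule in_sets_AE) (use f A in auto)
qed (use g in auto)

text \<open>Bochner measurability yields limits only at almost every time, and the completeness of
  the time measure compensates for it.\<close>

lemma measurable_lebesgue_on_AE_eq:
  fixes f g :: "real \<Rightarrow> ennreal"
  assumes "f \<in> borel_measurable (lebesgue_on {0..})" "AE t in lebesgue_on {0..}. f t = g t"
  shows "g \<in> borel_measurable (lebesgue_on {0..})"
  using complete_measure.measurable_AE_eq[OF complete_measure_lebesgue_on assms] by auto

text \<open>Both space norms have this shape, with block norms or their essential suprema in time as
  the sequence, so the sequence-space estimates are proved once.\<close>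

definition weighted_lq :: "ennreal \<Rightarrow> real \<Rightarrow> (int \<Rightarrow> ennreal) \<Rightarrow> ennreal" where
  "weighted_lq q s a = Lp_norm (count_space UNIV) q (\<lambda>j. ennreal (2 powr (of_int j * s)) * a j)"

lemma FB_norm_ft_eq: "FB_norm_ft \<phi> s p q g = weighted_lq q s (\<lambda>j. block_norm \<phi> p j g)"
  by (simp add: FB_norm_ft_def weighted_lq_def)

lemma LFB_norm_ft_eq:
  "LFB_norm_ft \<phi> s p q g = weighted_lq q s (\<lambda>j. esssup (lebesgue_on {0..}) (\<lambda>t. block_norm \<phi> p j (g t)))"
  by (simp add: LFB_norm_ft_def weighted_lq_def)

lemma weighted_lq_mono:
  assumes "1 \<le> q" "\<And>j. a j \<le> b j"
  shows "weighted_lq q s a \<le> weighted_lq q s b"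
  unfolding weighted_lq_def using assms by (intro Lp_norm_mono) (auto intro: mult_left_mono)

lemma weighted_lq_add:
  assumes "1 \<le> q"
  shows "weighted_lq q s (\<lambda>j. a j + b j) \<le> weighted_lq q s a + weighted_lq q s b"
  unfolding weighted_lq_def distrib_left
  by (rule Lp_norm_triangle[OF assms sigma_finite_measure_count_space_countable]) auto

lemma weighted_lq_cmult_le:
  assumes "1 \<le> q"
  shows "weighted_lq q s (\<lambda>j. c * a j) \<le> c * weighted_lq q s a"
  using Lp_norm_cmult_le[OF assms, of "\<lambda>j. ennreal (2 powr (of_int j * s)) * a j" "count_space UNIV" c]
  by (simp add: weighted_lq_def mult.left_commute)

lemma le_weighted_lq:
  assumes "1 \<le> q"
  shows "ennreal (2 powr (of_int j * s)) * a j \<le> weighted_lq q s a"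
  unfolding weighted_lq_def by (rule le_lq_norm[OF assms])

lemma le_weighted_lq':
  assumes "1 \<le> q"
  shows "a j \<le> ennreal (2 powr (- (of_int j * s))) * weighted_lq q s a"
proof -
  have "a j = ennreal (2 powr (- (of_int j * s))) * (ennreal (2 powr (of_int j * s)) * a j)"
    by (simp flip: mult.assoc ennreal_mult powr_add)
  also have "\<dots> \<le> ennreal (2 powr (- (of_int j * s))) * weighted_lq q s a"
    by (intro mult_left_mono le_weighted_lq assms) auto
  finally show ?thesis .
qed

locale fourier_besov =
  fixes \<phi> :: "real^3 \<Rightarrow> complex" and p q :: ennreal
  assumes cutoff: "LP_cutoff \<phi>" and p: "1 \<le> p" and q: "1 \<le> q"
begin

definition cut :: "int \<Rightarrow> real^3 \<Rightarrow> real" where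
  "cut j \<xi> = norm (\<phi> (2 powr (- of_int j) *\<^sub>R \<xi>))"

text \<open>The block norm for functions that may be infinite: time integrals and convolutions are
  bounded through it before their convergence is known.\<close>

definition block :: "int \<Rightarrow> (real^3 \<Rightarrow> ennreal) \<Rightarrow> ennreal" where
  "block j h = Lp_norm lborel p (\<lambda>\<xi>. ennreal (cut j \<xi>) * h \<xi>)"

lemma cut_nonneg [simp]: "0 \<le> cut j \<xi>"
  by (simp add: cut_def)

lemma cut_measurable [measurable]: "cut j \<in> borel_measurable borel"
proof -
  note [measurable] = LP_cutoff_measurable[OF cutoff]
  show ?thesis
    unfolding cut_def by measurable
qed

lemma cut_partition:
  assumes "\<xi> \<noteq> 0" obtains j where "0 < cut j \<xi>"
  using LP_cutoff_partition[OF cutoff assms] unfolding cut_def by (metis zero_less_norm_iff)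

lemma cut_support:
  assumes "cut j \<xi> \<noteq> 0"
  shows "3/4 * 2 powr j \<le> norm \<xi>" "norm \<xi> \<le> 8/3 * 2 powr j"
proof -
  have eq: "norm (2 powr (- of_int j) *\<^sub>R \<xi>) = norm \<xi> / 2 powr j"
    by (simp add: powr_minus_divide)
  show "3/4 * 2 powr j \<le> norm \<xi>" "norm \<xi> \<le> 8/3 * 2 powr j"
    using LP_cutoff_support[OF cutoff, of "2 powr (- of_int j) *\<^sub>R \<xi>"] assms
    unfolding eq by (auto simp: cut_def pos_le_divide_eq pos_divide_le_eq)
qed

lemma block_norm_eq: "block_norm \<phi> p j g = block j (\<lambda>\<xi>. ennreal (norm (g \<xi>)))"
  unfolding block_norm_def block_def cut_def by (simp add: norm_complex_smult ennreal_mult)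

lemma block_mono_AE:
  assumes [measurable]: "h \<in> borel_measurable borel" and "AE \<xi> in lborel. h \<xi> \<le> k \<xi>"
  shows "block j h \<le> block j k"
  unfolding block_def using assms(2)
  by (intro Lp_norm_mono_AE[OF p]) (auto elim!: eventually_mono intro: mult_left_mono)

lemma block_add:
  assumes [measurable]: "h \<in> borel_measurable borel" "k \<in> borel_measurable borel"
  shows "block j (\<lambda>\<xi>. h \<xi> + k \<xi>) \<le> block j h + block j k"
  unfolding block_def distrib_left by (rule Lp_norm_triangle[OF p sigma_finite_lborel]) auto

lemma block_cmult_le:
  assumes [measurable]: "h \<in> borel_measurable borel"
  shows "block j (\<lambda>\<xi>. c * h \<xi>) \<le> c * block j h"
  using Lp_norm_cmult_le[OF p, of "\<lambda>\<xi>. ennreal (cut j \<xi>) * h \<xi>" lborel c]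
  by (simp add: block_def mult.left_commute)

text \<open>Every nonzero frequency is seen by some block with a positive cutoff, so finiteness of
  countably many block norms gives finiteness off one null set.\<close>

lemma AE_finite_of_block:
  assumes [measurable]: "h \<in> borel_measurable borel" and fin: "\<And>j. block j h < top"
  shows "AE \<xi> in lborel. h \<xi> < top"
proof -
  have "AE \<xi> in lborel. \<forall>j. ennreal (cut j \<xi>) * h \<xi> < top"
    unfolding AE_all_countable
    using fin unfolding block_def by (intro allI AE_finite_of_Lp_norm[OF p]) auto
  then show ?thesis
    using AE_lborel_singleton[of 0]
  proof eventually_elim
    case (elim \<xi>)
    then obtain j where "0 < cut j \<xi>"
      using cut_partition by blast
    then have "ennreal (cut j \<xi>) \<noteq> 0"
      by simp
    with elim(1)[rule_format, of j] show "h \<xi> < top"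
      by (auto simp: ennreal_mult_less_top)
  qed
qed

lemma block_norm_le_add:
  assumes [measurable]: "f \<in> borel_measurable borel" "g \<in> borel_measurable borel" "h \<in> borel_measurable borel"
    and le: "AE \<xi> in lborel. norm (f \<xi>) \<le> norm (g \<xi>) + norm (h \<xi>)"
  shows "block_norm \<phi> p j f \<le> block_norm \<phi> p j g + block_norm \<phi> p j h"
proof -
  have "block j (\<lambda>\<xi>. ennreal (norm (f \<xi>))) \<le> block j (\<lambda>\<xi>. ennreal (norm (g \<xi>)) + ennreal (norm (h \<xi>)))"
    by (rule block_mono_AE) (use le in \<open>auto elim!: eventually_mono simp flip: ennreal_plus intro: ennreal_leI\<close>)
  also have "\<dots> \<le> block j (\<lambda>\<xi>. ennreal (norm (g \<xi>))) + block j (\<lambda>\<xi>. ennreal (norm (h \<xi>)))"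
    by (rule block_add) auto
  finally show ?thesis
    by (simp add: block_norm_eq)
qed

lemma block_norm_cong_AE:
  assumes "f \<in> borel_measurable borel" "g \<in> borel_measurable borel" "AE \<xi> in lborel. f \<xi> = g \<xi>"
  shows "block_norm \<phi> p j f = block_norm \<phi> p j g"
  unfolding block_norm_eq using assms
  by (intro antisym block_mono_AE) (auto elim: eventually_mono)

lemma FB_norm_ft_le_add:
  assumes "f \<in> borel_measurable borel" "g \<in> borel_measurable borel" "h \<in> borel_measurable borel"
    "AE \<xi> in lborel. norm (f \<xi>) \<le> norm (g \<xi>) + norm (h \<xi>)"
  shows "FB_norm_ft \<phi> s p q f \<le> FB_norm_ft \<phi> s p q g + FB_norm_ft \<phi> s p q h"
proof -
  have "FB_norm_ft \<phi> s p q f \<le> weighted_lq q s (\<lambda>j. block_norm \<phi> p j g + block_norm \<phi> p j h)"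
    unfolding FB_norm_ft_eq by (intro weighted_lq_mono[OF q] block_norm_le_add assms)
  also have "\<dots> \<le> FB_norm_ft \<phi> s p q g + FB_norm_ft \<phi> s p q h"
    unfolding FB_norm_ft_eq by (rule weighted_lq_add[OF q])
  finally show ?thesis .
qed

lemma has_ft_measurable: "has_ft T g \<Longrightarrow> g \<in> borel_measurable borel"
  by (simp add: has_ft_def)

lemma FB_space_has_ft: "f \<in> FB_space \<phi> s p q \<Longrightarrow> has_ft f (ft f)"
  unfolding FB_space_def using has_ft_ft by blast

lemma FB_space_ft_measurable: "f \<in> FB_space \<phi> s p q \<Longrightarrow> ft f \<in> borel_measurable borel"
  by (rule has_ft_measurable[OF FB_space_has_ft])

lemma ft_minus_AE:
  assumes "f \<in> FB_space \<phi> s p q" "g \<in> FB_space \<phi> s p q"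
  shows "AE \<xi> in lborel. ft (f - g) \<xi> = ft f \<xi> - ft g \<xi>"
  using assms by (intro ft_eq_AE[OF cutoff has_ft_minus] FB_space_has_ft)

lemma ft_minus_measurable:
  assumes "f \<in> FB_space \<phi> s p q" "g \<in> FB_space \<phi> s p q"
  shows "ft (f - g) \<in> borel_measurable borel"
  by (rule has_ft_measurable[OF has_ft_ft[OF has_ft_minus[OF assms[THEN FB_space_has_ft]]]])

lemma block_norm_minus:
  assumes "f \<in> FB_space \<phi> s p q" "g \<in> FB_space \<phi> s p q"
  shows "block_norm \<phi> p j (ft (f - g)) = block_norm \<phi> p j (\<lambda>\<xi>. ft f \<xi> - ft g \<xi>)"
  using assms FB_space_ft_measurable[OF assms(1)] FB_space_ft_measurable[OF assms(2)]
  by (intro block_norm_cong_AE ft_minus_AE ft_minus_measurable) auto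

lemma FB_norm_minus:
  assumes "f \<in> FB_space \<phi> s p q" "g \<in> FB_space \<phi> s p q"
  shows "FB_norm \<phi> s p q (f - g) = FB_norm_ft \<phi> s p q (\<lambda>\<xi>. ft f \<xi> - ft g \<xi>)"
  unfolding FB_norm_def FB_norm_ft_eq by (simp add: block_norm_minus[OF assms])

lemma FB_norm_minus_commute:
  assumes "f \<in> FB_space \<phi> s p q" "g \<in> FB_space \<phi> s p q"
  shows "FB_norm \<phi> s p q (f - g) = FB_norm \<phi> s p q (g - f)"
  using assms by (simp add: FB_norm_minus FB_norm_ft_eq block_norm_eq norm_minus_commute)

lemma FB_norm_triangle:
  assumes "f \<in> FB_space \<phi> s p q" "g \<in> FB_space \<phi> s p q" "h \<in> FB_space \<phi> s p q"
  shows "FB_norm \<phi> s p q (f - h) \<le> FB_norm \<phi> s p q (f - g) + FB_norm \<phi> s p q (g - h)"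
  using assms[THEN FB_space_ft_measurable] assms norm_triangle_ineq
  by (auto simp: FB_norm_minus intro!: FB_norm_ft_le_add AE_I2 norm_diff_triangle_le[OF order_refl order_refl])

lemma FB_space_minus:
  assumes "f \<in> FB_space \<phi> s p q" "g \<in> FB_space \<phi> s p q"
  shows "f - g \<in> FB_space \<phi> s p q"
proof -
  have "FB_norm \<phi> s p q (f - g) \<le> FB_norm \<phi> s p q f + FB_norm \<phi> s p q g"
    using assms[THEN FB_space_ft_measurable]
    by (simp add: FB_norm_minus[OF assms]) (auto simp: FB_norm_def intro!: FB_norm_ft_le_add AE_I2 norm_triangle_ineq4)
  also have "\<dots> < top"
    using assms by (simp add: FB_space_def less_top)
  finally show ?thesis
    using has_ft_minus[OF FB_space_has_ft[OF assms(1)] FB_space_has_ft[OF assms(2)]]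
    by (auto simp: FB_space_def less_top)
qed

lemma FB_norm_minus_minus_le:
  assumes "a \<in> FB_space \<phi> s p q" "b \<in> FB_space \<phi> s p q" "c \<in> FB_space \<phi> s p q" "d \<in> FB_space \<phi> s p q"
  shows "FB_norm \<phi> s p q ((a - b) - (c - d)) \<le> FB_norm \<phi> s p q (a - c) + FB_norm \<phi> s p q (b - d)"
proof -
  note ab = FB_space_minus[OF assms(1,2)] and cd = FB_space_minus[OF assms(3,4)]
  have [measurable]: "ft a \<in> borel_measurable borel" "ft b \<in> borel_measurable borel"
    "ft c \<in> borel_measurable borel" "ft d \<in> borel_measurable borel"
    "ft (a - b) \<in> borel_measurable borel" "ft (c - d) \<in> borel_measurable borel"
    using assms ab cd by (auto intro: FB_space_ft_measurable)
  have "AE \<xi> in lborel. norm (ft (a - b) \<xi> - ft (c - d) \<xi>) \<le> norm (ft a \<xi> - ft c \<xi>) + norm (ft b \<xi> - ft d \<xi>)"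
    using ft_minus_AE[OF assms(1,2)] ft_minus_AE[OF assms(3,4)]
  proof eventually_elim
    case (elim \<xi>)
    have "ft (a - b) \<xi> - ft (c - d) \<xi> = (ft a \<xi> - ft c \<xi>) - (ft b \<xi> - ft d \<xi>)"
      unfolding elim by (simp add: algebra_simps)
    then show ?case
      using norm_triangle_ineq4[of "ft a \<xi> - ft c \<xi>" "ft b \<xi> - ft d \<xi>"] by (simp only:)
  qed
  then show ?thesis
    using assms ab cd by (auto simp: FB_norm_minus intro!: FB_norm_ft_le_add)
qed

section \<open>Time-dependent spaces and operations on them\<close>

lemma LFB_spaceD:
  assumes "f \<in> LFB_space \<phi> s p q"
  shows "0 \<le> t \<Longrightarrow> f t \<in> FB_space \<phi> s p q" "bochner_measurable_FB \<phi> s p q f" "LFB_norm \<phi> s p q f < top"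
  using assms by (auto simp: LFB_space_def)

lemma LFB_norm_eq:
  "LFB_norm \<phi> s p q f = weighted_lq q s (\<lambda>j. esssup (lebesgue_on {0..}) (\<lambda>t. block_norm \<phi> p j (ft (f t))))"
  by (simp add: LFB_norm_def LFB_norm_ft_eq)

lemma simple_function_FB_measurable:
  assumes "simple_function M f" "simple_function M g"
  shows "(\<lambda>t. FB_norm \<phi> s p q (f t - g t)) \<in> borel_measurable M"
  by (intro borel_measurable_simple_function simple_function_compose2[OF assms])

text \<open>To bound \<open>esssup\<close> by an almost-everywhere bound one needs measurability of
  the block norms in time, which is the work here. They are limits of the block norms of the Bochner
  approximants, because one block is controlled by the full norm.\<close>

lemma LFB_spaceI:
  assumes FB: "\<And>t. 0 \<le> t \<Longrightarrow> f t \<in> FB_space \<phi> s p q" and boch: "bochner_measurable_FB \<phi> s p q f"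
    and bound: "\<And>j. AE t in lebesgue_on {0..}. block_norm \<phi> p j (ft (f t)) \<le> b j"
    and fin: "weighted_lq q s b < top"
  shows "f \<in> LFB_space \<phi> s p q" and "LFB_norm \<phi> s p q f \<le> weighted_lq q s b"
proof -
  have meas: "(\<lambda>t. block_norm \<phi> p j (ft (f t))) \<in> borel_measurable (lebesgue_on {0..})" for j
  proof -
    obtain \<sigma> where \<sigma>: "\<And>n. simple_function (lebesgue_on {0..}) (\<sigma> n)"
      "\<And>n t. 0 \<le> t \<Longrightarrow> \<sigma> n t \<in> FB_space \<phi> s p q"
      "AE t in lebesgue_on {0..}. (\<lambda>n. FB_norm \<phi> s p q (\<sigma> n t - f t)) \<longlonglongrightarrow> 0"
      using boch unfolding bochner_measurable_FB_def by blast
    have [measurable]: "(\<lambda>t. block_norm \<phi> p j (ft (\<sigma> n t))) \<in> borel_measurable (lebesgue_on {0..})" for n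
      by (intro borel_measurable_simple_function simple_function_compose1[OF \<sigma>(1)])
    \<comment> \<open>\<open>limsup\<close> is measurable without any convergence; it remains to see
      that it equals the block norm at almost every time.\<close>
    have "(\<lambda>t. limsup (\<lambda>n. block_norm \<phi> p j (ft (\<sigma> n t)))) \<in> borel_measurable (lebesgue_on {0..})"
      by measurable
    then show ?thesis
    proof (rule measurable_lebesgue_on_AE_eq)
      show "AE t in lebesgue_on {0..}. limsup (\<lambda>n. block_norm \<phi> p j (ft (\<sigma> n t))) = block_norm \<phi> p j (ft (f t))"
        using \<sigma>(3) AE_space
      proof eventually_elim
        case (elim t)
        then have t: "0 \<le> t"
          by simp
        let ?b = "block_norm \<phi> p j (ft (f t))"
        define e where "e n = ennreal (2 powr (- (of_int j * s))) * FB_norm \<phi> s p q (\<sigma> n t - f t)" for n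
        have e: "e \<longlonglongrightarrow> 0"
          using ennreal_tendsto_cmult[OF _ elim(1), of "ennreal (2 powr (- (of_int j * s)))"]
          unfolding e_def by simp
        note [measurable] = FB_space_ft_measurable[OF FB[OF t]] FB_space_ft_measurable[OF \<sigma>(2)[OF t]]
        have d: "block_norm \<phi> p j (\<lambda>\<xi>. ft (\<sigma> n t) \<xi> - ft (f t) \<xi>) \<le> e n" for n
          unfolding e_def FB_norm_minus[OF \<sigma>(2)[OF t] FB[OF t]] FB_norm_ft_eq by (rule le_weighted_lq'[OF q])
        have 1: "block_norm \<phi> p j (ft (\<sigma> n t)) \<le> ?b + e n" for n
          by (rule order_trans[OF block_norm_le_add add_left_mono[OF d]])
            (use norm_triangle_sub in auto)
        have 2: "?b \<le> block_norm \<phi> p j (ft (\<sigma> n t)) + e n" for n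
          by (rule order_trans[OF block_norm_le_add add_left_mono[OF d]])
            (auto simp: norm_minus_commute[of "ft (\<sigma> n t) _"] intro!: norm_triangle_sub)
        have "limsup (\<lambda>n. block_norm \<phi> p j (ft (\<sigma> n t))) \<le> limsup (\<lambda>n. ?b + e n)"
          by (intro Limsup_mono always_eventually allI 1)
        also have "\<dots> = ?b + 0"
          by (intro lim_imp_Limsup tendsto_add tendsto_const e) simp
        finally have "limsup (\<lambda>n. block_norm \<phi> p j (ft (\<sigma> n t))) \<le> ?b"
          by simp
        moreover have "?b \<le> limsup (\<lambda>n. block_norm \<phi> p j (ft (\<sigma> n t)))"
        proof (rule ennreal_le_epsilon)
          fix d :: real assume "0 < d"
          then have "\<forall>\<^sub>F n in sequentially. e n < ennreal d"
            by (intro order_tendstoD(2)[OF e]) simp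
          then have "\<forall>\<^sub>F n in sequentially. ?b - ennreal d \<le> block_norm \<phi> p j (ft (\<sigma> n t))"
          proof eventually_elim
            case (elim n)
            then have "?b \<le> block_norm \<phi> p j (ft (\<sigma> n t)) + ennreal d"
              using order_trans[OF 2 add_left_mono[of "e n" "ennreal d"]] by simp
            then show ?case
              by (simp add: ennreal_minus_le_iff add.commute)
          qed
          then have "?b - ennreal d \<le> limsup (\<lambda>n. block_norm \<phi> p j (ft (\<sigma> n t)))"
            by (intro le_Limsup) auto
          then show "?b \<le> limsup (\<lambda>n. block_norm \<phi> p j (ft (\<sigma> n t))) + ennreal d"
            by (simp add: ennreal_minus_le_iff add.commute)
        qed
        ultimately show ?case
          by simp
      qed
    qed
  qed
  have "esssup (lebesgue_on {0..}) (\<lambda>t. block_norm \<phi> p j (ft (f t))) \<le> b j" for j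
    by (intro esssup_I meas bound)
  then show *: "LFB_norm \<phi> s p q f \<le> weighted_lq q s b"
    unfolding LFB_norm_eq by (rule weighted_lq_mono[OF q])
  show "f \<in> LFB_space \<phi> s p q"
    using FB boch le_less_trans[OF * fin] by (simp add: LFB_space_def)
qed

lemma LFB_block_bound:
  assumes "f \<in> LFB_space \<phi> s p q"
  shows "AE t in lborel. 0 \<le> t \<longrightarrow> (\<forall>j. ennreal (2 powr (of_int j * s)) * block_norm \<phi> p j (ft (f t)) \<le> LFB_norm \<phi> s p q f)"
proof -
  have "AE t in lebesgue_on {0..}. \<forall>j. ennreal (2 powr (of_int j * s)) * block_norm \<phi> p j (ft (f t)) \<le> LFB_norm \<phi> s p q f"
    unfolding AE_all_countable
  proof
    fix j
    show "AE t in lebesgue_on {0..}. ennreal (2 powr (of_int j * s)) * block_norm \<phi> p j (ft (f t)) \<le> LFB_norm \<phi> s p q f"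
      using esssup_AE[of "\<lambda>t. block_norm \<phi> p j (ft (f t))"]
    proof eventually_elim
      case (elim t)
      then have "ennreal (2 powr (of_int j * s)) * block_norm \<phi> p j (ft (f t)) \<le>
         ennreal (2 powr (of_int j * s)) * esssup (lebesgue_on {0..}) (\<lambda>t. block_norm \<phi> p j (ft (f t)))"
        by (rule mult_left_mono) simp
      also have "\<dots> \<le> LFB_norm \<phi> s p q f"
        unfolding LFB_norm_eq by (rule le_weighted_lq[OF q])
      finally show ?case .
    qed
  qed
  then show ?thesis
    by (simp add: AE_time_iff)
qed

lemma bochner_measurable_FB_minus:
  assumes f: "\<And>t. 0 \<le> t \<Longrightarrow> f t \<in> FB_space \<phi> s p q" "bochner_measurable_FB \<phi> s p q f"
    and g: "\<And>t. 0 \<le> t \<Longrightarrow> g t \<in> FB_space \<phi> s p q" "bochner_measurable_FB \<phi> s p q g"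
  shows "bochner_measurable_FB \<phi> s p q (\<lambda>t. f t - g t)"
proof -
  obtain \<sigma> where \<sigma>: "\<And>n. simple_function (lebesgue_on {0..}) (\<sigma> n)"
    "\<And>n t. 0 \<le> t \<Longrightarrow> \<sigma> n t \<in> FB_space \<phi> s p q"
    "AE t in lebesgue_on {0..}. (\<lambda>n. FB_norm \<phi> s p q (\<sigma> n t - f t)) \<longlonglongrightarrow> 0"
    using f(2) unfolding bochner_measurable_FB_def by blast
  obtain \<tau> where \<tau>: "\<And>n. simple_function (lebesgue_on {0..}) (\<tau> n)"
    "\<And>n t. 0 \<le> t \<Longrightarrow> \<tau> n t \<in> FB_space \<phi> s p q"
    "AE t in lebesgue_on {0..}. (\<lambda>n. FB_norm \<phi> s p q (\<tau> n t - g t)) \<longlonglongrightarrow> 0"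
    using g(2) unfolding bochner_measurable_FB_def by blast
  show ?thesis
    unfolding bochner_measurable_FB_def
  proof (intro exI[of _ "\<lambda>n t. \<sigma> n t - \<tau> n t"] conjI allI impI)
    show "simple_function (lebesgue_on {0..}) (\<lambda>t. \<sigma> n t - \<tau> n t)" for n
      by (rule simple_function_compose2[OF \<sigma>(1) \<tau>(1)])
    show "\<sigma> n t - \<tau> n t \<in> FB_space \<phi> s p q" if "0 \<le> t" for n t
      using that by (intro FB_space_minus \<sigma> \<tau>)
    show "AE t in lebesgue_on {0..}. (\<lambda>n. FB_norm \<phi> s p q (\<sigma> n t - \<tau> n t - (f t - g t))) \<longlonglongrightarrow> 0"
      using \<sigma>(3) \<tau>(3) AE_space
    proof eventually_elim
      case (elim t)
      then have t: "0 \<le> t"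
        by simp
      have "(\<lambda>n. FB_norm \<phi> s p q (\<sigma> n t - f t) + FB_norm \<phi> s p q (\<tau> n t - g t)) \<longlonglongrightarrow> 0"
        using tendsto_add[OF elim(1,2)] by simp
      then show ?case
        by (rule tendsto_sandwich[OF _ _ tendsto_const, rotated 2])
          (use \<sigma>(2)[OF t] \<tau>(2)[OF t] f(1)[OF t] g(1)[OF t] in \<open>auto intro!: always_eventually FB_norm_minus_minus_le\<close>)
    qed
  qed
qed

lemma bochner_measurable_FB_split:
  assumes f: "bochner_measurable_FB \<phi> s p q f" and g: "bochner_measurable_FB \<phi> s p q g"
  shows "bochner_measurable_FB \<phi> s p q (\<lambda>t. if T \<le> t then f t else g t)"
proof -
  obtain \<sigma> where \<sigma>: "\<And>n. simple_function (lebesgue_on {0..}) (\<sigma> n)"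
    "\<And>n t. 0 \<le> t \<Longrightarrow> \<sigma> n t \<in> FB_space \<phi> s p q"
    "AE t in lebesgue_on {0..}. (\<lambda>n. FB_norm \<phi> s p q (\<sigma> n t - f t)) \<longlonglongrightarrow> 0"
    using f unfolding bochner_measurable_FB_def by blast
  obtain \<tau> where \<tau>: "\<And>n. simple_function (lebesgue_on {0..}) (\<tau> n)"
    "\<And>n t. 0 \<le> t \<Longrightarrow> \<tau> n t \<in> FB_space \<phi> s p q"
    "AE t in lebesgue_on {0..}. (\<lambda>n. FB_norm \<phi> s p q (\<tau> n t - g t)) \<longlonglongrightarrow> 0"
    using g unfolding bochner_measurable_FB_def by blast
  show ?thesis
    unfolding bochner_measurable_FB_def
  proof (intro exI[of _ "\<lambda>n t. if T \<le> t then \<sigma> n t else \<tau> n t"] conjI allI impI)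
    show "simple_function (lebesgue_on {0..}) (\<lambda>t. if T \<le> t then \<sigma> n t else \<tau> n t)" for n
    proof -
      have "{T..} \<inter> {0..} \<in> sets (lebesgue_on {0..})"
        by (subst sets_restrict_space_iff) auto
      then show ?thesis
        using simple_function_If_set[OF \<sigma>(1) \<tau>(1), of "{T..}" n n] by simp
    qed
    show "(if T \<le> t then \<sigma> n t else \<tau> n t) \<in> FB_space \<phi> s p q" if "0 \<le> t" for n t
      using that \<sigma> \<tau> by simp
    show "AE t in lebesgue_on {0..}. (\<lambda>n. FB_norm \<phi> s p q ((if T \<le> t then \<sigma> n t else \<tau> n t) - (if T \<le> t then f t else g t))) \<longlonglongrightarrow> 0"
      using \<sigma>(3) \<tau>(3) by eventually_elim auto
  qed
qed

lemma LFB_space_minus: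
  assumes f: "f \<in> LFB_space \<phi> s p q" and g: "g \<in> LFB_space \<phi> s p q"
  shows "(\<lambda>t. f t - g t) \<in> LFB_space \<phi> s p q"
proof (rule LFB_spaceI(1))
  show "f t - g t \<in> FB_space \<phi> s p q" if "0 \<le> t" for t
    using that by (intro FB_space_minus LFB_spaceD f g)
  show "bochner_measurable_FB \<phi> s p q (\<lambda>t. f t - g t)"
    by (intro bochner_measurable_FB_minus LFB_spaceD f g)
  let ?F = "\<lambda>j. esssup (lebesgue_on {0..}) (\<lambda>t. block_norm \<phi> p j (ft (f t)))"
  let ?G = "\<lambda>j. esssup (lebesgue_on {0..}) (\<lambda>t. block_norm \<phi> p j (ft (g t)))"
  show "AE t in lebesgue_on {0..}. block_norm \<phi> p j (ft (f t - g t)) \<le> ?F j + ?G j" for j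
    using esssup_AE[of "\<lambda>t. block_norm \<phi> p j (ft (f t))"] esssup_AE[of "\<lambda>t. block_norm \<phi> p j (ft (g t))"] AE_space
  proof eventually_elim
    case (elim t)
    then have t: "0 \<le> t"
      by simp
    note FB = LFB_spaceD(1)[OF f t] LFB_spaceD(1)[OF g t]
    have "block_norm \<phi> p j (ft (f t - g t)) \<le> block_norm \<phi> p j (ft (f t)) + block_norm \<phi> p j (ft (g t))"
      unfolding block_norm_minus[OF FB] using FB[THEN FB_space_ft_measurable]
      by (intro block_norm_le_add AE_I2 norm_triangle_ineq4) auto
    also have "\<dots> \<le> ?F j + ?G j"
      using elim by (intro add_mono)
    finally show ?case .
  qed
  show "weighted_lq q s (\<lambda>j. ?F j + ?G j) < top"
    using weighted_lq_add[OF q, of s ?F ?G] LFB_spaceD(3)[OF f] LFB_spaceD(3)[OF g]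
    by (auto simp: LFB_norm_eq less_top[symmetric] top_unique)
qed

lemma LFB_space_split:
  assumes f: "f \<in> LFB_space \<phi> s p q" and g: "g \<in> LFB_space \<phi> s p q"
  shows "(\<lambda>t. if T \<le> t then f t else g t) \<in> LFB_space \<phi> s p q"
proof (rule LFB_spaceI(1))
  show "(if T \<le> t then f t else g t) \<in> FB_space \<phi> s p q" if "0 \<le> t" for t
    using that LFB_spaceD[OF f] LFB_spaceD[OF g] by simp
  show "bochner_measurable_FB \<phi> s p q (\<lambda>t. if T \<le> t then f t else g t)"
    by (intro bochner_measurable_FB_split LFB_spaceD f g)
  let ?F = "\<lambda>j. esssup (lebesgue_on {0..}) (\<lambda>t. block_norm \<phi> p j (ft (f t)))"
  let ?G = "\<lambda>j. esssup (lebesgue_on {0..}) (\<lambda>t. block_norm \<phi> p j (ft (g t)))"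
  show "AE t in lebesgue_on {0..}. block_norm \<phi> p j (ft (if T \<le> t then f t else g t)) \<le> ?F j + ?G j" for j
    using esssup_AE[of "\<lambda>t. block_norm \<phi> p j (ft (f t))"] esssup_AE[of "\<lambda>t. block_norm \<phi> p j (ft (g t))"]
    by eventually_elim (auto intro: order_trans add_increasing add_increasing2)
  show "weighted_lq q s (\<lambda>j. ?F j + ?G j) < top"
    using weighted_lq_add[OF q, of s ?F ?G] LFB_spaceD(3)[OF f] LFB_spaceD(3)[OF g]
    by (auto simp: LFB_norm_eq less_top[symmetric] top_unique)
qed

text \<open>The index of the approximating simple function is chosen measurably in \<open>t\<close> so that the
  selected functions converge geometrically, which upgrades norm convergence to convergence almost
  everywhere in \<open>\<xi>\<close>.\<close>

lemma bochner_measurable_FB_fast: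
  assumes FB: "\<And>t. 0 \<le> t \<Longrightarrow> f t \<in> FB_space \<phi> s p q" and boch: "bochner_measurable_FB \<phi> s p q f"
  obtains C \<tau> where "countable C" "C \<noteq> {}" "C \<subseteq> FB_space \<phi> s p q"
    "\<And>k::nat. \<tau> k \<in> lebesgue_on {0..} \<rightarrow>\<^sub>M count_space C"
    "AE t in lebesgue_on {0..}. \<forall>k. FB_norm \<phi> s p q (\<tau> k t - f t) \<le> ennreal ((1/2) ^ k)"
proof -
  let ?M = "lebesgue_on {0::real..}"
  obtain \<sigma> where \<sigma>: "\<And>n. simple_function ?M (\<sigma> n)"
    "\<And>n t. 0 \<le> t \<Longrightarrow> \<sigma> n t \<in> FB_space \<phi> s p q"
    "AE t in ?M. (\<lambda>n. FB_norm \<phi> s p q (\<sigma> n t - f t)) \<longlonglongrightarrow> 0"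
    using boch unfolding bochner_measurable_FB_def by blast
  define C where "C = (\<Union>n. \<sigma> n ` {0..})"
  have fin: "finite (\<sigma> n ` {0..})" for n
    using simple_functionD(1)[OF \<sigma>(1)] by simp
  have C: "countable C"
    unfolding C_def by (rule countable_UN) (auto intro: countable_finite fin)
  have \<sigma>_meas: "\<sigma> n \<in> ?M \<rightarrow>\<^sub>M count_space C" for n
    using simple_functionD(2)[OF \<sigma>(1), of n]
    by (subst measurable_count_space_eq_countable[OF C]) (auto simp: C_def)
  \<comment> \<open>A Cauchy condition among the approximants alone: norms of differences of simple
    functions are measurable in \<open>t\<close>, so the least good index is measurable too.\<close>
  define good where "good = (\<lambda>k n t. \<forall>m\<in>{n..}. FB_norm \<phi> s p q (\<sigma> n t - \<sigma> m t) \<le> ennreal ((1/2) ^ k))"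
  define N where "N = (\<lambda>k t. LEAST n. good k n t)"
  define \<tau> where "\<tau> = (\<lambda>k t. \<sigma> (N k t) t)"
  have [measurable]: "(\<lambda>t. FB_norm \<phi> s p q (\<sigma> n t - \<sigma> m t)) \<in> borel_measurable ?M" for n m
    by (rule simple_function_FB_measurable[OF \<sigma>(1) \<sigma>(1)])
  have [measurable]: "Measurable.pred ?M (good k n)" for k n
    unfolding good_def by measurable
  have N_meas: "N k \<in> ?M \<rightarrow>\<^sub>M count_space UNIV" for k
    unfolding N_def by measurable
  have "\<tau> k \<in> ?M \<rightarrow>\<^sub>M count_space C" for k
    unfolding \<tau>_def by (rule measurable_compose_countable[OF \<sigma>_meas N_meas])
  moreover have "AE t in ?M. \<forall>k. FB_norm \<phi> s p q (\<tau> k t - f t) \<le> ennreal ((1/2) ^ k)"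
    using \<sigma>(3) AE_space
  proof (eventually_elim, intro allI)
    fix t k assume lim: "(\<lambda>n. FB_norm \<phi> s p q (\<sigma> n t - f t)) \<longlonglongrightarrow> 0" and "t \<in> space ?M"
    then have t: "0 \<le> t"
      by simp
    note mem = FB[OF t] \<sigma>(2)[OF t]
    have "\<forall>\<^sub>F n in sequentially. FB_norm \<phi> s p q (\<sigma> n t - f t) < ennreal ((1/2) ^ k / 2)"
      by (rule order_tendstoD(2)[OF lim]) simp
    then obtain n0 where n0: "\<And>n. n0 \<le> n \<Longrightarrow> FB_norm \<phi> s p q (\<sigma> n t - f t) < ennreal ((1/2) ^ k / 2)"
      by (auto simp: eventually_sequentially)
    have "good k n0 t"
      unfolding good_def
    proof
      fix m assume m: "m \<in> {n0..}"
      have "FB_norm \<phi> s p q (\<sigma> n0 t - \<sigma> m t) \<le> FB_norm \<phi> s p q (\<sigma> n0 t - f t) + FB_norm \<phi> s p q (f t - \<sigma> m t)"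
        by (intro FB_norm_triangle mem)
      also have "\<dots> \<le> ennreal ((1/2) ^ k / 2) + ennreal ((1/2) ^ k / 2)"
        using n0[of n0] n0[of m] m by (intro add_mono) (auto simp: FB_norm_minus_commute[OF mem] less_imp_le)
      also have "\<dots> = ennreal ((1/2) ^ k)"
        by (simp flip: ennreal_plus)
      finally show "FB_norm \<phi> s p q (\<sigma> n0 t - \<sigma> m t) \<le> ennreal ((1/2) ^ k)" .
    qed
    then have good: "good k (N k t) t"
      unfolding N_def by (rule LeastI)
    \<comment> \<open>The index \<open>m\<close> tends to infinity in the triangle inequality
      through \<open>\<sigma> m t\<close>.\<close>
    have "FB_norm \<phi> s p q (\<tau> k t - f t) \<le> ennreal ((1/2) ^ k) + 0"
    proof (rule LIMSEQ_le_const[OF tendsto_add[OF tendsto_const lim]], intro exI[of _ "N k t"] allI impI)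
      fix m assume m: "N k t \<le> m"
      have "FB_norm \<phi> s p q (\<tau> k t - f t) \<le> FB_norm \<phi> s p q (\<tau> k t - \<sigma> m t) + FB_norm \<phi> s p q (\<sigma> m t - f t)"
        unfolding \<tau>_def by (intro FB_norm_triangle mem)
      also have "\<dots> \<le> ennreal ((1/2) ^ k) + FB_norm \<phi> s p q (\<sigma> m t - f t)"
        using good m unfolding good_def \<tau>_def by (intro add_right_mono) auto
      finally show "FB_norm \<phi> s p q (\<tau> k t - f t) \<le> ennreal ((1/2) ^ k) + FB_norm \<phi> s p q (\<sigma> m t - f t)" .
    qed
    then show "FB_norm \<phi> s p q (\<tau> k t - f t) \<le> ennreal ((1/2) ^ k)"
      by simp
  qed
  moreover have "C \<subseteq> FB_space \<phi> s p q" "C \<noteq> {}"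
    using \<sigma>(2) by (auto simp: C_def)
  ultimately show thesis
    using C that by blast
qed

text \<open>Geometric decay gives convergence almost everywhere after multiplication by each cutoff,
  and off the origin some cutoff can be divided out.\<close>

lemma AE_tendsto_of_FB_norm_ft:
  assumes [measurable]: "\<And>k. h k \<in> borel_measurable borel"
    and le: "\<And>k. FB_norm_ft \<phi> s p q (h k) \<le> ennreal ((1/2) ^ k)"
  shows "AE \<xi> in lborel. (\<lambda>k. h k \<xi>) \<longlonglongrightarrow> 0"
proof -
  have "AE \<xi> in lborel. \<forall>j. (\<lambda>k. ennreal (cut j \<xi>) * ennreal (norm (h k \<xi>))) \<longlonglongrightarrow> 0"
    unfolding AE_all_countable
  proof (intro allI Lp_norm_fast_convergence_AE[OF p])
    fix j k
    have "block_norm \<phi> p j (h k) \<le> ennreal (2 powr (- (of_int j * s))) * FB_norm_ft \<phi> s p q (h k)"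
      unfolding FB_norm_ft_eq by (rule le_weighted_lq'[OF q])
    also have "\<dots> \<le> ennreal (2 powr (- (of_int j * s))) * ennreal ((1/2) ^ k)"
      by (intro mult_left_mono le) simp
    finally show "Lp_norm lborel p (\<lambda>\<xi>. ennreal (cut j \<xi>) * ennreal (norm (h k \<xi>))) \<le>
        ennreal (2 powr (- (of_int j * s))) * ennreal ((1/2) ^ k)"
      by (simp add: block_norm_eq block_def)
  qed auto
  then show ?thesis
    using AE_lborel_singleton[of 0]
  proof eventually_elim
    case (elim \<xi>)
    then obtain j where j: "0 < cut j \<xi>"
      using cut_partition by blast
    have "(\<lambda>k. ennreal (cut j \<xi> * norm (h k \<xi>))) \<longlonglongrightarrow> ennreal 0"
      using elim(1)[rule_format, of j] by (simp add: ennreal_mult)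
    then have "(\<lambda>k. cut j \<xi> * norm (h k \<xi>)) \<longlonglongrightarrow> 0"
      by (subst (asm) tendsto_ennreal_iff) auto
    then have "(\<lambda>k. inverse (cut j \<xi>) * (cut j \<xi> * norm (h k \<xi>))) \<longlonglongrightarrow> inverse (cut j \<xi>) * 0"
      by (intro tendsto_intros)
    then have "(\<lambda>k. norm (h k \<xi>)) \<longlonglongrightarrow> 0"
      using j by (simp add: mult.assoc[symmetric])
    then show ?case
      by (rule tendsto_norm_zero_cancel)
  qed
qed

text \<open>The countable set is coded by natural numbers, so that a Lebesgue measurable index can
  be replaced by a Borel one through the real-valued case. Decoding by the floor always yields an
  element of \<open>C\<close>.\<close>

lemma measurable_count_space_lborel_version:
  assumes C: "countable C" "C \<noteq> {}" and \<tau>: "\<tau> \<in> lebesgue_on {0::real..} \<rightarrow>\<^sub>M count_space C"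
  obtains \<tau>' where "\<tau>' \<in> lborel \<rightarrow>\<^sub>M count_space C" "AE t in lborel. 0 \<le> t \<longrightarrow> \<tau> t = \<tau>' t"
proof -
  have "(\<lambda>t. real (to_nat_on C (\<tau> t))) \<in> borel_measurable (lebesgue_on {0..})"
    by (rule measurable_compose[OF \<tau>]) simp
  then have "(\<lambda>t. if t \<in> {0..} then real (to_nat_on C (\<tau> t)) else 0) \<in> borel_measurable lebesgue"
    by (subst borel_measurable_if) auto
  then obtain e where e: "e \<in> borel_measurable lborel"
    "AE t in lborel. (if t \<in> {0..} then real (to_nat_on C (\<tau> t)) else 0) = e t"
    using completion_ex_borel_measurable_real by blast
  note [measurable] = e(1)
  have n: "(\<lambda>t. nat \<lfloor>e t\<rfloor>) \<in> lborel \<rightarrow>\<^sub>M count_space UNIV"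
    by measurable
  have "(\<lambda>t. from_nat_into C (nat \<lfloor>e t\<rfloor>)) \<in> lborel \<rightarrow>\<^sub>M count_space C"
    by (rule measurable_compose[OF n]) (use C in \<open>auto intro: from_nat_into\<close>)
  moreover have "AE t in lborel. 0 \<le> t \<longrightarrow> \<tau> t = from_nat_into C (nat \<lfloor>e t\<rfloor>)"
    using e(2)
  proof (eventually_elim, intro impI)
    fix t assume t: "(if t \<in> {0..} then real (to_nat_on C (\<tau> t)) else 0) = e t" "0 \<le> t"
    then have "\<tau> t \<in> C"
      using measurable_space[OF \<tau>, of t] by simp
    with t C show "\<tau> t = from_nat_into C (nat \<lfloor>e t\<rfloor>)"
      by (auto simp flip: t(1))
  qed
  ultimately show thesis
    by (rule that)
qed

text \<open>For countably many distributions the arbitrary choices made by \<open>ft\<close> are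
  harmless: the transform of the \<open>k\<close>-th approximant is jointly measurable because its
  index is measurable in time. The pointwise limit agrees with the transform of \<open>f t\<close>
  for almost every frequency at almost every time.\<close>

lemma ft_time_exists:
  assumes f: "f \<in> LFB_space \<phi> s p q"
  shows "\<exists>g. case_prod g \<in> borel_measurable (lborel \<Otimes>\<^sub>M lborel) \<and> (AE t in lborel. 0 \<le> t \<longrightarrow> has_ft (f t) (g t))"
proof -
  obtain C \<tau> where C: "countable C" "C \<noteq> {}" "C \<subseteq> FB_space \<phi> s p q"
    and \<tau>: "\<And>k::nat. \<tau> k \<in> lebesgue_on {0..} \<rightarrow>\<^sub>M count_space C"
      "AE t in lebesgue_on {0..}. \<forall>k. FB_norm \<phi> s p q (\<tau> k t - f t) \<le> ennreal ((1/2) ^ k)"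
    using bochner_measurable_FB_fast[OF LFB_spaceD(1,2)[OF f]] by blast
  have "\<exists>\<tau>'. \<tau>' \<in> lborel \<rightarrow>\<^sub>M count_space C \<and> (AE t in lborel. 0 \<le> t \<longrightarrow> \<tau> k t = \<tau>' t)" for k
    using measurable_count_space_lborel_version[OF C(1,2) \<tau>(1)] by blast
  then obtain \<tau>' where \<tau>': "\<And>k. \<tau>' k \<in> lborel \<rightarrow>\<^sub>M count_space C"
    "\<And>k. AE t in lborel. 0 \<le> t \<longrightarrow> \<tau> k t = \<tau>' k t"
    by metis
  define g where "g = (\<lambda>t \<xi>. lim (\<lambda>k. ft (\<tau>' k t) \<xi>))"
  have [measurable]: "(\<lambda>x. ft (\<tau>' k (fst x)) (snd x)) \<in> borel_measurable (lborel \<Otimes>\<^sub>M lborel)" for k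
  proof (rule measurable_compose_countable'[OF _ _ C(1), of "\<lambda>c x. ft c (snd x)" _ _ "\<lambda>x. \<tau>' k (fst x)"])
    show "(\<lambda>x. ft c (snd x)) \<in> borel_measurable (lborel \<Otimes>\<^sub>M lborel)" if "c \<in> C" for c
      using FB_space_ft_measurable[of c s] that C(3) by (intro measurable_compose[OF measurable_snd]) auto
    show "(\<lambda>x. \<tau>' k (fst x)) \<in> lborel \<Otimes>\<^sub>M lborel \<rightarrow>\<^sub>M count_space C"
      by (rule measurable_compose[OF measurable_fst \<tau>'(1)])
  qed
  have g_meas: "case_prod g \<in> borel_measurable (lborel \<Otimes>\<^sub>M lborel)"
    unfolding g_def case_prod_beta' by measurable
  have "AE t in lborel. \<forall>k. 0 \<le> t \<longrightarrow> \<tau> k t = \<tau>' k t"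
    unfolding AE_all_countable using \<tau>'(2) by blast
  then have "AE t in lborel. 0 \<le> t \<longrightarrow> has_ft (f t) (g t)"
    using \<tau>(2)[unfolded AE_time_iff]
  proof (eventually_elim, intro impI)
    fix t :: real assume t: "0 \<le> t" and "\<forall>k. 0 \<le> t \<longrightarrow> \<tau> k t = \<tau>' k t"
      "0 \<le> t \<longrightarrow> (\<forall>k. FB_norm \<phi> s p q (\<tau> k t - f t) \<le> ennreal ((1/2) ^ k))"
    then have le: "FB_norm \<phi> s p q (\<tau>' k t - f t) \<le> ennreal ((1/2) ^ k)" for k
      by auto
    have mem: "\<tau>' k t \<in> FB_space \<phi> s p q" "f t \<in> FB_space \<phi> s p q" for k
      using measurable_space[OF \<tau>'(1), of t k] C(3) LFB_spaceD(1)[OF f t] by auto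
    note [measurable] = mem[THEN FB_space_ft_measurable]
    have "AE \<xi> in lborel. (\<lambda>k. ft (\<tau>' k t) \<xi> - ft (f t) \<xi>) \<longlonglongrightarrow> 0"
      by (rule AE_tendsto_of_FB_norm_ft) (use le in \<open>auto simp: FB_norm_minus[OF mem]\<close>)
    then have "AE \<xi> in lborel. ft (f t) \<xi> = g t \<xi>"
      by eventually_elim (auto simp: g_def LIM_zero_iff intro!: limI[symmetric])
    then show "has_ft (f t) (g t)"
      by (rule has_ft_cong_AE[OF FB_space_has_ft[OF mem(2)]]) (use measurable_Pair2[OF g_meas, of t] in simp)
  qed
  with g_meas show ?thesis
    by blast
qed

lemma
  assumes f: "f \<in> LFB_space \<phi> s p q"
  shows ft_time_measurable: "case_prod (ft_time f) \<in> borel_measurable (lborel \<Otimes>\<^sub>M lborel)"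
    and ft_time_has_ft: "AE t in lborel. 0 \<le> t \<longrightarrow> has_ft (f t) (ft_time f t)"
  using someI_ex[OF ft_time_exists[OF f]] unfolding ft_time_def by blast+

lemma ft_time_AE:
  assumes f: "f \<in> LFB_space \<phi> s p q"
  shows "AE t in lborel. 0 \<le> t \<longrightarrow> (AE \<xi> in lborel. ft_time f t \<xi> = ft (f t) \<xi>)"
  using ft_time_has_ft[OF f]
  by eventually_elim (auto intro: has_ft_unique[OF cutoff] has_ft_ft)

lemma ft_time_measurable' [measurable]:
  assumes f: "f \<in> LFB_space \<phi> s p q"
  shows "ft_time f t \<in> borel_measurable borel"
  using measurable_Pair2[OF ft_time_measurable[OF f], of t] by simp

lemma ft_time_minus:
  assumes f: "f \<in> LFB_space \<phi> s p q" and g: "g \<in> LFB_space \<phi> s p q"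
  shows "AE t in lborel. 0 \<le> t \<longrightarrow> (AE \<xi> in lborel. ft_time (\<lambda>t. f t - g t) t \<xi> = ft_time f t \<xi> - ft_time g t \<xi>)"
  using ft_time_has_ft[OF f] ft_time_has_ft[OF g] ft_time_has_ft[OF LFB_space_minus[OF f g]]
  by eventually_elim (auto intro: has_ft_unique[OF cutoff] has_ft_minus)

end

section \<open>The product estimate\<close>

definition pow2 :: "real \<Rightarrow> ennreal" where
  "pow2 x = ennreal (2 powr x)"

lemma pow2_mult: "pow2 x * pow2 y = pow2 (x + y)"
  by (simp add: pow2_def powr_add flip: ennreal_mult)

lemma pow2_mult_left: "pow2 x * (pow2 y * z) = pow2 (x + y) * z"
  by (simp add: pow2_mult flip: mult.assoc)

lemma pow2_0 [simp]: "pow2 0 = 1"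
  by (simp add: pow2_def)

lemma pow2_finite [simp]: "pow2 x < top" "pow2 x \<noteq> top" "pow2 x \<noteq> 0"
  by (simp_all add: pow2_def)

lemma pow2_le_swap: "pow2 x * a \<le> b \<longleftrightarrow> a \<le> pow2 (- x) * b"
proof
  assume "pow2 x * a \<le> b"
  then have "pow2 (- x) * (pow2 x * a) \<le> pow2 (- x) * b"
    by (rule mult_left_mono) simp
  then show "a \<le> pow2 (- x) * b"
    by (simp add: pow2_mult_left)
next
  assume "a \<le> pow2 (- x) * b"
  then have "pow2 x * a \<le> pow2 x * (pow2 (- x) * b)"
    by (rule mult_left_mono) simp
  then show "pow2 x * a \<le> b"
    by (simp add: pow2_mult_left)
qed

lemma suminf_pow2:
  assumes "0 < x"
  shows "(\<Sum>n. pow2 (- (real n * x))) = ennreal (1 / (1 - 2 powr (- x)))"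
proof -
  have "2 powr (- x) < 1"
    using assms by (simp add: powr_less_one)
  then have "(\<lambda>n. (2 powr (- x)) ^ n) sums (1 / (1 - 2 powr (- x)))"
    by (intro geometric_sums) simp
  moreover have "(2 powr (- x)) ^ n = 2 powr (- (real n * x))" for n
    by (simp add: powr_powr mult.commute flip: powr_realpow)
  ultimately show ?thesis
    unfolding pow2_def by (intro suminf_ennreal_eq) simp_all
qed

text \<open>Sharp dyadic annuli partition the nonzero frequencies, whereas the smooth blocks
  overlap. Convolutions are estimated on annuli and the result is carried back to blocks.\<close>

definition annulus :: "int \<Rightarrow> (real^3) set" where
  "annulus k = {\<xi>. 2 powr k \<le> norm \<xi> \<and> norm \<xi> < 2 powr (k + 1)}"

lemma annulus_measurable [measurable]: "annulus k \<in> sets borel"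
  unfolding annulus_def by measurable

lemma ex_annulus:
  assumes "\<xi> \<noteq> 0" obtains k where "\<xi> \<in> annulus k"
proof -
  define k where "k = \<lfloor>log 2 (norm \<xi>)\<rfloor>"
  have "2 powr of_int k \<le> 2 powr log 2 (norm \<xi>)" "2 powr log 2 (norm \<xi>) < 2 powr (of_int k + 1)"
    unfolding k_def by (auto intro: powr_mono powr_less_mono)
  with assms show thesis
    by (intro that[of k]) (simp add: annulus_def)
qed

lemma emeasure_annulus_le: "emeasure lborel (annulus k) \<le> ennreal (8 * unit_ball_vol 3) * pow2 (3 * k)"
proof -
  have "emeasure lborel (annulus k) \<le> emeasure lborel (ball (0::real^3) (2 powr (k + 1)))"
    by (intro emeasure_mono) (auto simp: annulus_def)
  also have "\<dots> = ennreal (unit_ball_vol 3 * (2 powr (k + 1)) ^ 3)"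
    by (subst emeasure_ball) auto
  also have "unit_ball_vol 3 * (2 powr (k + 1)) ^ 3 = (8 * unit_ball_vol 3) * 2 powr (3 * k)"
  proof -
    have "(2 powr (k + 1)) ^ 3 = (2 powr (k + 1)) powr (3::real)"
      by (simp add: powr_numeral)
    also have "\<dots> = 2 powr (3 * k + 3)"
      by (simp add: powr_powr algebra_simps)
    finally show ?thesis
      by (simp add: powr_add)
  qed
  finally show ?thesis
    by (simp add: pow2_def ennreal_mult')
qed

text \<open>Applied to absolute values it dominates \<open>convolution\<close> and has a value
  whether or not the integral converges.\<close>

definition nnconv :: "(real^3 \<Rightarrow> ennreal) \<Rightarrow> (real^3 \<Rightarrow> ennreal) \<Rightarrow> real^3 \<Rightarrow> ennreal" where
  "nnconv f g \<xi> = (\<integral>\<^sup>+\<eta>. f (\<xi> - \<eta>) * g \<eta> \<partial>lborel)"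

lemma nnconv_measurable [measurable]:
  assumes [measurable]: "f \<in> borel_measurable borel" "g \<in> borel_measurable borel"
  shows "nnconv f g \<in> borel_measurable borel"
  unfolding nnconv_def by measurable

section \<open>Translation invariance, Young's inequality and Bernstein's inequality\<close>

lemma nn_integral_lborel_reflect:
  fixes f :: "'a::euclidean_space \<Rightarrow> ennreal"
  assumes [measurable]: "f \<in> borel_measurable borel"
  shows "(\<integral>\<^sup>+x. f (a - x) \<partial>lborel) = (\<integral>\<^sup>+x. f x \<partial>lborel)"
proof -
  have "(\<integral>\<^sup>+x. f x \<partial>lborel) = (\<integral>\<^sup>+x. f x \<partial>density (distr lborel borel (\<lambda>x. a + (- 1) *\<^sub>R x)) (\<lambda>_. ennreal (\<bar>- 1\<bar> ^ DIM('a))))"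
    using lborel_affine[of "- 1" a] by simp
  also have "\<dots> = (\<integral>\<^sup>+x. f (a - x) \<partial>lborel)"
    by (simp add: nn_integral_density nn_integral_distr density_1)
  finally show ?thesis
    by simp
qed

lemma nn_integral_lborel_translate:
  fixes f :: "'a::euclidean_space \<Rightarrow> ennreal"
  assumes [measurable]: "f \<in> borel_measurable borel"
  shows "(\<integral>\<^sup>+x. f (x - a) \<partial>lborel) = (\<integral>\<^sup>+x. f x \<partial>lborel)"
proof -
  have "(\<integral>\<^sup>+x. f x \<partial>lborel) = (\<integral>\<^sup>+x. f x \<partial>distr lborel borel ((+) (- a)))"
    by (simp add: lborel_distr_plus)
  also have "\<dots> = (\<integral>\<^sup>+x. f (x - a) \<partial>lborel)"
    by (simp add: nn_integral_distr)
  finally show ?thesis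
    by simp
qed

lemma AE_lborel_translate:
  fixes P :: "'a::euclidean_space \<Rightarrow> bool"
  assumes [measurable]: "Measurable.pred borel P" and P: "AE x in lborel. P x"
  shows "AE x in lborel. P (x - a)"
proof -
  have "AE x in distr lborel borel ((+) (- a)). P x"
    unfolding lborel_distr_plus by (rule P)
  then show ?thesis
    by (subst (asm) AE_distr_iff) auto
qed

lemma AE_lborel_reflect:
  fixes P :: "'a::euclidean_space \<Rightarrow> bool"
  assumes P: "AE x in lborel. P x"
  shows "AE x in lborel. P (a - x)"
proof -
  obtain N where N: "{x. \<not> P x} \<subseteq> N" "emeasure lborel N = 0" "N \<in> sets borel"
    using AE_E[OF P] by auto
  have "(\<integral>\<^sup>+x. indicator N (a - x) \<partial>lborel) = 0"
    using N by (subst nn_integral_lborel_reflect) auto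
  then have "AE x in lborel. indicator N (a - x) = (0::ennreal)"
    using N(3) by (subst (asm) nn_integral_0_iff_AE) auto
  then show ?thesis
    using N(1) by (auto elim!: eventually_mono simp: indicator_def split: if_splits)
qed

lemma nnconv_commute:
  assumes [measurable]: "f \<in> borel_measurable borel" "g \<in> borel_measurable borel"
  shows "nnconv f g \<xi> = nnconv g f \<xi>"
  using nn_integral_lborel_reflect[of "\<lambda>\<eta>. f (\<xi> - \<eta>) * g \<eta>" \<xi>]
  by (simp add: nnconv_def mult.commute)

lemma Lp_norm_translate:
  assumes p: "1 \<le> p" and [measurable]: "f \<in> borel_measurable borel"
  shows "Lp_norm lborel p (\<lambda>x::real^3. f (x - a)) = Lp_norm lborel p f"
proof (cases "p = top")
  case True
  have "(AE x in lborel. f (x - a) \<le> c) \<longleftrightarrow> (AE x in lborel. f x \<le> c)" for c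
  proof
    assume "AE x in lborel. f (x - a) \<le> c"
    from AE_lborel_translate[OF _ this, of "- a"] show "AE x in lborel. f x \<le> c"
      by simp
  next
    assume "AE x in lborel. f x \<le> c"
    from AE_lborel_translate[OF _ this, of a] show "AE x in lborel. f (x - a) \<le> c"
      by simp
  qed
  then have "Lp_norm lborel top (\<lambda>x. f (x - a)) \<le> c \<longleftrightarrow> Lp_norm lborel top f \<le> c" for c
    by (simp add: Lp_norm_top_le_iff)
  then show ?thesis
    unfolding True by (meson antisym order_refl)
next
  case False
  then show ?thesis
    using nn_integral_lborel_translate[of "\<lambda>x. ennreal_powr (f x) (enn2real p)" a] by (simp add: Lp_norm_def)
qed

lemma Young_L1_Lp:
  assumes p: "1 \<le> p" and [measurable]: "f \<in> borel_measurable borel" "g \<in> borel_measurable borel"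
    and fin: "(\<integral>\<^sup>+\<eta>. g \<eta> \<partial>lborel) < top"
  shows "Lp_norm lborel p (nnconv f g) \<le> (\<integral>\<^sup>+\<eta>. g \<eta> \<partial>lborel) * Lp_norm lborel p f"
proof -
  have "Lp_norm lborel p (\<lambda>\<xi>. \<integral>\<^sup>+\<eta>. g \<eta> * f (\<xi> - \<eta>) \<partial>lborel) \<le> (\<integral>\<^sup>+\<eta>. g \<eta> \<partial>lborel) * Lp_norm lborel p f"
    by (rule Minkowski_integral_kernel[OF p sigma_finite_lborel sigma_finite_lborel _ _ fin])
      (auto simp: Lp_norm_translate[OF p])
  then show ?thesis
    by (simp add: nnconv_def[abs_def] mult.commute)
qed

text \<open>Hoelder's inequality, obtained from Jensen with the indicator of the annulus as weight:
  the factor is its volume to the power 1 - 1/p. The maximum with 1 lets one constant serve for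
  every \<open>p\<close>.\<close>

lemma Bernstein_annulus:
  assumes p: "1 \<le> p" and [measurable]: "f \<in> borel_measurable borel"
  shows "(\<integral>\<^sup>+\<xi>. indicator (annulus k) \<xi> * f \<xi> \<partial>lborel) \<le>
    ennreal (max 1 (8 * unit_ball_vol 3)) * pow2 (k * (3 - enn2real (3 / p))) * Lp_norm lborel p (\<lambda>\<xi>. indicator (annulus k) \<xi> * f \<xi>)"
    (is "?I \<le> ennreal ?c * _ * ?N")
proof -
  let ?K = "emeasure lborel (annulus k)"
  have K_int: "(\<integral>\<^sup>+\<xi>. indicator (annulus k) \<xi> \<partial>lborel) = ?K"
    by simp
  have K_le: "?K \<le> ennreal ?c * pow2 (3 * k)"
    by (rule order_trans[OF emeasure_annulus_le]) (auto intro!: mult_right_mono)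
  then have K_fin: "?K < top"
    by (rule le_less_trans) (simp add: ennreal_mult_less_top)
  show ?thesis
  proof (cases "p = top")
    case True
    have "AE \<xi> in lborel. indicator (annulus k) \<xi> * f \<xi> \<le> ?N"
      using Lp_norm_top_le_iff[of "\<lambda>\<xi>. indicator (annulus k) \<xi> * f \<xi>" lborel ?N] True by simp
    then have "?I \<le> (\<integral>\<^sup>+\<xi>. indicator (annulus k) \<xi> * ?N \<partial>lborel)"
      by (intro nn_integral_mono_AE) (auto elim!: eventually_mono split: split_indicator)
    also have "\<dots> = ?K * ?N"
      by (simp add: nn_integral_multc)
    also have "\<dots> \<le> ennreal ?c * pow2 (3 * k) * ?N"
      by (intro mult_right_mono K_le) simp
    finally show ?thesis
      using True by (simp add: mult.commute[of 3])
  next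
    case False
    note P = enn2real_ge_1[OF p False]
    define P' where "P' = enn2real p"
    have p_eq: "p = ennreal P'"
      using False by (simp add: P'_def less_top)
    have P'_ge: "1 \<le> P'"
      using P by (simp add: P'_def)
    have ip: "enn2real (3 / p) = 3 / P'"
      using P'_ge divide_ennreal[of 3 P'] unfolding p_eq by simp
    show ?thesis
    proof (cases "?K = 0")
      case True
      then have "AE \<xi> in lborel. \<xi> \<notin> annulus k"
        by (intro AE_not_in) (simp add: null_sets_def)
      then have "?I = 0"
        by (subst nn_integral_0_iff_AE) (auto elim!: eventually_mono)
      then show ?thesis
        by simp
    next
      case K0: False
      let ?S = "\<integral>\<^sup>+\<xi>. indicator (annulus k) \<xi> * ennreal_powr (f \<xi>) P' \<partial>lborel"
      have "ennreal_powr ?I P' \<le> ennreal_powr ?K P' * (?S / ?K)"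
        using K0 K_fin P by (intro Jensen_powr_nn_integral[OF _ _ _ K_int]) (auto simp: P'_def zero_less_iff_neq_zero)
      also have "?S = (\<integral>\<^sup>+\<xi>. ennreal_powr (indicator (annulus k) \<xi> * f \<xi>) P' \<partial>lborel)"
        by (intro nn_integral_cong) (auto split: split_indicator)
      also have "\<dots> \<le> ennreal_powr ?N P'"
        unfolding P'_def by (rule Lp_norm_finite_le_iff[OF p False, THEN iffD1, OF order_refl])
      finally have "ennreal_powr ?I P' \<le> ennreal_powr ?K P' * (ennreal_powr ?N P' / ?K)"
        by (simp add: divide_right_mono_ennreal mult_left_mono)
      also have "\<dots> = ennreal_powr (ennreal_powr ?K (1 - 1 / P') * ?N) P'"
      proof -
        obtain m where m: "?K = ennreal m" "0 < m"
          using K0 K_fin by (cases ?K) auto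
        have e1: "ennreal_powr ?K P' / ?K = ennreal_powr ?K (P' - 1)"
          using m by (simp add: ennreal_powr_ennreal divide_ennreal powr_diff)
        have e2: "(1 - 1 / P') * P' = P' - 1"
          using P by (simp add: P'_def field_simps)
        have e3: "a * (b / c) = (a / c) * b" for a b c :: ennreal
          by (simp add: divide_ennreal_def mult_ac)
        show ?thesis
          unfolding ennreal_powr_mult ennreal_powr_powr e2 e1[symmetric] by (rule e3)
      qed
      finally have "?I \<le> ennreal_powr ?K (1 - 1 / P') * ?N"
        using P by (subst (asm) ennreal_powr_le_iff) (auto simp: P'_def)
      also have "ennreal_powr ?K (1 - 1 / P') \<le> ennreal ?c * pow2 (k * (3 - enn2real (3 / p)))"
      \<comment> \<open>Monotonicity of \<open>ennreal_powr\<close> is available for positive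
        exponents, so the exponent 0 is treated apart.\<close>
      proof (cases "P' = 1")
        case True
        have "ennreal_powr ?K 0 \<le> 1"
          using K_fin by (cases ?K) (auto simp: ennreal_powr_ennreal powr_def)
        also have "\<dots> \<le> ennreal ?c * 1"
          by simp
        finally show ?thesis
          using True by (simp add: ip)
      next
        case False
        then have P1: "0 < 1 - 1 / P'" "1 - 1 / P' \<le> 1"
          using P'_ge by (auto simp: field_simps)
        have "ennreal_powr ?K (1 - 1 / P') \<le> ennreal_powr (ennreal ?c * pow2 (3 * k)) (1 - 1 / P')"
          by (intro ennreal_powr_mono K_le P1)
        also have "\<dots> = ennreal (?c powr (1 - 1 / P')) * pow2 (3 * k * (1 - 1 / P'))"
          by (simp add: ennreal_powr_mult pow2_def ennreal_powr_ennreal powr_powr)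
        also have "\<dots> \<le> ennreal ?c * pow2 (3 * k * (1 - 1 / P'))"
          using P1 powr_mono[of "1 - 1 / P'" 1 ?c] by (intro mult_right_mono ennreal_leI) auto
        also have "3 * k * (1 - 1 / P') = k * (3 - enn2real (3 / p))"
          by (simp add: ip algebra_simps)
        finally show ?thesis .
      qed
      finally show ?thesis
        by (simp add: mult_right_mono)
    qed
  qed
qed

section \<open>Comparison of smooth blocks and sharp annuli\<close>

context fourier_besov
begin

text \<open>The cutoffs sum to 1, and on an annulus only three of them can be nonzero, because the
  support radii 3/4 and 8/3 allow an index shift of at most one.\<close>

lemma indicator_annulus_le_cut:
  "indicator (annulus k) \<xi> \<le> cut (k - 1) \<xi> + cut k \<xi> + cut (k + 1) \<xi>"
proof (cases "\<xi> \<in> annulus k")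
  case True
  then have nz: "\<xi> \<noteq> 0"
    using powr_gt_zero[of 2 "real_of_int k"] by (auto simp: annulus_def)
  let ?f = "\<lambda>j::int. \<phi> (2 powr (- of_int j) *\<^sub>R \<xi>)"
  have supp: "?f j = 0" if "j \<notin> {k - 1, k, k + 1}" for j
  proof (rule ccontr)
    assume "?f j \<noteq> 0"
    then have "cut j \<xi> \<noteq> 0"
      by (simp add: cut_def)
    note b = cut_support[OF this]
    have "3/4 * 2 powr j < 2 powr (of_int k + 1)"
      using b True by (auto simp: annulus_def)
    also have "(2::real) powr (of_int k + 1) < 3/4 * 2 powr (of_int k + 2)"
      by (simp add: powr_add)
    finally have "real_of_int j < of_int k + 2"
      by simp
    moreover have "2 powr k \<le> 8/3 * 2 powr j"
      using b True by (auto simp: annulus_def)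
    moreover have "8/3 * 2 powr j < 2 powr (of_int j + 2)"
      by (simp add: powr_add)
    ultimately have "real_of_int j < of_int k + 2" "2 powr real_of_int k < 2 powr (of_int j + 2)"
      by linarith+
    then have "real_of_int j < of_int k + 2" "real_of_int k < of_int j + 2"
      by simp_all
    then have "j < k + 2" "k < j + 2"
      by linarith+
    with that show False
      by auto
  qed
  have "(?f has_sum 1) UNIV"
    using cutoff nz unfolding LP_cutoff_def by blast
  then have "(?f has_sum 1) {k - 1, k, k + 1}"
    by (subst has_sum_cong_neutral[where S="{k - 1, k, k + 1}" and T=UNIV and g="?f"]) (use supp in auto)
  then have "(\<Sum>j\<in>{k - 1, k, k + 1}. ?f j) = 1"
    using has_sum_unique[OF has_sum_finite[of "{k - 1, k, k + 1}" ?f]] by blast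
  then have "1 \<le> norm (?f (k - 1) + (?f k + ?f (k + 1)))"
    by simp
  also have "\<dots> \<le> norm (?f (k - 1)) + (norm (?f k) + norm (?f (k + 1)))"
    by (intro order_trans[OF norm_triangle_ineq] add_left_mono norm_triangle_ineq)
  finally show ?thesis
    using True by (simp add: cut_def)
qed simp

lemma Lp_norm_annulus_le_block:
  assumes [measurable]: "f \<in> borel_measurable borel"
  shows "Lp_norm lborel p (\<lambda>\<xi>. indicator (annulus k) \<xi> * f \<xi>) \<le> block (k - 1) f + block k f + block (k + 1) f"
proof -
  have "Lp_norm lborel p (\<lambda>\<xi>. indicator (annulus k) \<xi> * f \<xi>) \<le>
      Lp_norm lborel p (\<lambda>\<xi>. (ennreal (cut (k - 1) \<xi>) * f \<xi> + ennreal (cut k \<xi>) * f \<xi>) + ennreal (cut (k + 1) \<xi>) * f \<xi>)"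
  proof (rule Lp_norm_mono[OF p])
    fix \<xi>
    have "indicator (annulus k) \<xi> = ennreal (indicator (annulus k) \<xi>)"
      by (simp split: split_indicator)
    also have "\<dots> \<le> ennreal (cut (k - 1) \<xi> + cut k \<xi> + cut (k + 1) \<xi>)"
      by (intro ennreal_leI indicator_annulus_le_cut)
    finally show "indicator (annulus k) \<xi> * f \<xi> \<le>
        (ennreal (cut (k - 1) \<xi>) * f \<xi> + ennreal (cut k \<xi>) * f \<xi>) + ennreal (cut (k + 1) \<xi>) * f \<xi>"
      by (simp add: ennreal_plus flip: distrib_right del: ennreal_plus) (simp add: mult_right_mono)
  qed auto
  also have "\<dots> \<le> block (k - 1) f + block k f + block (k + 1) f"
    unfolding block_def
    by (intro order_trans[OF Lp_norm_triangle[OF p sigma_finite_lborel]] add_right_mono Lp_norm_triangle[OF p sigma_finite_lborel]) auto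
  finally show ?thesis .
qed

text \<open>Counterpart of \<open>indicator_annulus_le_cut\<close>: the radii from 3/4 to 8/3 lie in
  [1/2, 4), which three consecutive annuli cover.\<close>

lemma cut_le_indicator_annulus:
  assumes B: "\<And>\<xi>. norm (\<phi> \<xi>) \<le> B" "0 \<le> B"
  shows "cut j \<xi> \<le> B * (indicator (annulus (j - 1)) \<xi> + indicator (annulus j) \<xi> + indicator (annulus (j + 1)) \<xi>)"
proof (cases "cut j \<xi> = 0")
  case False
  note b = cut_support[OF this]
  have "2 powr (of_int j - 1) \<le> 3/4 * 2 powr j" "8/3 * 2 powr j < 2 powr (of_int j + 2)"
    by (simp_all add: powr_add powr_diff)
  then have "\<xi> \<in> annulus (j - 1) \<or> \<xi> \<in> annulus j \<or> \<xi> \<in> annulus (j + 1)"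
    using b by (auto simp: annulus_def algebra_simps)
  moreover have "cut j \<xi> \<le> B"
    using B by (simp add: cut_def)
  ultimately show ?thesis
    using B(2) by (auto simp: indicator_def algebra_simps)
qed (use B in simp)

lemma block_le_Lp_norm_annulus:
  assumes B: "\<And>\<xi>. norm (\<phi> \<xi>) \<le> B" "0 \<le> B" and [measurable]: "f \<in> borel_measurable borel"
  shows "block j f \<le> ennreal B * (Lp_norm lborel p (\<lambda>\<xi>. indicator (annulus (j - 1)) \<xi> * f \<xi>)
    + Lp_norm lborel p (\<lambda>\<xi>. indicator (annulus j) \<xi> * f \<xi>) + Lp_norm lborel p (\<lambda>\<xi>. indicator (annulus (j + 1)) \<xi> * f \<xi>))"
proof -
  have "block j f \<le> Lp_norm lborel p (\<lambda>\<xi>. ennreal B * ((indicator (annulus (j - 1)) \<xi> * f \<xi> + indicator (annulus j) \<xi> * f \<xi>) + indicator (annulus (j + 1)) \<xi> * f \<xi>))"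
    unfolding block_def
  proof (rule Lp_norm_mono[OF p])
    fix \<xi>
    have "ennreal (cut j \<xi>) \<le> ennreal (B * (indicator (annulus (j - 1)) \<xi> + indicator (annulus j) \<xi> + indicator (annulus (j + 1)) \<xi>))"
      by (intro ennreal_leI cut_le_indicator_annulus B)
    also have "\<dots> = ennreal B * (indicator (annulus (j - 1)) \<xi> + indicator (annulus j) \<xi> + indicator (annulus (j + 1)) \<xi>)"
      using B by (simp add: ennreal_mult ennreal_indicator)
    finally have "ennreal (cut j \<xi>) * f \<xi> \<le> \<dots> * f \<xi>"
      by (rule mult_right_mono) simp
    then show "ennreal (cut j \<xi>) * f \<xi> \<le> ennreal B * ((indicator (annulus (j - 1)) \<xi> * f \<xi> + indicator (annulus j) \<xi> * f \<xi>) + indicator (annulus (j + 1)) \<xi> * f \<xi>)"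
      by (simp add: distrib_right mult.assoc)
  qed auto
  also have "\<dots> \<le> ennreal B * Lp_norm lborel p (\<lambda>\<xi>. (indicator (annulus (j - 1)) \<xi> * f \<xi> + indicator (annulus j) \<xi> * f \<xi>) + indicator (annulus (j + 1)) \<xi> * f \<xi>)"
    by (rule Lp_norm_cmult_le[OF p]) auto
  also have "\<dots> \<le> ennreal B * (Lp_norm lborel p (\<lambda>\<xi>. indicator (annulus (j - 1)) \<xi> * f \<xi>)
    + Lp_norm lborel p (\<lambda>\<xi>. indicator (annulus j) \<xi> * f \<xi>) + Lp_norm lborel p (\<lambda>\<xi>. indicator (annulus (j + 1)) \<xi> * f \<xi>))"
    by (intro mult_left_mono order_trans[OF Lp_norm_triangle[OF p sigma_finite_lborel]] add_right_mono Lp_norm_triangle[OF p sigma_finite_lborel]) auto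
  finally show ?thesis .
qed

end

text \<open>Here r = s - 2\<alpha>: the forcing space is weaker by the 2\<alpha> derivatives that
  the time integral of the heat factor restores.\<close>

locale fractional_scaling = fourier_besov +
  fixes \<alpha> s r :: real
  assumes \<alpha>_gt: "1/2 < \<alpha>" and \<alpha>_lt: "\<alpha> < 1/4 * (5 - enn2real (3 / p))"
    and s_eq: "s = 4 - 2 * \<alpha> - enn2real (3 / p)" and r_eq: "r = 4 - 4 * \<alpha> - enn2real (3 / p)"
begin

definition low_const :: real where
  "low_const = max 1 (8 * unit_ball_vol 3) / (1 - 2 powr (- (2 * \<alpha> - 1)))"

lemma low_const_nonneg: "0 \<le> low_const"
  using \<alpha>_gt by (auto simp: low_const_def powr_less_one intro!: divide_nonneg_pos)

text \<open>Bernstein on the annulus of index l gives the power 2^(l (2\<alpha> - 1)), since 3 - 3/p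
  - s = 2\<alpha> - 1. The sum over all l \<le> k is geometric because \<alpha> > 1/2, which is the
  second factor of \<open>low_const\<close>.\<close>

lemma low_frequency_L1:
  fixes k :: int
  assumes [measurable]: "g \<in> borel_measurable borel"
    and le: "\<And>k. Lp_norm lborel p (\<lambda>\<xi>. indicator (annulus k) \<xi> * g \<xi>) \<le> b * pow2 (- (k * s))"
  shows "(\<integral>\<^sup>+\<eta>. indicator {\<eta>. norm \<eta> < 2 powr (of_int k + 1)} \<eta> * g \<eta> \<partial>lborel) \<le>
    ennreal low_const * b * pow2 (k * (2 * \<alpha> - 1))"
proof -
  let ?c = "max 1 (8 * unit_ball_vol 3) :: real"
  have "(\<integral>\<^sup>+\<eta>. indicator {\<eta>. norm \<eta> < 2 powr (of_int k + 1)} \<eta> * g \<eta> \<partial>lborel) \<le>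
    (\<integral>\<^sup>+\<eta>. (\<Sum>n. indicator (annulus (k - int n)) \<eta> * g \<eta>) \<partial>lborel)"
  proof (rule nn_integral_mono_AE)
    show "AE \<eta> in lborel. indicator {\<eta>. norm \<eta> < 2 powr (of_int k + 1)} \<eta> * g \<eta> \<le> (\<Sum>n. indicator (annulus (k - int n)) \<eta> * g \<eta>)"
      using AE_lborel_singleton[of "0::real^3"]
    proof eventually_elim
      case (elim \<eta>)
      show ?case
      proof (cases "norm \<eta> < 2 powr (of_int k + 1)")
        case True
        obtain l where l: "\<eta> \<in> annulus l"
          using ex_annulus[OF elim] by blast
        have "2 powr l < 2 powr (real_of_int k + 1)"
          by (rule le_less_trans[of "2 powr l" "norm \<eta>"]) (use l True in \<open>auto simp: annulus_def\<close>)
        then have "l \<le> k"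
          by simp
        then have "l = k - int (nat (k - l))"
          by simp
        then have "indicator (annulus (k - int (nat (k - l)))) \<eta> = (1::ennreal)"
          using l by simp
        then have "g \<eta> \<le> (\<Sum>n\<in>{nat (k - l)}. indicator (annulus (k - int n)) \<eta> * g \<eta>)"
          by simp
        also have "\<dots> \<le> (\<Sum>n. indicator (annulus (k - int n)) \<eta> * g \<eta>)"
          by (intro sum_le_suminf) auto
        finally show ?thesis
          using True by simp
      qed simp
    qed
  qed
  also have "\<dots> = (\<Sum>n. \<integral>\<^sup>+\<eta>. indicator (annulus (k - int n)) \<eta> * g \<eta> \<partial>lborel)"
    by (rule nn_integral_suminf) simp
  also have "\<dots> \<le> (\<Sum>n. (ennreal ?c * b * pow2 (k * (2 * \<alpha> - 1))) * pow2 (- (real n * (2 * \<alpha> - 1))))"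
  proof (intro suminf_le allI)
    fix n
    let ?l = "k - int n"
    have "(\<integral>\<^sup>+\<eta>. indicator (annulus ?l) \<eta> * g \<eta> \<partial>lborel) \<le>
        ennreal ?c * pow2 (?l * (3 - enn2real (3 / p))) * (b * pow2 (- (?l * s)))"
      by (rule order_trans[OF Bernstein_annulus[OF p] mult_left_mono[OF le]]) auto
    also have "\<dots> = ennreal ?c * b * pow2 (?l * (3 - enn2real (3 / p)) + - (?l * s))"
      by (simp only: pow2_mult[symmetric] mult_ac)
    also have "?l * (3 - enn2real (3 / p)) + - (?l * s) = k * (2 * \<alpha> - 1) + - (real n * (2 * \<alpha> - 1))"
      by (simp add: s_eq algebra_simps)
    finally show "(\<integral>\<^sup>+\<eta>. indicator (annulus ?l) \<eta> * g \<eta> \<partial>lborel) \<le>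
        (ennreal ?c * b * pow2 (k * (2 * \<alpha> - 1))) * pow2 (- (real n * (2 * \<alpha> - 1)))"
      by (simp only: pow2_mult[symmetric] mult.assoc)
  qed auto
  also have "\<dots> = (ennreal ?c * b * pow2 (k * (2 * \<alpha> - 1))) * ennreal (1 / (1 - 2 powr (- (2 * \<alpha> - 1))))"
    using \<alpha>_gt by (subst ennreal_suminf_cmult) (simp add: suminf_pow2)
  also have "\<dots> = (ennreal ?c * ennreal (1 / (1 - 2 powr (- (2 * \<alpha> - 1))))) * b * pow2 (k * (2 * \<alpha> - 1))"
    by (simp add: mult_ac)
  also have "ennreal ?c * ennreal (1 / (1 - 2 powr (- (2 * \<alpha> - 1)))) = ennreal low_const"
    by (simp add: low_const_def flip: ennreal_mult')
  finally show ?thesis .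
qed

text \<open>Regularity exponent of a product before the derivative is applied. Its positivity is the
  upper bound on \<alpha> and makes the sum over high-frequency indices converge.\<close>

definition order :: real where
  "order = r + 1"

lemma order_pos: "0 < order"
  using \<alpha>_lt unfolding order_def by (simp add: r_eq)

text \<open>If \<open>\<xi>\<close> lies in the \<open>j\<close>-th annulus, the larger of \<open>\<xi> - \<eta>\<close> and \<open>\<eta>\<close> lies in an
  annulus of index \<open>k \<ge> j - 1\<close> and the other one below it.\<close>

definition paraproduct :: "(real^3 \<Rightarrow> ennreal) \<Rightarrow> (real^3 \<Rightarrow> ennreal) \<Rightarrow> int \<Rightarrow> real^3 \<Rightarrow> ennreal" where
  "paraproduct f g k = nnconv (\<lambda>\<xi>. indicator (annulus k) \<xi> * f \<xi>) (\<lambda>\<eta>. indicator {\<eta>. norm \<eta> < 2 powr (of_int k + 1)} \<eta> * g \<eta>)"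

lemma paraproduct_measurable [measurable]:
  assumes [measurable]: "f \<in> borel_measurable borel" "g \<in> borel_measurable borel"
  shows "paraproduct f g k \<in> borel_measurable borel"
  unfolding paraproduct_def by measurable

lemma nnconv_le_paraproducts:
  assumes [measurable]: "f \<in> borel_measurable borel" "g \<in> borel_measurable borel"
  shows "indicator (annulus j) \<xi> * nnconv f g \<xi> \<le>
    (\<Sum>n. paraproduct f g (j - 1 + int n) \<xi> + paraproduct g f (j - 1 + int n) \<xi>)"
proof (cases "\<xi> \<in> annulus j")
  case True
  let ?hi = "\<lambda>n \<eta>. indicator (annulus (j - 1 + int n)) \<eta> :: ennreal"
  let ?lo = "\<lambda>n \<eta>::real^3. indicator {\<eta>. norm \<eta> < 2 powr (of_int (j - 1 + int n) + 1)} \<eta> :: ennreal"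
  let ?t = "\<lambda>n \<eta>. (?hi n (\<xi> - \<eta>) * f (\<xi> - \<eta>)) * (?lo n \<eta> * g \<eta>) + (?lo n (\<xi> - \<eta>) * f (\<xi> - \<eta>)) * (?hi n \<eta> * g \<eta>)"
  have "f (\<xi> - \<eta>) * g \<eta> \<le> (\<Sum>n. ?t n \<eta>)" for \<eta>
  proof -
    \<comment> \<open>Two vectors shorter than half the inner radius of the annulus cannot add up to
      \<xi>.\<close>
    have large: "2 powr (real_of_int j - 1) \<le> max (norm (\<xi> - \<eta>)) (norm \<eta>)"
    proof -
      have "2 powr j \<le> norm (\<xi> - \<eta>) + norm \<eta>"
        using True norm_triangle_ineq[of "\<xi> - \<eta>" \<eta>] by (simp add: annulus_def)
      then show ?thesis
        by (simp add: powr_diff)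
    qed
    obtain \<zeta> where \<zeta>: "norm \<zeta> = max (norm (\<xi> - \<eta>)) (norm \<eta>)" "\<zeta> = \<xi> - \<eta> \<and> norm \<eta> \<le> norm \<zeta> \<or> \<zeta> = \<eta> \<and> norm (\<xi> - \<eta>) \<le> norm \<zeta>"
      by (metis max.cobounded1 max.cobounded2 max_def)
    have "\<zeta> \<noteq> 0"
      using large \<zeta>(1) powr_gt_zero[of 2 "real_of_int j - 1"] by auto
    then obtain k where k: "\<zeta> \<in> annulus k"
      by (rule ex_annulus)
    have "norm \<zeta> < 2 powr (real_of_int k + 1)"
      using k by (simp add: annulus_def)
    with large have "2 powr (real_of_int j - 1) < 2 powr (real_of_int k + 1)"
      unfolding \<zeta>(1)[symmetric] by (rule le_less_trans)
    then have "real_of_int j - 1 < real_of_int k + 1"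
      by simp
    then have "j - 1 \<le> k"
      by linarith
    then obtain n where n: "k = j - 1 + int n"
      by (metis zle_iff_zadd)
    have "f (\<xi> - \<eta>) * g \<eta> \<le> ?t n \<eta>"
      using \<zeta>(2)
    proof
      assume "\<zeta> = \<xi> - \<eta> \<and> norm \<eta> \<le> norm \<zeta>"
      then have "?hi n (\<xi> - \<eta>) = 1" "?lo n \<eta> = 1"
        using k unfolding n by (auto simp: annulus_def)
      then show ?thesis
        by simp
    next
      assume "\<zeta> = \<eta> \<and> norm (\<xi> - \<eta>) \<le> norm \<zeta>"
      then have "?hi n \<eta> = 1" "?lo n (\<xi> - \<eta>) = 1"
        using k unfolding n by (auto simp: annulus_def)
      then show ?thesis
        by simp
    qed
    also have "\<dots> \<le> (\<Sum>n. ?t n \<eta>)"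
      using sum_le_suminf[of "\<lambda>n. ?t n \<eta>" "{n}"] by simp
    finally show ?thesis .
  qed
  then have "nnconv f g \<xi> \<le> (\<integral>\<^sup>+\<eta>. (\<Sum>n. ?t n \<eta>) \<partial>lborel)"
    unfolding nnconv_def by (intro nn_integral_mono)
  also have "\<dots> = (\<Sum>n. \<integral>\<^sup>+\<eta>. ?t n \<eta> \<partial>lborel)"
    by (rule nn_integral_suminf) measurable
  also have "\<dots> = (\<Sum>n. paraproduct f g (j - 1 + int n) \<xi> + paraproduct g f (j - 1 + int n) \<xi>)"
  proof (intro suminf_cong)
    fix n
    have "paraproduct g f (j - 1 + int n) \<xi> =
        nnconv (\<lambda>\<eta>. ?lo n \<eta> * f \<eta>) (\<lambda>\<xi>. ?hi n \<xi> * g \<xi>) \<xi>"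
      unfolding paraproduct_def by (rule nnconv_commute) measurable
    then show "(\<integral>\<^sup>+\<eta>. ?t n \<eta> \<partial>lborel) = paraproduct f g (j - 1 + int n) \<xi> + paraproduct g f (j - 1 + int n) \<xi>"
      by (simp add: paraproduct_def nnconv_def nn_integral_add)
  qed
  finally show ?thesis
    using True by simp
qed simp

text \<open>Young's inequality with the high-frequency factor in the p-norm and the low-frequency
  factor in the 1-norm. The exponents combine because s - (2\<alpha> - 1) = r + 1.\<close>

lemma Lp_norm_paraproduct:
  assumes [measurable]: "f \<in> borel_measurable borel" "g \<in> borel_measurable borel"
    and f: "\<And>k. Lp_norm lborel p (\<lambda>\<xi>. indicator (annulus k) \<xi> * f \<xi>) \<le> a * pow2 (- (k * s))"
    and g: "\<And>k. Lp_norm lborel p (\<lambda>\<xi>. indicator (annulus k) \<xi> * g \<xi>) \<le> b * pow2 (- (k * s))"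
    and b: "b < top"
  shows "Lp_norm lborel p (paraproduct f g k) \<le> ennreal low_const * a * b * pow2 (- (k * order))"
proof -
  have L1: "(\<integral>\<^sup>+\<eta>. indicator {\<eta>. norm \<eta> < 2 powr (of_int k + 1)} \<eta> * g \<eta> \<partial>lborel) \<le>
    ennreal low_const * b * pow2 (k * (2 * \<alpha> - 1))" (is "?G \<le> ?R")
    by (rule low_frequency_L1[OF _ g]) measurable
  have "?R < top"
    using b by (simp add: ennreal_mult_less_top)
  with L1 have "?G < top"
    by (rule le_less_trans)
  then have "Lp_norm lborel p (paraproduct f g k) \<le> ?G * Lp_norm lborel p (\<lambda>\<xi>. indicator (annulus k) \<xi> * f \<xi>)"
    unfolding paraproduct_def by (intro Young_L1_Lp[OF p]) auto
  also have "\<dots> \<le> ?R * (a * pow2 (- (k * s)))"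
    by (intro mult_mono L1 f) auto
  also have "\<dots> = ennreal low_const * a * b * pow2 (k * (2 * \<alpha> - 1) + - (k * s))"
    by (simp only: pow2_mult[symmetric] mult_ac)
  also have "k * (2 * \<alpha> - 1) + - (k * s) = - (k * order)"
    unfolding order_def by (simp add: s_eq r_eq algebra_simps)
  finally show ?thesis .
qed

text \<open>The paraproducts of index j - 1 + n decay like 2^(- n order). In the constant,
  \<open>2 powr order\<close> pays for starting one index below \<open>j\<close>, and the 2 for the
  two roles of the factors.\<close>

lemma Lp_norm_nnconv_annulus:
  assumes [measurable]: "f \<in> borel_measurable borel" "g \<in> borel_measurable borel"
    and f: "\<And>k. Lp_norm lborel p (\<lambda>\<xi>. indicator (annulus k) \<xi> * f \<xi>) \<le> a * pow2 (- (k * s))"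
    and g: "\<And>k. Lp_norm lborel p (\<lambda>\<xi>. indicator (annulus k) \<xi> * g \<xi>) \<le> b * pow2 (- (k * s))"
    and a: "a < top" and b: "b < top"
  shows "Lp_norm lborel p (\<lambda>\<xi>. indicator (annulus j) \<xi> * nnconv f g \<xi>) \<le>
    ennreal (1 / (1 - 2 powr (- order)) * (2 * low_const * 2 powr order)) * a * b * pow2 (- (j * order))"
proof -
  let ?t = "\<lambda>n \<xi>. paraproduct f g (j - 1 + int n) \<xi> + paraproduct g f (j - 1 + int n) \<xi>"
  let ?c = "ennreal (2 * low_const * 2 powr order) * a * b * pow2 (- (j * order))"
  have "Lp_norm lborel p (\<lambda>\<xi>. indicator (annulus j) \<xi> * nnconv f g \<xi>) \<le> Lp_norm lborel p (\<lambda>\<xi>. \<Sum>n. ?t n \<xi>)"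
    by (rule Lp_norm_mono[OF p]) (auto intro: nnconv_le_paraproducts)
  \<comment> \<open>A factor 1 is inserted to exhibit the series as a weighted sum whose rescaled
    terms share one bound.\<close>
  also have "\<dots> = Lp_norm lborel p (\<lambda>\<xi>. \<integral>\<^sup>+n. pow2 (- (real n * order)) * (pow2 (real n * order) * ?t n \<xi>) \<partial>count_space UNIV)"
    by (simp add: pow2_mult_left nn_integral_count_space_nat)
  also have "\<dots> \<le> (\<integral>\<^sup>+n. pow2 (- (real n * order)) \<partial>count_space UNIV) * ?c"
  proof (rule Lp_norm_weighted_sum[OF p sigma_finite_lborel])
    show "(\<integral>\<^sup>+n. pow2 (- (real n * order)) \<partial>count_space UNIV) < top"
      using order_pos by (simp add: nn_integral_count_space_nat suminf_pow2)
    fix n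
    let ?k = "j - 1 + int n"
    have "Lp_norm lborel p (\<lambda>\<xi>. pow2 (real n * order) * ?t n \<xi>) \<le> pow2 (real n * order) * Lp_norm lborel p (?t n)"
      by (rule Lp_norm_cmult_le[OF p]) measurable
    also have "Lp_norm lborel p (?t n) \<le> Lp_norm lborel p (paraproduct f g ?k) + Lp_norm lborel p (paraproduct g f ?k)"
      by (rule Lp_norm_triangle[OF p sigma_finite_lborel]) measurable
    also have "\<dots> \<le> ennreal low_const * a * b * pow2 (- (?k * order)) + ennreal low_const * b * a * pow2 (- (?k * order))"
      by (intro add_mono Lp_norm_paraproduct f g a b) measurable
    also have "\<dots> = ennreal (2 * low_const) * a * b * pow2 (- (?k * order))"
    proof -
      have two: "ennreal (2 * low_const) = ennreal low_const + ennreal low_const"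
        using low_const_nonneg by (simp flip: ennreal_plus)
      show ?thesis
        unfolding two distrib_right by (simp only: mult_ac)
    qed
    also have "- (?k * order) = - (real n * order) + (order + - (j * order))"
      by (simp add: algebra_simps)
    also have "pow2 (real n * order) * (ennreal (2 * low_const) * a * b * pow2 (- (real n * order) + (order + - (j * order)))) = ?c"
    proof -
      have "pow2 (real n * order) * (ennreal (2 * low_const) * a * b * pow2 (- (real n * order) + (order + - (j * order)))) =
          ennreal (2 * low_const) * a * b * (pow2 (real n * order) * pow2 (- (real n * order) + (order + - (j * order))))"
        by (simp add: mult_ac)
      also have "\<dots> = ennreal (2 * low_const) * a * b * (pow2 order * pow2 (- (j * order)))"
        by (simp add: pow2_mult)
      also have "\<dots> = ?c"
        using low_const_nonneg by (simp add: pow2_def ennreal_mult mult_ac)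
      finally show ?thesis .
    qed
    finally show "Lp_norm lborel p (\<lambda>\<xi>. pow2 (real n * order) * ?t n \<xi>) \<le> ?c"
      by (simp add: mult_left_mono)
  qed measurable
  also have "(\<integral>\<^sup>+n. pow2 (- (real n * order)) \<partial>count_space UNIV) * ?c =
     ennreal (1 / (1 - 2 powr (- order)) * (2 * low_const * 2 powr order)) * a * b * pow2 (- (j * order))"
  proof -
    have "ennreal (1 / (1 - 2 powr (- order)) * (2 * low_const * 2 powr order)) =
        ennreal (1 / (1 - 2 powr (- order))) * ennreal (2 * low_const * 2 powr order)"
      using low_const_nonneg by (intro ennreal_mult'') simp
    then show ?thesis
      by (simp only: nn_integral_count_space_nat suminf_pow2[OF order_pos] mult_ac)
  qed
  finally show ?thesis .
qed

text \<open>The assumed estimate concerns complete Duhamel integrals and does not control the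
  integrand at a given time; this is the control at a given time. Suprema over the blocks suffice
  for the smoothing argument, so no summability in \<open>j\<close> is obtained.\<close>

lemma product_estimate:
  obtains C :: real where "0 \<le> C"
    "\<And>f g a b j. f \<in> borel_measurable borel \<Longrightarrow> g \<in> borel_measurable borel \<Longrightarrow>
       (\<And>j. pow2 (j * s) * block j f \<le> a) \<Longrightarrow> (\<And>j. pow2 (j * s) * block j g \<le> b) \<Longrightarrow> a < top \<Longrightarrow> b < top \<Longrightarrow>
       pow2 (j * r) * block j (\<lambda>\<xi>. ennreal (norm \<xi>) * nnconv f g \<xi>) \<le> ennreal C * a * b"
proof -
  obtain B where B: "1 \<le> B" "\<And>\<xi>. norm (\<phi> \<xi>) \<le> B"
    using LP_cutoff_bounded[OF cutoff] by blast
  define S where "S = 2 powr (- s) + 1 + 2 powr s"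
  define C1 where "C1 = 1 / (1 - 2 powr (- order)) * (2 * low_const * 2 powr order)"
  define C2 where "C2 = 2 powr (- order) + 1 + 2 powr order"
  \<comment> \<open>\<open>S\<close> and \<open>C2\<close> pay for the three neighbours in passing
    from blocks to annuli and back; 8/3 bounds the frequency on block \<open>j\<close> relative to
    2^j.\<close>
  define C where "C = 8/3 * (B * (C1 * S * S * C2))"
  have S_nonneg: "0 \<le> S"
    by (simp add: S_def)
  have C1_nonneg: "0 \<le> C1"
    using order_pos low_const_nonneg by (auto simp: C1_def powr_less_one less_imp_le)
  have C2_nonneg: "0 \<le> C2"
    by (simp add: C2_def)
  have ann: "Lp_norm lborel p (\<lambda>\<xi>. indicator (annulus k) \<xi> * f \<xi>) \<le> (ennreal S * a) * pow2 (- (k * s))"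
    if [measurable]: "f \<in> borel_measurable borel" and le: "\<And>j. pow2 (j * s) * block j f \<le> a" for f a k
  proof -
    have le': "block j f \<le> pow2 (- (j * s)) * a" for j
      using le[of j] by (simp add: pow2_le_swap)
    have "Lp_norm lborel p (\<lambda>\<xi>. indicator (annulus k) \<xi> * f \<xi>) \<le> block (k - 1) f + block k f + block (k + 1) f"
      by (rule Lp_norm_annulus_le_block) measurable
    also have "\<dots> \<le> pow2 (- ((k - 1) * s)) * a + pow2 (- (k * s)) * a + pow2 (- ((k + 1) * s)) * a"
      by (intro add_mono le')
    also have "\<dots> = (pow2 s * pow2 (- (k * s)) + pow2 (- (k * s)) + pow2 (- s) * pow2 (- (k * s))) * a"
      by (simp add: pow2_mult algebra_simps)
    also have "\<dots> = (ennreal S * a) * pow2 (- (k * s))"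
      by (simp add: S_def pow2_def algebra_simps)
    finally show ?thesis .
  qed
  have "pow2 (j * r) * block j (\<lambda>\<xi>. ennreal (norm \<xi>) * nnconv f g \<xi>) \<le> ennreal C * a * b"
    if [measurable]: "f \<in> borel_measurable borel" "g \<in> borel_measurable borel"
      and f: "\<And>j. pow2 (j * s) * block j f \<le> a" and g: "\<And>j. pow2 (j * s) * block j g \<le> b"
      and a: "a < top" and b: "b < top" for f g a b j
  proof -
    let ?N = "\<lambda>j. Lp_norm lborel p (\<lambda>\<xi>. indicator (annulus j) \<xi> * nnconv f g \<xi>)"
    let ?ab = "ennreal C1 * (ennreal S * a) * (ennreal S * b)"
    have N: "?N j \<le> ?ab * pow2 (- (j * order))" for j
      unfolding C1_def
      using a b by (intro Lp_norm_nnconv_annulus ann f g) (auto simp: ennreal_mult_less_top)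
    have "block j (nnconv f g) \<le> ennreal B * (?N (j - 1) + ?N j + ?N (j + 1))"
      using B by (intro block_le_Lp_norm_annulus) auto
    also have "\<dots> \<le> ennreal B * (?ab * pow2 (- ((j - 1) * order)) + ?ab * pow2 (- (j * order)) + ?ab * pow2 (- ((j + 1) * order)))"
      by (intro mult_left_mono add_mono N) simp
    also have "\<dots> = ennreal B * (?ab * (pow2 order * pow2 (- (j * order)) + pow2 (- (j * order)) + pow2 (- order) * pow2 (- (j * order))))"
      by (simp add: pow2_mult algebra_simps)
    also have "\<dots> = ennreal B * (?ab * ennreal C2) * pow2 (- (j * order))"
      by (simp add: C2_def pow2_def algebra_simps)
    finally have conv: "block j (nnconv f g) \<le> ennreal B * (?ab * ennreal C2) * pow2 (- (j * order))" .
    have "block j (\<lambda>\<xi>. ennreal (norm \<xi>) * nnconv f g \<xi>) \<le> Lp_norm lborel p (\<lambda>\<xi>. (ennreal (8/3) * pow2 j) * (ennreal (cut j \<xi>) * nnconv f g \<xi>))"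
      unfolding block_def
    proof (rule Lp_norm_mono[OF p])
      fix \<xi>
      have "ennreal (cut j \<xi>) * ennreal (norm \<xi>) \<le> ennreal (cut j \<xi>) * (ennreal (8/3) * pow2 j)"
      proof (cases "cut j \<xi> = 0")
        case False
        then have "ennreal (norm \<xi>) \<le> ennreal (8/3 * 2 powr j)"
          by (intro ennreal_leI cut_support(2))
        also have "\<dots> = ennreal (8/3) * pow2 j"
          unfolding pow2_def by (rule ennreal_mult) auto
        finally show ?thesis
          by (rule mult_left_mono) simp
      qed simp
      then have "(ennreal (cut j \<xi>) * ennreal (norm \<xi>)) * nnconv f g \<xi> \<le> (ennreal (cut j \<xi>) * (ennreal (8/3) * pow2 j)) * nnconv f g \<xi>"
        by (rule mult_right_mono) simp
      then show "ennreal (cut j \<xi>) * (ennreal (norm \<xi>) * nnconv f g \<xi>) \<le> (ennreal (8/3) * pow2 j) * (ennreal (cut j \<xi>) * nnconv f g \<xi>)"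
        by (simp add: mult_ac)
    qed measurable
    also have "\<dots> \<le> (ennreal (8/3) * pow2 j) * block j (nnconv f g)"
      unfolding block_def by (rule Lp_norm_cmult_le[OF p]) measurable
    also have "\<dots> \<le> (ennreal (8/3) * pow2 j) * (ennreal B * (?ab * ennreal C2) * pow2 (- (j * order)))"
      by (intro mult_left_mono conv) simp
    finally have "pow2 (j * r) * block j (\<lambda>\<xi>. ennreal (norm \<xi>) * nnconv f g \<xi>) \<le>
        pow2 (j * r) * ((ennreal (8/3) * pow2 j) * (ennreal B * (?ab * ennreal C2) * pow2 (- (j * order))))"
      by (rule mult_left_mono) simp
    also have "\<dots> = (pow2 (j * r) * (pow2 j * pow2 (- (j * order)))) * (ennreal (8/3) * (ennreal B * (?ab * ennreal C2)))"
      by (simp only: mult_ac)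
    also have "pow2 (j * r) * (pow2 j * pow2 (- (j * order))) = 1"
      by (simp add: pow2_mult order_def algebra_simps)
    also have "1 * (ennreal (8/3) * (ennreal B * (?ab * ennreal C2))) = ennreal C * a * b"
    proof -
      have "ennreal C = ennreal (8/3) * (ennreal B * (ennreal C1 * ennreal S * ennreal S * ennreal C2))"
      proof -
        have n: "0 \<le> C1 * S" "0 \<le> C1 * S * S" "0 \<le> C1 * S * S * C2" "0 \<le> B" "0 \<le> B * (C1 * S * S * C2)" "0 \<le> (8/3 :: real)"
          using B C1_nonneg C2_nonneg S_nonneg by auto
        show ?thesis
          unfolding C_def ennreal_mult[OF n(6,5)] ennreal_mult[OF n(4,3)] ennreal_mult[OF n(2) C2_nonneg]
            ennreal_mult[OF n(1) S_nonneg] ennreal_mult[OF C1_nonneg S_nonneg] ..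
      qed
      then show ?thesis
        by (simp add: mult_ac)
    qed
    finally show ?thesis .
  qed
  moreover have "0 \<le> C"
    using B C1_nonneg C2_nonneg S_nonneg by (auto simp: C_def intro!: mult_nonneg_nonneg)
  ultimately show thesis
    using that by blast
qed

end

section \<open>The Duhamel operator\<close>

lemma norm_vec_le_sum: "norm (z :: complex^'n) \<le> (\<Sum>i\<in>UNIV. norm (z $ i))"
  unfolding norm_vec_def by (rule L2_set_le_sum) simp

lemma norm_mat_apply_le:
  assumes "\<And>m k. \<bar>M $ m $ k\<bar> \<le> b"
  shows "norm (mat_apply M z) \<le> 9 * b * norm z"
proof -
  have b: "0 \<le> b"
    using assms[of undefined undefined] by linarith
  have "norm (mat_apply M z $ m) \<le> 3 * b * norm z" for m
  proof -
    have "norm (mat_apply M z $ m) \<le> (\<Sum>k\<in>UNIV. norm ((M $ m $ k) *\<^sub>R (z $ k)))"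
      unfolding mat_apply_def by (simp only: vec_lambda_beta norm_sum)
    also have "\<dots> \<le> (\<Sum>k\<in>(UNIV::3 set). b * norm z)"
      unfolding norm_scaleR using assms b by (intro sum_mono mult_mono) (auto simp: Finite_Cartesian_Product.norm_nth_le)
    finally show ?thesis
      by simp
  qed
  then have "(\<Sum>m\<in>UNIV. norm (mat_apply M z $ m)) \<le> (\<Sum>m\<in>(UNIV::3 set). 3 * b * norm z)"
    by (intro sum_mono)
  with norm_vec_le_sum[of "mat_apply M z"] show ?thesis
    by simp
qed

lemma mat_apply_diff: "mat_apply M (x - y) = mat_apply M x - mat_apply M y"
  by (simp add: mat_apply_def vec_eq_iff scaleR_diff_right sum_subtractf)

lemma mat_apply_add: "mat_apply M (x + y) = mat_apply M x + mat_apply M y"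
  by (simp add: mat_apply_def vec_eq_iff scaleR_add_right sum.distrib)

lemma mat_apply_zero [simp]: "mat_apply M 0 = 0"
  by (simp add: mat_apply_def vec_eq_iff)

lemma coriolis_matrix_entry:
  "coriolis_matrix \<xi> $ m $ k = 0 \<or> (\<exists>i. coriolis_matrix \<xi> $ m $ k = (1 / norm \<xi>) * \<xi> $ i \<or> coriolis_matrix \<xi> $ m $ k = (1 / norm \<xi>) * (- \<xi> $ i))"
  using exhaust_3[of m] exhaust_3[of k] by (auto simp: coriolis_matrix_def)

lemma abs_component_div_norm_le: "\<bar>\<xi> $ i\<bar> / norm (\<xi> :: real^'n) \<le> 1"
  using component_le_norm_cart[of \<xi> i] by (cases "\<xi> = 0") (auto simp: divide_le_eq)

lemma abs_coriolis_matrix_le: "\<bar>coriolis_matrix \<xi> $ m $ k\<bar> \<le> 1"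
  using coriolis_matrix_entry[of \<xi> m k] abs_component_div_norm_le[of \<xi>] by (auto simp: abs_mult)

lemma abs_semigroup_symbol_le:
  "\<bar>semigroup_symbol \<nu> \<alpha> \<Omega> t \<xi> $ m $ k\<bar> \<le> 2 * exp (- \<nu> * norm \<xi> powr (2 * \<alpha>) * t)"
proof -
  let ?x = "\<Omega> * (\<xi>$3 / norm \<xi>) * t"
  have "\<bar>cos ?x * (mat 1 :: real^3^3) $ m $ k + sin ?x * coriolis_matrix \<xi> $ m $ k\<bar> \<le>
      \<bar>cos ?x\<bar> * \<bar>(mat 1 :: real^3^3) $ m $ k\<bar> + \<bar>sin ?x\<bar> * \<bar>coriolis_matrix \<xi> $ m $ k\<bar>"
    unfolding abs_mult[symmetric] by (rule abs_triangle_ineq)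
  also have "\<dots> \<le> 1 * 1 + 1 * 1"
    by (intro add_mono mult_mono abs_coriolis_matrix_le abs_cos_le_one abs_sin_le_one) (auto simp: mat_def)
  finally have "exp (- \<nu> * norm \<xi> powr (2 * \<alpha>) * t) * \<bar>cos ?x * (mat 1 :: real^3^3) $ m $ k + sin ?x * coriolis_matrix \<xi> $ m $ k\<bar>
      \<le> exp (- \<nu> * norm \<xi> powr (2 * \<alpha>) * t) * 2"
    by (intro mult_left_mono) auto
  then show ?thesis
    by (simp add: semigroup_symbol_def abs_mult)
qed

lemma abs_leray_symbol_le: "\<bar>leray_symbol \<xi> $ m $ k\<bar> \<le> 2"
proof -
  have "\<bar>\<xi>$m * \<xi>$k / (norm \<xi>)\<^sup>2\<bar> = (\<bar>\<xi>$m\<bar> / norm \<xi>) * (\<bar>\<xi>$k\<bar> / norm \<xi>)"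
    by (simp add: abs_mult power2_eq_square)
  also have "\<dots> \<le> 1 * 1"
    by (intro mult_mono abs_component_div_norm_le) auto
  finally have "\<bar>\<xi>$m * \<xi>$k / (norm \<xi>)\<^sup>2\<bar> \<le> 1"
    by simp
  then show ?thesis
    unfolding leray_symbol_def vec_lambda_beta
    by (intro order_trans[OF abs_triangle_ineq4], cases "m = k") simp_all
qed

lemma borel_measurable_real_vec_nth [measurable (raw)]:
  fixes f :: "'a \<Rightarrow> real^'n"
  shows "f \<in> borel_measurable M \<Longrightarrow> (\<lambda>x. f x $ i) \<in> borel_measurable M"
  by (rule borel_measurable_continuous_on[OF continuous_on_component]) auto

lemma coriolis_matrix_measurable [measurable (raw)]:
  assumes [measurable]: "X \<in> borel_measurable M"
  shows "(\<lambda>x. coriolis_matrix (X x) $ m $ k) \<in> borel_measurable M"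
proof -
  have "\<And>x. coriolis_matrix (X x) $ m $ k = (1 / norm (X x)) *
     (if m = 1 \<and> k = 2 then X x $ 3 else if m = 1 \<and> k = 3 then - X x $ 2 else
      if m = 2 \<and> k = 1 then - X x $ 3 else if m = 2 \<and> k = 3 then X x $ 1 else
      if m = 3 \<and> k = 1 then X x $ 2 else if m = 3 \<and> k = 2 then - X x $ 1 else 0)"
    using exhaust_3[of m] exhaust_3[of k] by (auto simp: coriolis_matrix_def)
  then show ?thesis
    by simp
qed

lemma mat_apply_measurable:
  assumes [measurable]: "\<And>m k. (\<lambda>x. A x $ m $ k) \<in> borel_measurable M" "Z \<in> borel_measurable M"
  shows "(\<lambda>x. mat_apply (A x) (Z x)) \<in> borel_measurable M"
  by (rule borel_measurable_vec_componentwise) (simp add: mat_apply_def)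

lemma semigroup_symbol_measurable:
  assumes [measurable]: "T \<in> borel_measurable M" "X \<in> borel_measurable M"
  shows "(\<lambda>x. semigroup_symbol \<nu> \<alpha> \<Omega> (T x) (X x) $ m $ k) \<in> borel_measurable M"
  unfolding semigroup_symbol_def vector_scaleR_component vector_add_component by measurable

lemma leray_symbol_measurable:
  assumes [measurable]: "X \<in> borel_measurable M"
  shows "(\<lambda>x. leray_symbol (X x) $ m $ k) \<in> borel_measurable M"
  unfolding leray_symbol_def by simp

text \<open>Without integrability the Bochner integral is 0, so Duhamel integrals can be bounded
  before their convergence is known.\<close>

lemma ennreal_norm_integral_le:
  fixes f :: "'a \<Rightarrow> 'b::{banach, second_countable_topology}"
  shows "ennreal (norm (\<integral>x. f x \<partial>M)) \<le> (\<integral>\<^sup>+x. ennreal (norm (f x)) \<partial>M)"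
  by (cases "integrable M f") (auto simp: integral_norm_bound_ennreal not_integrable_integral_eq)

text \<open>Both bounds carry the factor 1/x, which later cancels the scaling of a block. The second
  is for a window ending before \<open>t\<close> and gains decay in t - b from exp (- y) \<le>
  1/y.\<close>

lemma nn_integral_exp_le:
  fixes a b t x :: real
  assumes x: "0 < x" and b: "b \<le> t" and a: "a \<le> b"
  shows "(\<integral>\<^sup>+\<tau>. indicator {a..b} \<tau> * ennreal (exp (- (x * (t - \<tau>)))) \<partial>lborel) \<le> ennreal (1 / x)"
    and "b < t \<Longrightarrow> (\<integral>\<^sup>+\<tau>. indicator {a..b} \<tau> * ennreal (exp (- (x * (t - \<tau>)))) \<partial>lborel) \<le> ennreal ((b - a) / (x * (t - b)))"
proof -
  let ?I = "\<integral>\<^sup>+\<tau>. indicator {a..b} \<tau> * ennreal (exp (- (x * (t - \<tau>)))) \<partial>lborel"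
  have "?I = (\<integral>\<^sup>+\<tau>. ennreal (exp (- (x * (t - \<tau>)))) * indicator {a..b} \<tau> \<partial>lborel)"
    by (simp add: mult.commute)
  also have "\<dots> = ennreal (exp (- (x * (t - b))) / x - exp (- (x * (t - a))) / x)"
    using x a by (intro nn_integral_FTC_Icc) (auto intro!: derivative_eq_intros)
  also have "\<dots> \<le> ennreal (1 / x)"
  proof (rule ennreal_leI)
    have "exp (- (x * (t - b))) / x \<le> 1 / x"
      using x b by (intro divide_right_mono) auto
    moreover have "0 \<le> exp (- (x * (t - a))) / x"
      using x by simp
    ultimately show "exp (- (x * (t - b))) / x - exp (- (x * (t - a))) / x \<le> 1 / x"
      by linarith
  qed
  finally show "?I \<le> ennreal (1 / x)" .
  assume bt: "b < t"
  have "?I \<le> (\<integral>\<^sup>+\<tau>. ennreal (1 / (x * (t - b))) * indicator {a..b} \<tau> \<partial>lborel)"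
  proof (rule nn_integral_mono)
    fix \<tau>
    show "indicator {a..b} \<tau> * ennreal (exp (- (x * (t - \<tau>)))) \<le> ennreal (1 / (x * (t - b))) * indicator {a..b} \<tau>"
    proof (cases "\<tau> \<in> {a..b}")
      case True
      have "exp (- (x * (t - \<tau>))) \<le> exp (- (x * (t - b)))"
        using True x by simp
      also have "\<dots> \<le> 1 / (x * (t - b))"
      proof -
        have "0 < x * (t - b)" "x * (t - b) \<le> exp (x * (t - b))"
          using exp_ge_add_one_self[of "x * (t - b)"] x bt by (simp, linarith)
        then have "1 / exp (x * (t - b)) \<le> 1 / (x * (t - b))"
          by (intro frac_le) auto
        then show ?thesis
          by (simp add: exp_minus inverse_eq_divide)
      qed
      finally show ?thesis
        using True by (simp add: ennreal_leI)
    qed simp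
  qed
  also have "\<dots> = ennreal (1 / (x * (t - b))) * ennreal (b - a)"
    using a by (simp add: nn_integral_cmult_indicator)
  also have "\<dots> = ennreal ((b - a) / (x * (t - b)))"
    using a x bt by (simp flip: ennreal_mult')
  finally show "?I \<le> ennreal ((b - a) / (x * (t - b)))" .
qed

locale duhamel = fractional_scaling +
  fixes \<nu> \<Omega> :: real
  assumes \<nu>_pos: "0 < \<nu>"
begin

definition kern :: "real \<Rightarrow> real^3 \<Rightarrow> complex^3 \<Rightarrow> complex^3" where
  "kern t \<xi> z = mat_apply (semigroup_symbol \<nu> \<alpha> \<Omega> t \<xi>) (mat_apply (leray_symbol \<xi>) z)"

text \<open>The time set is separate from the evaluation time, so that the contribution of a past
  window can be followed to later times. Up to sign, the bilinear operator and the forcing term are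
  both instances.\<close>

definition duh :: "real set \<Rightarrow> (real \<Rightarrow> real^3 \<Rightarrow> complex^3) \<Rightarrow> real \<Rightarrow> real^3 \<Rightarrow> complex^3" where
  "duh A V t \<xi> = (LINT \<tau>:A|lborel. kern (t - \<tau>) \<xi> (V \<tau> \<xi>))"

lemma kern_add: "kern t \<xi> (x + y) = kern t \<xi> x + kern t \<xi> y"
  by (simp add: kern_def mat_apply_add)

lemma kern_0 [simp]: "kern t \<xi> 0 = 0"
  by (simp add: kern_def)

text \<open>The constant is 18 * 18: entries of either symbol are at most 2, apart from the heat
  factor, and each matrix product costs 9.\<close>

lemma norm_kern_le: "norm (kern t \<xi> z) \<le> 324 * exp (- \<nu> * norm \<xi> powr (2 * \<alpha>) * t) * norm z"
proof -
  have "norm (kern t \<xi> z) \<le> 9 * (2 * exp (- \<nu> * norm \<xi> powr (2 * \<alpha>) * t)) * norm (mat_apply (leray_symbol \<xi>) z)"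
    unfolding kern_def by (intro norm_mat_apply_le abs_semigroup_symbol_le)
  also have "\<dots> \<le> 9 * (2 * exp (- \<nu> * norm \<xi> powr (2 * \<alpha>) * t)) * (9 * 2 * norm z)"
    by (intro mult_left_mono norm_mat_apply_le abs_leray_symbol_le) auto
  finally show ?thesis
    by simp
qed

lemma norm_kern_le': "0 \<le> t \<Longrightarrow> norm (kern t \<xi> z) \<le> 324 * norm z"
  using norm_kern_le[of t \<xi> z] \<nu>_pos
  by (intro order_trans[OF norm_kern_le] mult_right_mono) auto

lemma kern_measurable [measurable (raw)]:
  assumes [measurable]: "T \<in> borel_measurable M" "X \<in> borel_measurable M" "Z \<in> borel_measurable M"
  shows "(\<lambda>x. kern (T x) (X x) (Z x)) \<in> borel_measurable M"
  unfolding kern_def by (intro mat_apply_measurable semigroup_symbol_measurable leray_symbol_measurable) auto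

lemma continuous_kern: "continuous_on UNIV (\<lambda>t. kern t \<xi> z)"
  unfolding kern_def mat_apply_def semigroup_symbol_def vector_scaleR_component vector_add_component
  by (intro continuous_on_vec_lambda continuous_intros)

text \<open>What the Duhamel integrands below have in common: bounds at regularity \<open>r\<close>,
  uniform in time and in the block index. This is enough for convergence and for decay of past
  windows, without l^q summability.\<close>

definition admissible :: "(real \<Rightarrow> real^3 \<Rightarrow> complex^3) \<Rightarrow> ennreal \<Rightarrow> bool" where
  "admissible V c \<longleftrightarrow> case_prod V \<in> borel_measurable (lborel \<Otimes>\<^sub>M lborel) \<and> c < top \<and>
     (AE \<tau> in lborel. 0 \<le> \<tau> \<longrightarrow> (\<forall>j. pow2 (j * r) * block_norm \<phi> p j (V \<tau>) \<le> c))"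

lemma joint_measurableD:
  assumes V: "case_prod V \<in> borel_measurable (lborel \<Otimes>\<^sub>M lborel)"
  shows "V \<tau> \<in> borel_measurable borel" "(\<lambda>\<tau>. V \<tau> \<xi>) \<in> borel_measurable borel"
  using measurable_Pair2[OF V, of \<tau>] measurable_Pair1[OF V, of \<xi>] by simp_all

lemma block_time_integral:
  assumes [measurable]: "k \<in> borel_measurable borel" "case_prod H \<in> borel_measurable (lborel \<Otimes>\<^sub>M lborel)"
    and k: "(\<integral>\<^sup>+\<tau>. k \<tau> \<partial>lborel) < top" and H: "AE \<tau> in lborel. k \<tau> \<noteq> 0 \<longrightarrow> block j (H \<tau>) \<le> c"
  shows "block j (\<lambda>\<xi>. \<integral>\<^sup>+\<tau>. k \<tau> * H \<tau> \<xi> \<partial>lborel) \<le> (\<integral>\<^sup>+\<tau>. k \<tau> \<partial>lborel) * c"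
proof -
  have [measurable]: "(\<lambda>\<tau>. H \<tau> \<xi>) \<in> borel_measurable borel" for \<xi>
    using measurable_Pair1[of "case_prod H" lborel lborel borel \<xi>] by simp
  have "block j (\<lambda>\<xi>. \<integral>\<^sup>+\<tau>. k \<tau> * H \<tau> \<xi> \<partial>lborel) =
      Lp_norm lborel p (\<lambda>\<xi>. \<integral>\<^sup>+\<tau>. k \<tau> * (ennreal (cut j \<xi>) * H \<tau> \<xi>) \<partial>lborel)"
    unfolding block_def by (simp add: mult.left_commute[of "k _"] nn_integral_cmult)
  also have "\<dots> \<le> (\<integral>\<^sup>+\<tau>. k \<tau> \<partial>lborel) * c"
    by (rule Minkowski_integral_kernel[OF p sigma_finite_lborel sigma_finite_lborel _ _ k])
      (use H in \<open>auto simp: block_def\<close>)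
  finally show ?thesis .
qed

definition time_integrable :: "(real \<Rightarrow> real^3 \<Rightarrow> complex^3) \<Rightarrow> real^3 \<Rightarrow> bool" where
  "time_integrable V \<xi> \<longleftrightarrow> (\<forall>T. (\<integral>\<^sup>+\<tau>. indicator {0..T} \<tau> * ennreal (norm (V \<tau> \<xi>)) \<partial>lborel) < top)"

text \<open>Minkowski bounds every block of the time integral over [0, n], which is therefore finite
  almost everywhere. Integer end times suffice by monotonicity, so one null set serves for all
  times.\<close>

lemma admissible_time_integrable:
  assumes V: "admissible V c"
  shows "AE \<xi> in lborel. time_integrable V \<xi>"
proof -
  have [measurable]: "case_prod V \<in> borel_measurable (lborel \<Otimes>\<^sub>M lborel)"
    using V by (simp add: admissible_def)
  let ?I = "\<lambda>T \<xi>. \<integral>\<^sup>+\<tau>. indicator {0..T} \<tau> * ennreal (norm (V \<tau> \<xi>)) \<partial>lborel"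
  have "AE \<xi> in lborel. ?I (real n) \<xi> < top" for n
  proof (rule AE_finite_of_block)
    fix j
    have "block j (?I (real n)) \<le> (\<integral>\<^sup>+\<tau>. indicator {0..real n} \<tau> \<partial>lborel) * (pow2 (- (j * r)) * c)"
    proof (rule block_time_integral)
      show "AE \<tau> in lborel. indicator {0..real n} \<tau> \<noteq> (0 :: ennreal) \<longrightarrow> block j (\<lambda>\<xi>. ennreal (norm (V \<tau> \<xi>))) \<le> pow2 (- (j * r)) * c"
        using V unfolding admissible_def
        by (auto elim!: eventually_mono simp: block_norm_eq pow2_le_swap indicator_def)
    qed auto
    also have "\<dots> < top"
      using V by (simp add: admissible_def ennreal_mult_less_top)
    finally show "block j (?I (real n)) < top" .
  qed measurable
  then have "AE \<xi> in lborel. \<forall>n. ?I (real n) \<xi> < top"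
    unfolding AE_all_countable by blast
  then show ?thesis
  proof eventually_elim
    case (elim \<xi>)
    show ?case
      unfolding time_integrable_def
    proof
      fix T
      obtain n :: nat where "T \<le> real n"
        using real_arch_simple by blast
      then have "?I T \<xi> \<le> ?I (real n) \<xi>"
        by (intro nn_integral_mono) (auto split: split_indicator)
      also have "\<dots> < top"
        using elim by blast
      finally show "?I T \<xi> < top" .
    qed
  qed
qed

lemma duh_integrable:
  assumes V: "case_prod V \<in> borel_measurable (lborel \<Otimes>\<^sub>M lborel)" and int: "time_integrable V \<xi>"
    and A: "A \<in> sets borel" "A \<subseteq> {0..t}"
  shows "set_integrable lborel A (\<lambda>\<tau>. kern (t - \<tau>) \<xi> (V \<tau> \<xi>))"
  unfolding set_integrable_def
proof (rule integrableI_bounded)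
  note [measurable] = joint_measurableD[OF V] A(1)
  show "(\<lambda>\<tau>. indicat_real A \<tau> *\<^sub>R kern (t - \<tau>) \<xi> (V \<tau> \<xi>)) \<in> borel_measurable lborel"
    by measurable
  have "(\<integral>\<^sup>+\<tau>. ennreal (norm (indicat_real A \<tau> *\<^sub>R kern (t - \<tau>) \<xi> (V \<tau> \<xi>))) \<partial>lborel)
      \<le> (\<integral>\<^sup>+\<tau>. ennreal 324 * (indicator {0..t} \<tau> * ennreal (norm (V \<tau> \<xi>))) \<partial>lborel)"
  proof (rule nn_integral_mono)
    fix \<tau>
    show "ennreal (norm (indicat_real A \<tau> *\<^sub>R kern (t - \<tau>) \<xi> (V \<tau> \<xi>))) \<le> ennreal 324 * (indicator {0..t} \<tau> * ennreal (norm (V \<tau> \<xi>)))"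
    proof (cases "\<tau> \<in> A")
      case True
      then have "\<tau> \<in> {0..t}"
        using A by blast
      then have "ennreal (norm (kern (t - \<tau>) \<xi> (V \<tau> \<xi>))) \<le> ennreal (324 * norm (V \<tau> \<xi>))"
        by (intro ennreal_leI norm_kern_le') simp
      also have "\<dots> = ennreal 324 * ennreal (norm (V \<tau> \<xi>))"
        by (rule ennreal_mult) auto
      finally show ?thesis
        using True \<open>\<tau> \<in> {0..t}\<close> by simp
    qed simp
  qed
  also have "\<dots> < top"
    using int by (subst nn_integral_cmult) (auto simp: time_integrable_def ennreal_mult_less_top)
  finally show "(\<integral>\<^sup>+\<tau>. ennreal (norm (indicat_real A \<tau> *\<^sub>R kern (t - \<tau>) \<xi> (V \<tau> \<xi>))) \<partial>lborel) < \<infinity>"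
    by simp
qed

lemma duh_measurable:
  assumes V: "case_prod V \<in> borel_measurable (lborel \<Otimes>\<^sub>M lborel)" and [measurable]: "A \<in> sets borel"
  shows "duh A V t \<in> borel_measurable borel"
proof -
  have [measurable]: "(\<lambda>x. V (snd x) (fst x)) \<in> borel_measurable (borel \<Otimes>\<^sub>M lborel)"
    using measurable_compose[OF _ V, of "\<lambda>x. (snd x, fst x)" "borel \<Otimes>\<^sub>M lborel"] by simp
  have "(\<lambda>(\<xi>, \<tau>). indicat_real A \<tau> *\<^sub>R kern (t - \<tau>) \<xi> (V \<tau> \<xi>)) \<in> borel_measurable (borel \<Otimes>\<^sub>M lborel)"
    unfolding case_prod_beta' by measurable
  then show ?thesis
    unfolding duh_def set_lebesgue_integral_def by (rule lborel.borel_measurable_lebesgue_integral)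
qed

text \<open>On the support of the \<open>j\<close>-th block the kernel decays like \<open>exp (- heat_rate j * t)\<close>.\<close>

definition heat_rate :: "int \<Rightarrow> real" where
  "heat_rate j = \<nu> * (3/4) powr (2 * \<alpha>) * 2 powr (2 * \<alpha> * j)"

lemma heat_rate_pos: "0 < heat_rate j"
  using \<nu>_pos by (simp add: heat_rate_def)

lemma cut_kern_le:
  assumes "0 \<le> t"
  shows "cut j \<xi> * norm (kern t \<xi> z) \<le> 324 * exp (- (heat_rate j * t)) * (cut j \<xi> * norm z)"
proof (cases "cut j \<xi> = 0")
  case False
  have "(3/4) powr (2 * \<alpha>) * 2 powr (2 * \<alpha> * j) = (3/4 * 2 powr j) powr (2 * \<alpha>)"
    by (subst powr_mult) (simp_all add: powr_powr mult.commute)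
  also have "\<dots> \<le> norm \<xi> powr (2 * \<alpha>)"
    using cut_support(1)[OF False] \<alpha>_gt by (intro powr_mono2) auto
  finally have "\<nu> * ((3/4) powr (2 * \<alpha>) * 2 powr (2 * \<alpha> * j)) * t \<le> \<nu> * norm \<xi> powr (2 * \<alpha>) * t"
    using assms \<nu>_pos by (intro mult_right_mono mult_left_mono) auto
  then have "exp (- \<nu> * norm \<xi> powr (2 * \<alpha>) * t) \<le> exp (- (heat_rate j * t))"
    by (simp add: heat_rate_def mult.assoc)
  then have "324 * exp (- \<nu> * norm \<xi> powr (2 * \<alpha>) * t) * norm z \<le> 324 * exp (- (heat_rate j * t)) * norm z"
    by (intro mult_right_mono mult_left_mono) auto
  with norm_kern_le[of t \<xi> z] have "norm (kern t \<xi> z) \<le> 324 * exp (- (heat_rate j * t)) * norm z"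
    by linarith
  then have "cut j \<xi> * norm (kern t \<xi> z) \<le> cut j \<xi> * (324 * exp (- (heat_rate j * t)) * norm z)"
    by (rule mult_left_mono) simp
  then show ?thesis
    by (simp add: mult_ac)
qed simp

text \<open>On one block the matrix kernel is dominated by a scalar exponential depending on time
  alone, so Minkowski applies with that exponential as kernel.\<close>

lemma block_norm_duh_le:
  assumes V: "case_prod V \<in> borel_measurable (lborel \<Otimes>\<^sub>M lborel)" and ab: "a \<le> b" "b \<le> t"
    and c: "AE \<tau> in lborel. \<tau> \<in> {a..b} \<longrightarrow> block_norm \<phi> p j (V \<tau>) \<le> c"
  shows "block_norm \<phi> p j (duh {a..b} V t) \<le>
    ennreal 324 * (\<integral>\<^sup>+\<tau>. indicator {a..b} \<tau> * ennreal (exp (- (heat_rate j * (t - \<tau>)))) \<partial>lborel) * c"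
proof -
  note [measurable] = V joint_measurableD[OF V] duh_measurable[OF V]
  let ?k = "\<lambda>\<tau>. indicator {a..b} \<tau> * ennreal (exp (- (heat_rate j * (t - \<tau>))))"
  let ?I = "\<lambda>\<xi>. \<integral>\<^sup>+\<tau>. ?k \<tau> * ennreal (norm (V \<tau> \<xi>)) \<partial>lborel"
  have k: "(\<integral>\<^sup>+\<tau>. ?k \<tau> \<partial>lborel) < top"
    by (rule le_less_trans[OF nn_integral_exp_le(1)[OF heat_rate_pos ab(2,1)]]) simp
  have pw: "ennreal (cut j \<xi>) * ennreal (norm (duh {a..b} V t \<xi>)) \<le> ennreal 324 * (ennreal (cut j \<xi>) * ?I \<xi>)" for \<xi>
  proof -
    have "ennreal (cut j \<xi>) * ennreal (norm (duh {a..b} V t \<xi>)) \<le>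
        ennreal (cut j \<xi>) * (\<integral>\<^sup>+\<tau>. ennreal (norm (indicat_real {a..b} \<tau> *\<^sub>R kern (t - \<tau>) \<xi> (V \<tau> \<xi>))) \<partial>lborel)"
      unfolding duh_def set_lebesgue_integral_def by (intro mult_left_mono ennreal_norm_integral_le) simp
    also have "\<dots> = (\<integral>\<^sup>+\<tau>. ennreal (cut j \<xi> * norm (indicat_real {a..b} \<tau> *\<^sub>R kern (t - \<tau>) \<xi> (V \<tau> \<xi>))) \<partial>lborel)"
      by (subst nn_integral_cmult[symmetric]) (auto simp: ennreal_mult)
    also have "\<dots> \<le> (\<integral>\<^sup>+\<tau>. ennreal (324 * cut j \<xi>) * (?k \<tau> * ennreal (norm (V \<tau> \<xi>))) \<partial>lborel)"
    proof (rule nn_integral_mono)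
      fix \<tau>
      show "ennreal (cut j \<xi> * norm (indicat_real {a..b} \<tau> *\<^sub>R kern (t - \<tau>) \<xi> (V \<tau> \<xi>))) \<le>
          ennreal (324 * cut j \<xi>) * (?k \<tau> * ennreal (norm (V \<tau> \<xi>)))"
      proof (cases "\<tau> \<in> {a..b}")
        case True
        then have "cut j \<xi> * norm (kern (t - \<tau>) \<xi> (V \<tau> \<xi>)) \<le> (324 * cut j \<xi>) * (exp (- (heat_rate j * (t - \<tau>))) * norm (V \<tau> \<xi>))"
          using cut_kern_le[of "t - \<tau>" j \<xi> "V \<tau> \<xi>"] ab by (simp add: mult_ac)
        then have "ennreal (cut j \<xi> * norm (kern (t - \<tau>) \<xi> (V \<tau> \<xi>))) \<le>
            ennreal ((324 * cut j \<xi>) * (exp (- (heat_rate j * (t - \<tau>))) * norm (V \<tau> \<xi>)))"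
          by (rule ennreal_leI)
        also have "\<dots> = ennreal (324 * cut j \<xi>) * (ennreal (exp (- (heat_rate j * (t - \<tau>)))) * ennreal (norm (V \<tau> \<xi>)))"
          by (subst ennreal_mult, simp, simp, subst ennreal_mult) simp_all
        finally show ?thesis
          using True by simp
      qed simp
    qed
    also have "\<dots> = ennreal (324 * cut j \<xi>) * ?I \<xi>"
      by (rule nn_integral_cmult) measurable
    also have "\<dots> = ennreal 324 * (ennreal (cut j \<xi>) * ?I \<xi>)"
      by (simp add: ennreal_mult mult.assoc)
    finally show ?thesis .
  qed
  have "block_norm \<phi> p j (duh {a..b} V t) \<le> Lp_norm lborel p (\<lambda>\<xi>. ennreal 324 * (ennreal (cut j \<xi>) * ?I \<xi>))"
    unfolding block_norm_eq block_def by (rule Lp_norm_mono[OF p _ pw]) measurable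
  also have "\<dots> \<le> ennreal 324 * block j ?I"
    unfolding block_def by (rule Lp_norm_cmult_le[OF p]) measurable
  also have "\<dots> \<le> ennreal 324 * ((\<integral>\<^sup>+\<tau>. ?k \<tau> \<partial>lborel) * c)"
  proof (intro mult_left_mono block_time_integral k)
    show "AE \<tau> in lborel. ?k \<tau> \<noteq> 0 \<longrightarrow> block j (\<lambda>\<xi>. ennreal (norm (V \<tau> \<xi>))) \<le> c"
      using c by eventually_elim (auto simp: block_norm_eq indicator_def)
    show "?k \<in> borel_measurable borel" "(\<lambda>(\<tau>, \<xi>). ennreal (norm (V \<tau> \<xi>))) \<in> borel_measurable (lborel \<Otimes>\<^sub>M lborel)"
      by measurable
  qed simp
  finally show ?thesis
    by (simp add: mult.assoc)
qed

text \<open>Division by \<open>heat_rate j\<close> turns the weight of order \<open>s\<close> into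
  the weight of order \<open>r\<close>, as s = r + 2\<alpha>.\<close>

lemma heat_rate_pow2: "pow2 (j * s) * (ennreal (y / heat_rate j) * c) = ennreal (y / (\<nu> * (3/4) powr (2 * \<alpha>))) * (pow2 (j * r) * c)"
  if "0 \<le> y"
proof -
  have "2 powr (j * s) * (y / heat_rate j) = y / (\<nu> * (3/4) powr (2 * \<alpha>)) * 2 powr (j * r)"
  proof -
    have "2 powr (j * s) = 2 powr (2 * \<alpha> * j) * 2 powr (j * r)"
      unfolding powr_add[symmetric] by (simp add: s_eq r_eq algebra_simps)
    then show ?thesis
      by (simp add: heat_rate_def)
  qed
  then have "ennreal (2 powr (j * s)) * ennreal (y / heat_rate j) = ennreal (y / (\<nu> * (3/4) powr (2 * \<alpha>))) * ennreal (2 powr (j * r))"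
    using that \<nu>_pos heat_rate_pos[of j] by (simp flip: ennreal_mult)
  then show ?thesis
    by (simp add: pow2_def flip: mult.assoc)
qed

definition heat_const :: real where
  "heat_const = 324 / (\<nu> * (3/4) powr (2 * \<alpha>))"

lemma heat_const_nonneg: "0 \<le> heat_const"
  using \<nu>_pos by (simp add: heat_const_def)

text \<open>Parabolic smoothing with a constant independent of block and time. The second bound, for
  a window in the past, is the source of the decay of the integral over [0, T].\<close>

lemma duh_smoothing:
  assumes V: "case_prod V \<in> borel_measurable (lborel \<Otimes>\<^sub>M lborel)" and ab: "a \<le> b" "b \<le> t"
    and c: "AE \<tau> in lborel. \<tau> \<in> {a..b} \<longrightarrow> pow2 (j * r) * block_norm \<phi> p j (V \<tau>) \<le> c"
  shows "pow2 (j * s) * block_norm \<phi> p j (duh {a..b} V t) \<le> ennreal heat_const * c"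
    and "b < t \<Longrightarrow> pow2 (j * s) * block_norm \<phi> p j (duh {a..b} V t) \<le> ennreal (heat_const * ((b - a) / (t - b))) * c"
proof -
  let ?E = "\<integral>\<^sup>+\<tau>. indicator {a..b} \<tau> * ennreal (exp (- (heat_rate j * (t - \<tau>)))) \<partial>lborel"
  let ?c = "pow2 (- (j * r)) * c"
  have c': "AE \<tau> in lborel. \<tau> \<in> {a..b} \<longrightarrow> block_norm \<phi> p j (V \<tau>) \<le> ?c"
    using c by (simp add: pow2_le_swap)
  have *: "pow2 (j * s) * block_norm \<phi> p j (duh {a..b} V t) \<le> ennreal (heat_const * y) * c"
    if y: "0 \<le> y" and E: "?E \<le> ennreal (y / heat_rate j)" for y
  proof -
    have "block_norm \<phi> p j (duh {a..b} V t) \<le> ennreal 324 * ?E * ?c"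
      by (rule block_norm_duh_le[OF V ab c'])
    also have "\<dots> \<le> ennreal 324 * ennreal (y / heat_rate j) * ?c"
      by (intro mult_right_mono mult_left_mono E) auto
    finally have "pow2 (j * s) * block_norm \<phi> p j (duh {a..b} V t) \<le> pow2 (j * s) * (ennreal 324 * ennreal (y / heat_rate j) * ?c)"
      by (rule mult_left_mono) simp
    also have "\<dots> = ennreal 324 * (pow2 (j * s) * (ennreal (y / heat_rate j) * ?c))"
      by (simp add: mult_ac)
    also have "\<dots> = ennreal 324 * (ennreal (y / (\<nu> * (3/4) powr (2 * \<alpha>))) * c)"
      unfolding heat_rate_pow2[OF y] by (simp add: pow2_mult_left)
    also have "\<dots> = ennreal (324 * (y / (\<nu> * (3/4) powr (2 * \<alpha>)))) * c"
      using y \<nu>_pos by (subst ennreal_mult) (auto simp: mult.assoc)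
    also have "324 * (y / (\<nu> * (3/4) powr (2 * \<alpha>))) = heat_const * y"
      by (simp add: heat_const_def)
    finally show ?thesis .
  qed
  show "pow2 (j * s) * block_norm \<phi> p j (duh {a..b} V t) \<le> ennreal heat_const * c"
    using *[of 1] nn_integral_exp_le(1)[OF heat_rate_pos ab(2,1)] by simp
  assume bt: "b < t"
  have "(b - a) / (heat_rate j * (t - b)) = (b - a) / (t - b) / heat_rate j"
    by simp
  then have "?E \<le> ennreal ((b - a) / (t - b) / heat_rate j)"
    using nn_integral_exp_le(2)[OF heat_rate_pos ab(2,1) bt, of j] by (simp only:)
  then show "pow2 (j * s) * block_norm \<phi> p j (duh {a..b} V t) \<le> ennreal (heat_const * ((b - a) / (t - b))) * c"
    using ab bt by (intro *) simp_all
qed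

text \<open>Approach from the right makes the indicators of the growing intervals converge at every
  time, including the endpoint. The bound \<open>t + 1\<close> gives a common dominating
  function.\<close>

lemma duh_continuous:
  assumes V: "case_prod V \<in> borel_measurable (lborel \<Otimes>\<^sub>M lborel)" and int: "time_integrable V \<xi>"
    and X: "X \<longlonglongrightarrow> t" "\<And>n. t \<le> X n" "\<And>n. X n \<le> t + 1"
  shows "(\<lambda>n. duh {0..X n} V (X n) \<xi>) \<longlonglongrightarrow> duh {0..t} V t \<xi>"
  unfolding duh_def set_lebesgue_integral_def
proof (rule integral_dominated_convergence[where w="\<lambda>\<tau>. 324 * norm (indicat_real {0..t + 1} \<tau> *\<^sub>R V \<tau> \<xi>)"])
  note [measurable] = joint_measurableD[OF V]
  show "integrable lborel (\<lambda>\<tau>. 324 * norm (indicat_real {0..t + 1} \<tau> *\<^sub>R V \<tau> \<xi>))"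
  proof (intro integrable_mult_right integrable_norm integrableI_bounded)
    have "(\<integral>\<^sup>+\<tau>. ennreal (norm (indicat_real {0..t + 1} \<tau> *\<^sub>R V \<tau> \<xi>)) \<partial>lborel) =
        (\<integral>\<^sup>+\<tau>. indicator {0..t + 1} \<tau> * ennreal (norm (V \<tau> \<xi>)) \<partial>lborel)"
      by (intro nn_integral_cong) (simp split: split_indicator)
    then show "(\<integral>\<^sup>+\<tau>. ennreal (norm (indicat_real {0..t + 1} \<tau> *\<^sub>R V \<tau> \<xi>)) \<partial>lborel) < \<infinity>"
      using int by (simp add: time_integrable_def)
  qed measurable
  show "AE \<tau> in lborel. norm (indicat_real {0..X n} \<tau> *\<^sub>R kern (X n - \<tau>) \<xi> (V \<tau> \<xi>)) \<le> 324 * norm (indicat_real {0..t + 1} \<tau> *\<^sub>R V \<tau> \<xi>)" for n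
  proof (intro AE_I2)
    fix \<tau>
    show "norm (indicat_real {0..X n} \<tau> *\<^sub>R kern (X n - \<tau>) \<xi> (V \<tau> \<xi>)) \<le> 324 * norm (indicat_real {0..t + 1} \<tau> *\<^sub>R V \<tau> \<xi>)"
      using norm_kern_le'[of "X n - \<tau>" \<xi> "V \<tau> \<xi>"] X(3)[of n] by (auto simp: indicator_def)
  qed
  show "AE \<tau> in lborel. (\<lambda>n. indicat_real {0..X n} \<tau> *\<^sub>R kern (X n - \<tau>) \<xi> (V \<tau> \<xi>)) \<longlonglongrightarrow> indicat_real {0..t} \<tau> *\<^sub>R kern (t - \<tau>) \<xi> (V \<tau> \<xi>)"
  proof (intro AE_I2 tendsto_scaleR)
    fix \<tau>
    have "(\<lambda>n. X n - \<tau>) \<longlonglongrightarrow> t - \<tau>"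
      by (intro tendsto_intros X)
    then show "(\<lambda>n. kern (X n - \<tau>) \<xi> (V \<tau> \<xi>)) \<longlonglongrightarrow> kern (t - \<tau>) \<xi> (V \<tau> \<xi>)"
      using continuous_kern by (intro isCont_tendsto_compose[of "t - \<tau>" "\<lambda>t. kern t \<xi> (V \<tau> \<xi>)"]) (auto simp: continuous_on_eq_continuous_at)
    show "(\<lambda>n. indicat_real {0..X n} \<tau>) \<longlonglongrightarrow> indicat_real {0..t} \<tau>"
    proof (cases "\<tau> \<le> t")
      case True
      then have "\<tau> \<le> X n" for n
        using X(2)[of n] by linarith
      with True show ?thesis
        by (simp add: indicator_def)
    next
      case False
      then have "\<forall>\<^sub>F n in sequentially. X n < \<tau>"
        by (intro order_tendstoD(2)[OF X(1)]) simp
      then have "\<forall>\<^sub>F n in sequentially. indicat_real {0..X n} \<tau> = indicat_real {0..t} \<tau>"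
        by eventually_elim (use False in \<open>simp add: indicator_def\<close>)
      then show ?thesis
        by (rule tendsto_eventually)
    qed
  qed
  show "(\<lambda>\<tau>. indicat_real {0..t} \<tau> *\<^sub>R kern (t - \<tau>) \<xi> (V \<tau> \<xi>)) \<in> borel_measurable lborel"
    by measurable
  show "(\<lambda>\<tau>. indicat_real {0..X n} \<tau> *\<^sub>R kern (X n - \<tau>) \<xi> (V \<tau> \<xi>)) \<in> borel_measurable lborel" for n
    by measurable
qed

text \<open>Good times accumulate at \<open>t\<close> from the right; along them the Duhamel
  integral converges for almost every frequency, and Fatou's lemma keeps the bound.\<close>

lemma block_norm_duh_every_time:
  assumes V: "admissible V c" and t: "0 \<le> t"
    and le: "AE t in lborel. 0 \<le> t \<longrightarrow> block_norm \<phi> p j (duh {0..t} V t) \<le> b"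
  shows "block_norm \<phi> p j (duh {0..t} V t) \<le> b"
proof -
  have Vm: "case_prod V \<in> borel_measurable (lborel \<Otimes>\<^sub>M lborel)"
    using V by (simp add: admissible_def)
  have "\<exists>x. t < x \<and> x < t + 1 / real (Suc n) \<and> block_norm \<phi> p j (duh {0..x} V x) \<le> b" for n
  proof (rule ccontr)
    assume no: "\<not> ?thesis"
    obtain N where N: "{x. \<not> (0 \<le> x \<longrightarrow> block_norm \<phi> p j (duh {0..x} V x) \<le> b)} \<subseteq> N" "emeasure lborel N = 0" "N \<in> sets borel"
      using AE_E[OF le] by auto
    \<comment> \<open>A nonempty open interval has positive measure, so it cannot consist of bad
      times only.\<close>
    have "{t<..<t + 1 / real (Suc n)} \<subseteq> N"
      using no t N(1) by force
    then have "emeasure lborel {t<..<t + 1 / real (Suc n)} \<le> emeasure lborel N"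
      using N(3) by (intro emeasure_mono) auto
    then show False
      using N(2) by simp
  qed
  then obtain X where X: "\<And>n. t < X n" "\<And>n. X n < t + 1 / real (Suc n)"
    "\<And>n. block_norm \<phi> p j (duh {0..X n} V (X n)) \<le> b"
    by metis
  have lim: "X \<longlonglongrightarrow> t"
  proof (rule tendsto_sandwich[of "\<lambda>_. t" X _ "\<lambda>n. t + 1 / real (Suc n)"])
    show "(\<lambda>n. t + 1 / real (Suc n)) \<longlonglongrightarrow> t"
      using tendsto_add[OF tendsto_const LIMSEQ_Suc[OF lim_1_over_n], of t] by simp
  qed (use X(1,2) in \<open>auto intro!: always_eventually less_imp_le\<close>)
  have X1: "X n \<le> t + 1" for n
  proof -
    have "1 / real (Suc n) \<le> 1"
      by simp
    with X(2)[of n] show ?thesis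
      by linarith
  qed
  note [measurable] = duh_measurable[OF Vm]
  have "AE \<xi> in lborel. (\<lambda>n. ennreal (cut j \<xi>) * ennreal (norm (duh {0..X n} V (X n) \<xi>))) \<longlonglongrightarrow>
      ennreal (cut j \<xi>) * ennreal (norm (duh {0..t} V t \<xi>))"
    using admissible_time_integrable[OF V]
  proof eventually_elim
    case (elim \<xi>)
    have "(\<lambda>n. duh {0..X n} V (X n) \<xi>) \<longlonglongrightarrow> duh {0..t} V t \<xi>"
      by (rule duh_continuous[OF Vm elim lim less_imp_le[OF X(1)] X1])
    then show ?case
      by (intro ennreal_tendsto_cmult tendsto_ennrealI tendsto_norm) auto
  qed
  then show ?thesis
    unfolding block_norm_eq block_def
    by (rule Lp_norm_Fatou[OF p, rotated 2]) (use X(3) in \<open>auto simp: block_norm_eq block_def\<close>)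
qed

text \<open>In the hypothesis the exceptional frequencies depend on the time, whereas the integral
  in time is taken at a fixed frequency; Fubini exchanges the two null sets. The resulting null set
  is the same for all \<open>t\<close>.\<close>

lemma duh_add:
  assumes V: "admissible V c" "admissible W d" "admissible Z e"
    and eq: "AE \<tau> in lborel. 0 \<le> \<tau> \<longrightarrow> (AE \<xi> in lborel. V \<tau> \<xi> = W \<tau> \<xi> + Z \<tau> \<xi>)"
  shows "AE \<xi> in lborel. \<forall>t. duh {0..t} V t \<xi> = duh {0..t} W t \<xi> + duh {0..t} Z t \<xi>"
proof -
  have m: "case_prod V \<in> borel_measurable (lborel \<Otimes>\<^sub>M lborel)" "case_prod W \<in> borel_measurable (lborel \<Otimes>\<^sub>M lborel)"
    "case_prod Z \<in> borel_measurable (lborel \<Otimes>\<^sub>M lborel)"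
    using V by (auto simp: admissible_def)
  have [measurable]: "(\<lambda>x. V (fst x) (snd x)) \<in> borel_measurable (lborel \<Otimes>\<^sub>M lborel)"
    "(\<lambda>x. W (fst x) (snd x)) \<in> borel_measurable (lborel \<Otimes>\<^sub>M lborel)"
    "(\<lambda>x. Z (fst x) (snd x)) \<in> borel_measurable (lborel \<Otimes>\<^sub>M lborel)"
    using m by (simp_all add: case_prod_beta')
  note [measurable] = joint_measurableD[OF m(1)] joint_measurableD[OF m(2)] joint_measurableD[OF m(3)]
  have "AE \<tau> in lborel. AE \<xi> in lborel. 0 \<le> \<tau> \<longrightarrow> V \<tau> \<xi> = W \<tau> \<xi> + Z \<tau> \<xi>"
    using eq by eventually_elim auto
  moreover have "{x \<in> space (lborel \<Otimes>\<^sub>M lborel). 0 \<le> fst x \<longrightarrow> V (fst x) (snd x) = W (fst x) (snd x) + Z (fst x) (snd x)}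
      \<in> sets (lborel \<Otimes>\<^sub>M lborel)"
    by measurable
  ultimately have "AE \<xi> in lborel. AE \<tau> in lborel. 0 \<le> \<tau> \<longrightarrow> V \<tau> \<xi> = W \<tau> \<xi> + Z \<tau> \<xi>"
    by (subst lborel_pair.AE_commute[symmetric]) auto
  then show ?thesis
    using admissible_time_integrable[OF V(2)] admissible_time_integrable[OF V(3)]
  proof (eventually_elim, intro allI)
    fix \<xi> t assume ae: "AE \<tau> in lborel. 0 \<le> \<tau> \<longrightarrow> V \<tau> \<xi> = W \<tau> \<xi> + Z \<tau> \<xi>"
      and int: "time_integrable W \<xi>" "time_integrable Z \<xi>"
    have "duh {0..t} V t \<xi> = (LINT \<tau>:{0..t}|lborel. kern (t - \<tau>) \<xi> (W \<tau> \<xi>) + kern (t - \<tau>) \<xi> (Z \<tau> \<xi>))"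
      unfolding duh_def set_lebesgue_integral_def
    proof (rule integral_cong_AE)
      show "AE \<tau> in lborel. indicat_real {0..t} \<tau> *\<^sub>R kern (t - \<tau>) \<xi> (V \<tau> \<xi>) =
          indicat_real {0..t} \<tau> *\<^sub>R (kern (t - \<tau>) \<xi> (W \<tau> \<xi>) + kern (t - \<tau>) \<xi> (Z \<tau> \<xi>))"
        using ae by eventually_elim (auto simp: kern_add indicator_def)
    qed measurable
    then show "duh {0..t} V t \<xi> = duh {0..t} W t \<xi> + duh {0..t} Z t \<xi>"
      unfolding duh_def
      using set_integral_add(2)[OF duh_integrable[OF m(2) int(1)] duh_integrable[OF m(3) int(2)], of "{0..t}" t] by simp
  qed
qed

text \<open>The late part appears as a Duhamel integral over all of [0, t] whose integrand vanishes
  before \<open>T\<close>; this is the form to which the bilinear estimate applies.\<close>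

lemma duh_split:
  assumes V: "admissible V c" "admissible W d" and T: "0 \<le> T" "T \<le> t"
    and eq: "AE \<tau> in lborel. 0 \<le> \<tau> \<longrightarrow> (AE \<xi> in lborel. W \<tau> \<xi> = (if T \<le> \<tau> then V \<tau> \<xi> else 0))"
  shows "AE \<xi> in lborel. duh {0..t} V t \<xi> = duh {0..T} V t \<xi> + duh {0..t} W t \<xi>"
proof -
  have m: "case_prod V \<in> borel_measurable (lborel \<Otimes>\<^sub>M lborel)" "case_prod W \<in> borel_measurable (lborel \<Otimes>\<^sub>M lborel)"
    using V by (auto simp: admissible_def)
  have [measurable]: "(\<lambda>x. V (fst x) (snd x)) \<in> borel_measurable (lborel \<Otimes>\<^sub>M lborel)"
    "(\<lambda>x. W (fst x) (snd x)) \<in> borel_measurable (lborel \<Otimes>\<^sub>M lborel)"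
    using m by (simp_all add: case_prod_beta')
  note [measurable] = joint_measurableD[OF m(1)] joint_measurableD[OF m(2)]
  have "AE \<tau> in lborel. AE \<xi> in lborel. 0 \<le> \<tau> \<longrightarrow> W \<tau> \<xi> = (if T \<le> \<tau> then V \<tau> \<xi> else 0)"
    using eq by eventually_elim auto
  moreover have "{x \<in> space (lborel \<Otimes>\<^sub>M lborel). 0 \<le> fst x \<longrightarrow> W (fst x) (snd x) = (if T \<le> fst x then V (fst x) (snd x) else 0)}
      \<in> sets (lborel \<Otimes>\<^sub>M lborel)"
    by measurable
  ultimately have "AE \<xi> in lborel. AE \<tau> in lborel. 0 \<le> \<tau> \<longrightarrow> W \<tau> \<xi> = (if T \<le> \<tau> then V \<tau> \<xi> else 0)"
    by (rule lborel_pair.AE_commute[where P="\<lambda>\<tau> \<xi>. 0 \<le> \<tau> \<longrightarrow> W \<tau> \<xi> = (if T \<le> \<tau> then V \<tau> \<xi> else 0)", THEN iffD1, rotated])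
  then show ?thesis
    using admissible_time_integrable[OF V(1)] admissible_time_integrable[OF V(2)]
  proof eventually_elim
    fix \<xi> assume ae: "AE \<tau> in lborel. 0 \<le> \<tau> \<longrightarrow> W \<tau> \<xi> = (if T \<le> \<tau> then V \<tau> \<xi> else 0)"
      and int: "time_integrable V \<xi>" "time_integrable W \<xi>"
    let ?f = "\<lambda>\<tau>. kern (t - \<tau>) \<xi> (V \<tau> \<xi>)" and ?g = "\<lambda>\<tau>. kern (t - \<tau>) \<xi> (W \<tau> \<xi>)"
    have "(LINT \<tau>|lborel. indicat_real {0..t} \<tau> *\<^sub>R ?f \<tau>) =
        (LINT \<tau>|lborel. indicat_real {0..T} \<tau> *\<^sub>R ?f \<tau> + indicat_real {0..t} \<tau> *\<^sub>R ?g \<tau>)"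
    proof (rule integral_cong_AE)
      show "AE \<tau> in lborel. indicat_real {0..t} \<tau> *\<^sub>R ?f \<tau> = indicat_real {0..T} \<tau> *\<^sub>R ?f \<tau> + indicat_real {0..t} \<tau> *\<^sub>R ?g \<tau>"
        \<comment> \<open>At the single time \<open>T\<close> both pieces contribute, so it is
          discarded.\<close>
        using ae AE_lborel_singleton[of T]
        by eventually_elim (use T in \<open>auto simp: indicator_def split: if_splits\<close>)
    qed measurable
    also have "\<dots> = (LINT \<tau>|lborel. indicat_real {0..T} \<tau> *\<^sub>R ?f \<tau>) + (LINT \<tau>|lborel. indicat_real {0..t} \<tau> *\<^sub>R ?g \<tau>)"
      using duh_integrable[OF m(1) int(1), of "{0..T}" t] duh_integrable[OF m(2) int(2), of "{0..t}" t] T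
      by (intro Bochner_Integration.integral_add) (auto simp: set_integrable_def)
    finally show "duh {0..t} V t \<xi> = duh {0..T} V t \<xi> + duh {0..t} W t \<xi>"
      by (simp add: duh_def set_lebesgue_integral_def)
  qed
qed

end

section \<open>The nonlinearity and decay of late-time norms\<close>

text \<open>Equality holds at every \<xi>: the factors occur only under the integral, and reflection
  preserves null sets.\<close>

lemma convolution_cong_AE:
  assumes [measurable]: "f \<in> borel_measurable borel" "f' \<in> borel_measurable borel" "g \<in> borel_measurable borel" "g' \<in> borel_measurable borel"
    and f: "AE \<eta> in lborel. f \<eta> = f' \<eta>" and g: "AE \<eta> in lborel. g \<eta> = g' \<eta>"
  shows "convolution f g \<xi> = convolution f' g' \<xi>"
  unfolding convolution_def
  by (rule integral_cong_AE) (use AE_lborel_reflect[OF f, of \<xi>] g in \<open>auto elim: eventually_elim2\<close>)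

lemma convolution_zero [simp]: "convolution (\<lambda>\<eta>. 0) g \<xi> = 0" "convolution f (\<lambda>\<eta>. 0) \<xi> = 0"
  by (simp_all add: convolution_def)

definition div_tensor :: "(real^3 \<Rightarrow> complex^3) \<Rightarrow> (real^3 \<Rightarrow> complex^3) \<Rightarrow> real^3 \<Rightarrow> complex^3" where
  "div_tensor F G \<xi> = (\<chi> k. \<Sum>m\<in>UNIV. \<i> * complex_of_real (\<xi>$m) * convolution (\<lambda>\<eta>. F \<eta> $ m) (\<lambda>\<eta>. G \<eta> $ k) \<xi>)"

lemma div_tensor_ft_eq: "div_tensor_ft v w \<tau> \<xi> = div_tensor (ft_time v \<tau>) (ft_time w \<tau>) \<xi>"
  by (simp add: div_tensor_ft_def div_tensor_def)

lemma div_tensor_zero [simp]: "div_tensor (\<lambda>\<eta>. 0) G \<xi> = 0" "div_tensor F (\<lambda>\<eta>. 0) \<xi> = 0"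
  by (simp_all add: div_tensor_def vec_eq_iff)

lemma div_tensor_cong_AE:
  assumes [measurable]: "F \<in> borel_measurable borel" "F' \<in> borel_measurable borel" "G \<in> borel_measurable borel" "G' \<in> borel_measurable borel"
    and F: "AE \<eta> in lborel. F \<eta> = F' \<eta>" and G: "AE \<eta> in lborel. G \<eta> = G' \<eta>"
  shows "div_tensor F G \<xi> = div_tensor F' G' \<xi>"
proof -
  have "convolution (\<lambda>\<eta>. F \<eta> $ m) (\<lambda>\<eta>. G \<eta> $ k) \<xi> = convolution (\<lambda>\<eta>. F' \<eta> $ m) (\<lambda>\<eta>. G' \<eta> $ k) \<xi>" for m k
    by (rule convolution_cong_AE) (use F G in \<open>auto elim: eventually_mono\<close>)
  then show ?thesis
    by (simp add: div_tensor_def)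
qed

lemma ennreal_norm_convolution_le:
  fixes F G :: "real^3 \<Rightarrow> complex^3"
  shows "ennreal (norm (convolution (\<lambda>\<eta>. F \<eta> $ m) (\<lambda>\<eta>. G \<eta> $ k) \<xi>)) \<le>
    nnconv (\<lambda>\<eta>. ennreal (norm (F \<eta>))) (\<lambda>\<eta>. ennreal (norm (G \<eta>))) \<xi>"
proof -
  have "ennreal (norm (F (\<xi> - \<eta>) $ m * G \<eta> $ k)) \<le> ennreal (norm (F (\<xi> - \<eta>))) * ennreal (norm (G \<eta>))" for \<eta>
    by (simp add: norm_mult Finite_Cartesian_Product.norm_nth_le mult_mono ennreal_leI flip: ennreal_mult)
  then show ?thesis
    unfolding convolution_def nnconv_def
    by (intro order_trans[OF ennreal_norm_integral_le] nn_integral_mono)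
qed

lemma ennreal_norm_div_tensor_le:
  "ennreal (norm (div_tensor F G \<xi>)) \<le>
    9 * (ennreal (norm \<xi>) * nnconv (\<lambda>\<eta>. ennreal (norm (F \<eta>))) (\<lambda>\<eta>. ennreal (norm (G \<eta>))) \<xi>)"
proof -
  let ?X = "ennreal (norm \<xi>) * nnconv (\<lambda>\<eta>. ennreal (norm (F \<eta>))) (\<lambda>\<eta>. ennreal (norm (G \<eta>))) \<xi>"
  have c: "ennreal (norm (div_tensor F G \<xi> $ k)) \<le> 3 * ?X" for k
  proof -
    let ?t = "\<lambda>m. \<i> * complex_of_real (\<xi>$m) * convolution (\<lambda>\<eta>. F \<eta> $ m) (\<lambda>\<eta>. G \<eta> $ k) \<xi>"
    have "ennreal (norm (div_tensor F G \<xi> $ k)) \<le> ennreal (\<Sum>m\<in>UNIV. norm (?t m))"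
      unfolding div_tensor_def vec_lambda_beta by (intro ennreal_leI norm_sum)
    also have "\<dots> = (\<Sum>m\<in>UNIV. ennreal (norm (?t m)))"
      by (rule sum_ennreal[symmetric]) simp
    also have "\<dots> \<le> (\<Sum>m\<in>(UNIV::3 set). ?X)"
    proof (rule sum_mono)
      fix m
      have "ennreal (norm (?t m)) = ennreal \<bar>\<xi>$m\<bar> * ennreal (norm (convolution (\<lambda>\<eta>. F \<eta> $ m) (\<lambda>\<eta>. G \<eta> $ k) \<xi>))"
        by (simp add: norm_mult ennreal_mult)
      also have "\<dots> \<le> ?X"
        by (intro mult_mono ennreal_norm_convolution_le ennreal_leI component_le_norm_cart) auto
      finally show "ennreal (norm (?t m)) \<le> ?X" .
    qed
    also have "\<dots> = 3 * ?X"
      by simp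
    finally show ?thesis .
  qed
  have "ennreal (norm (div_tensor F G \<xi>)) \<le> ennreal (\<Sum>k\<in>UNIV. norm (div_tensor F G \<xi> $ k))"
    by (intro ennreal_leI norm_vec_le_sum)
  also have "\<dots> = (\<Sum>k\<in>UNIV. ennreal (norm (div_tensor F G \<xi> $ k)))"
    by (rule sum_ennreal[symmetric]) simp
  also have "\<dots> \<le> (\<Sum>k\<in>(UNIV::3 set). 3 * ?X)"
    by (intro sum_mono c)
  also have "\<dots> = 9 * ?X"
    by (simp add: mult.assoc[symmetric])
  finally show ?thesis .
qed

lemma integrable_convolution:
  fixes F G :: "real^3 \<Rightarrow> complex^3"
  assumes [measurable]: "F \<in> borel_measurable borel" "G \<in> borel_measurable borel"
    and fin: "nnconv (\<lambda>\<eta>. ennreal (norm (F \<eta>))) (\<lambda>\<eta>. ennreal (norm (G \<eta>))) \<xi> < top"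
  shows "integrable lborel (\<lambda>\<eta>. F (\<xi> - \<eta>) $ m * G \<eta> $ k)"
proof (rule integrableI_bounded)
  have "ennreal (norm (F (\<xi> - \<eta>) $ m * G \<eta> $ k)) \<le> ennreal (norm (F (\<xi> - \<eta>))) * ennreal (norm (G \<eta>))" for \<eta>
    by (simp add: norm_mult Finite_Cartesian_Product.norm_nth_le mult_mono ennreal_leI flip: ennreal_mult)
  then have "(\<integral>\<^sup>+\<eta>. ennreal (norm (F (\<xi> - \<eta>) $ m * G \<eta> $ k)) \<partial>lborel) \<le> nnconv (\<lambda>\<eta>. ennreal (norm (F \<eta>))) (\<lambda>\<eta>. ennreal (norm (G \<eta>))) \<xi>"
    unfolding nnconv_def by (intro nn_integral_mono)
  with fin show "(\<integral>\<^sup>+\<eta>. ennreal (norm (F (\<xi> - \<eta>) $ m * G \<eta> $ k)) \<partial>lborel) < \<infinity>"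
    by (simp add: le_less_trans)
qed measurable

text \<open>The tensor identity UU - VV = (U - V)U + V(U - V). Splitting the integrals requires
  absolute convergence of the three products at \<xi>.\<close>

lemma div_tensor_diff:
  fixes U V W :: "real^3 \<Rightarrow> complex^3"
  assumes [measurable]: "U \<in> borel_measurable borel" "V \<in> borel_measurable borel" "W \<in> borel_measurable borel"
    and W: "AE \<eta> in lborel. W \<eta> = U \<eta> - V \<eta>"
    and fin: "nnconv (\<lambda>\<eta>. ennreal (norm (U \<eta>))) (\<lambda>\<eta>. ennreal (norm (U \<eta>))) \<xi> < top"
      "nnconv (\<lambda>\<eta>. ennreal (norm (V \<eta>))) (\<lambda>\<eta>. ennreal (norm (U \<eta>))) \<xi> < top"
      "nnconv (\<lambda>\<eta>. ennreal (norm (V \<eta>))) (\<lambda>\<eta>. ennreal (norm (V \<eta>))) \<xi> < top"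
  shows "div_tensor U U \<xi> = div_tensor V V \<xi> + (div_tensor W U \<xi> + div_tensor V W \<xi>)"
proof -
  let ?c = "\<lambda>F G m k. convolution (\<lambda>\<eta>. F \<eta> $ m) (\<lambda>\<eta>. G \<eta> $ k) \<xi>"
  note int = integrable_convolution[OF _ _ fin(1)] integrable_convolution[OF _ _ fin(2)] integrable_convolution[OF _ _ fin(3)]
  have "?c U U m k = ?c V V m k + (?c W U m k + ?c V W m k)" for m k
  proof -
    have "?c W U m k = ?c (\<lambda>\<eta>. U \<eta> - V \<eta>) U m k"
      by (rule convolution_cong_AE) (use W in \<open>auto elim: eventually_mono\<close>)
    also have "\<dots> = ?c U U m k - ?c V U m k"
      unfolding convolution_def by (simp add: left_diff_distrib int)
    finally have 1: "?c W U m k = ?c U U m k - ?c V U m k" .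
    have "?c V W m k = ?c V (\<lambda>\<eta>. U \<eta> - V \<eta>) m k"
      by (rule convolution_cong_AE) (use W in \<open>auto elim: eventually_mono\<close>)
    also have "\<dots> = ?c V U m k - ?c V V m k"
      unfolding convolution_def by (simp add: right_diff_distrib int)
    finally show ?thesis
      using 1 by simp
  qed
  then show ?thesis
    by (simp add: div_tensor_def vec_eq_iff algebra_simps sum.distrib)
qed

lemma lq_add:
  fixes a b :: "int \<Rightarrow> ennreal"
  assumes "1 \<le> q"
  shows "Lp_norm (count_space UNIV) q (\<lambda>j. a j + b j) \<le> Lp_norm (count_space UNIV) q a + Lp_norm (count_space UNIV) q b"
  by (rule Lp_norm_triangle[OF assms sigma_finite_measure_count_space_countable]) auto

text \<open>Uniformity of the decay in \<open>j\<close> is needed only for \<open>q = \<infinity>\<close>, where there is no dominated convergence.\<close>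

lemma lq_tail_tendsto_zero:
  fixes W :: "int \<Rightarrow> real \<Rightarrow> ennreal"
  assumes q: "1 \<le> q" and fin: "Lp_norm (count_space UNIV) q (\<lambda>j. SUP t\<in>{T..}. W j t) < top"
    and unif: "\<And>\<epsilon>::real. 0 < \<epsilon> \<Longrightarrow> \<exists>t0. \<forall>t\<ge>t0. \<forall>j. W j t \<le> ennreal \<epsilon>"
  shows "(\<lambda>n. Lp_norm (count_space UNIV) q (\<lambda>j. SUP t\<in>{T + real n..}. W j t)) \<longlonglongrightarrow> 0"
proof (rule lq_norm_tendsto_zero[OF q fin])
  show "(SUP t\<in>{T + real n..}. W j t) \<le> (SUP t\<in>{T..}. W j t)" for n j
    by (intro SUP_subset_mono) auto
  show "(\<lambda>n. SUP j. SUP t\<in>{T + real n..}. W j t) \<longlonglongrightarrow> 0"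
  proof (rule order_tendstoI)
    fix a :: ennreal assume "0 < a"
    then obtain b where b: "0 < b" "b < a"
      using dense by blast
    then obtain \<epsilon> where \<epsilon>: "b = ennreal \<epsilon>" "0 < \<epsilon>"
      by (cases b) auto
    obtain t0 where t0: "\<And>t j. t0 \<le> t \<Longrightarrow> W j t \<le> b"
      using unif[OF \<epsilon>(2)] \<epsilon>(1) by blast
    obtain N :: nat where N: "t0 - T \<le> real N"
      using real_arch_simple by blast
    have "(SUP j. SUP t\<in>{T + real n..}. W j t) \<le> b" if "N \<le> n" for n
      using that N by (intro SUP_least t0) auto
    then show "\<forall>\<^sub>F n in sequentially. (SUP j. SUP t\<in>{T + real n..}. W j t) < a"
      using b(2) unfolding eventually_sequentially by (meson le_less_trans)
  qed simp
qed

section \<open>Block bounds for the chosen transforms in time\<close>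

context fourier_besov
begin

lemma LFB_ft_time_block:
  assumes f: "f \<in> LFB_space \<phi> s p q"
  shows "AE t in lborel. 0 \<le> t \<longrightarrow> (\<forall>j. block_norm \<phi> p j (ft_time f t) = block_norm \<phi> p j (ft (f t)))"
  using ft_time_AE[OF f]
proof (eventually_elim, intro impI allI)
  fix t j assume t: "0 \<le> t" "0 \<le> t \<longrightarrow> (AE \<xi> in lborel. ft_time f t \<xi> = ft (f t) \<xi>)"
  show "block_norm \<phi> p j (ft_time f t) = block_norm \<phi> p j (ft (f t))"
    using t ft_time_measurable'[OF f, of t] FB_space_ft_measurable[OF LFB_spaceD(1)[OF f t(1)]]
    by (intro block_norm_cong_AE) auto
qed

lemma LFB_ft_time_bound:
  assumes f: "f \<in> LFB_space \<phi> s p q"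
  shows "AE t in lborel. 0 \<le> t \<longrightarrow> (\<forall>j. pow2 (j * s) * block_norm \<phi> p j (ft_time f t) \<le> LFB_norm \<phi> s p q f)"
  using LFB_ft_time_block[OF f] LFB_block_bound[OF f] by eventually_elim (auto simp: pow2_def)

end

section \<open>The nonlinearity as a Duhamel integrand\<close>

context duhamel
begin

lemma nnconv_weighted_block:
  assumes u: "u \<in> LFB_space \<phi> s p q" and v: "v \<in> LFB_space \<phi> s p q"
  obtains c where "c < top"
    "AE \<tau> in lborel. 0 \<le> \<tau> \<longrightarrow> (\<forall>j. pow2 (j * r) * block j (\<lambda>\<xi>. ennreal (norm \<xi>) *
       nnconv (\<lambda>\<eta>. ennreal (norm (ft_time u \<tau> \<eta>))) (\<lambda>\<eta>. ennreal (norm (ft_time v \<tau> \<eta>))) \<xi>) \<le> c)"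
proof (rule product_estimate)
  fix C :: real assume C: "0 \<le> C" "\<And>f g a b j. f \<in> borel_measurable borel \<Longrightarrow> g \<in> borel_measurable borel \<Longrightarrow>
       (\<And>j. pow2 (j * s) * block j f \<le> a) \<Longrightarrow> (\<And>j. pow2 (j * s) * block j g \<le> b) \<Longrightarrow> a < top \<Longrightarrow> b < top \<Longrightarrow>
       pow2 (j * r) * block j (\<lambda>\<xi>. ennreal (norm \<xi>) * nnconv f g \<xi>) \<le> ennreal C * a * b"
  let ?c = "ennreal C * LFB_norm \<phi> s p q u * LFB_norm \<phi> s p q v"
  have "AE \<tau> in lborel. 0 \<le> \<tau> \<longrightarrow> (\<forall>j. pow2 (j * r) * block j (\<lambda>\<xi>. ennreal (norm \<xi>) *
       nnconv (\<lambda>\<eta>. ennreal (norm (ft_time u \<tau> \<eta>))) (\<lambda>\<eta>. ennreal (norm (ft_time v \<tau> \<eta>))) \<xi>) \<le> ?c)"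
    using LFB_ft_time_bound[OF u] LFB_ft_time_bound[OF v]
  proof (eventually_elim, intro impI allI)
    fix \<tau> :: real and j assume \<tau>: "0 \<le> \<tau>"
      and b: "0 \<le> \<tau> \<longrightarrow> (\<forall>j. pow2 (j * s) * block_norm \<phi> p j (ft_time u \<tau>) \<le> LFB_norm \<phi> s p q u)"
        "0 \<le> \<tau> \<longrightarrow> (\<forall>j. pow2 (j * s) * block_norm \<phi> p j (ft_time v \<tau>) \<le> LFB_norm \<phi> s p q v)"
    note [measurable] = ft_time_measurable'[OF u] ft_time_measurable'[OF v]
    show "pow2 (j * r) * block j (\<lambda>\<xi>. ennreal (norm \<xi>) *
       nnconv (\<lambda>\<eta>. ennreal (norm (ft_time u \<tau> \<eta>))) (\<lambda>\<eta>. ennreal (norm (ft_time v \<tau> \<eta>))) \<xi>) \<le> ?c"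
      by (rule C(2)) (use b \<tau> LFB_spaceD(3)[OF u] LFB_spaceD(3)[OF v] in \<open>auto simp: block_norm_eq\<close>)
  qed
  moreover have "?c < top"
    using LFB_spaceD(3)[OF u] LFB_spaceD(3)[OF v] by (simp add: ennreal_mult_less_top)
  ultimately show thesis
    using that by blast
qed

text \<open>The product estimate bounds the convolution with the weight \<open>norm \<xi>\<close>,
  which is positive off the origin.\<close>

lemma nnconv_ft_time_finite:
  assumes u: "u \<in> LFB_space \<phi> s p q" and v: "v \<in> LFB_space \<phi> s p q"
  shows "AE \<tau> in lborel. 0 \<le> \<tau> \<longrightarrow> (AE \<xi> in lborel.
    nnconv (\<lambda>\<eta>. ennreal (norm (ft_time u \<tau> \<eta>))) (\<lambda>\<eta>. ennreal (norm (ft_time v \<tau> \<eta>))) \<xi> < top)"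
proof -
  obtain c where c: "c < top"
    "AE \<tau> in lborel. 0 \<le> \<tau> \<longrightarrow> (\<forall>j. pow2 (j * r) * block j (\<lambda>\<xi>. ennreal (norm \<xi>) *
       nnconv (\<lambda>\<eta>. ennreal (norm (ft_time u \<tau> \<eta>))) (\<lambda>\<eta>. ennreal (norm (ft_time v \<tau> \<eta>))) \<xi>) \<le> c)"
    using nnconv_weighted_block[OF u v] by blast
  note [measurable] = ft_time_measurable'[OF u] ft_time_measurable'[OF v]
  show ?thesis
    using c(2)
  proof (eventually_elim, intro impI)
    fix \<tau> :: real
    let ?n = "nnconv (\<lambda>\<eta>. ennreal (norm (ft_time u \<tau> \<eta>))) (\<lambda>\<eta>. ennreal (norm (ft_time v \<tau> \<eta>)))"
    assume \<tau>: "0 \<le> \<tau>" "0 \<le> \<tau> \<longrightarrow> (\<forall>j. pow2 (j * r) * block j (\<lambda>\<xi>. ennreal (norm \<xi>) * ?n \<xi>) \<le> c)"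
    have "AE \<xi> in lborel. ennreal (norm \<xi>) * ?n \<xi> < top"
    proof (rule AE_finite_of_block)
      fix j
      have "block j (\<lambda>\<xi>. ennreal (norm \<xi>) * ?n \<xi>) \<le> pow2 (- (j * r)) * c"
        using \<tau> by (simp add: pow2_le_swap)
      also have "\<dots> < top"
        using c(1) by (simp add: ennreal_mult_less_top)
      finally show "block j (\<lambda>\<xi>. ennreal (norm \<xi>) * ?n \<xi>) < top" .
    qed measurable
    then show "AE \<xi> in lborel. ?n \<xi> < top"
      using AE_lborel_singleton[of "0::real^3"]
      by eventually_elim (auto simp: ennreal_mult_less_top)
  qed
qed

lemma div_tensor_ft_measurable:
  assumes u: "u \<in> LFB_space \<phi> s p q" and v: "v \<in> LFB_space \<phi> s p q"
  shows "case_prod (div_tensor_ft u v) \<in> borel_measurable (lborel \<Otimes>\<^sub>M lborel)"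
proof (rule borel_measurable_vec_componentwise)
  fix k
  have [measurable]: "(\<lambda>x. ft_time u (fst (fst x)) (snd (fst x) - snd x)) \<in> borel_measurable ((lborel \<Otimes>\<^sub>M lborel) \<Otimes>\<^sub>M lborel)"
    using measurable_compose[OF _ ft_time_measurable[OF u], of "\<lambda>x. (fst (fst x), snd (fst x) - snd x)" "(lborel \<Otimes>\<^sub>M lborel) \<Otimes>\<^sub>M lborel"] by simp
  have [measurable]: "(\<lambda>x. ft_time v (fst (fst x)) (snd x)) \<in> borel_measurable ((lborel \<Otimes>\<^sub>M lborel) \<Otimes>\<^sub>M lborel)"
    using measurable_compose[OF _ ft_time_measurable[OF v], of "\<lambda>x. (fst (fst x), snd x)" "(lborel \<Otimes>\<^sub>M lborel) \<Otimes>\<^sub>M lborel"] by simp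
  have [measurable]: "(\<lambda>x. convolution (\<lambda>\<eta>. ft_time u (fst x) \<eta> $ m) (\<lambda>\<eta>. ft_time v (fst x) \<eta> $ k) (snd x)) \<in> borel_measurable (lborel \<Otimes>\<^sub>M lborel)" for m
    unfolding convolution_def
    by (rule lborel.borel_measurable_lebesgue_integral) (unfold case_prod_beta', measurable)
  show "(\<lambda>x. (case x of (\<tau>, \<xi>) \<Rightarrow> div_tensor_ft u v \<tau> \<xi>) $ k) \<in> borel_measurable (lborel \<Otimes>\<^sub>M lborel)"
    unfolding case_prod_beta' div_tensor_ft_def vec_lambda_beta by measurable
qed

lemma div_tensor_ft_admissible:
  assumes u: "u \<in> LFB_space \<phi> s p q" and v: "v \<in> LFB_space \<phi> s p q"
  obtains c where "admissible (div_tensor_ft u v) c"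
proof -
  obtain c where c: "c < top"
    "AE \<tau> in lborel. 0 \<le> \<tau> \<longrightarrow> (\<forall>j. pow2 (j * r) * block j (\<lambda>\<xi>. ennreal (norm \<xi>) *
       nnconv (\<lambda>\<eta>. ennreal (norm (ft_time u \<tau> \<eta>))) (\<lambda>\<eta>. ennreal (norm (ft_time v \<tau> \<eta>))) \<xi>) \<le> c)"
    using nnconv_weighted_block[OF u v] by blast
  note m = div_tensor_ft_measurable[OF u v]
  note [measurable] = joint_measurableD(1)[OF m] ft_time_measurable'[OF u] ft_time_measurable'[OF v]
  have "AE \<tau> in lborel. 0 \<le> \<tau> \<longrightarrow> (\<forall>j. pow2 (j * r) * block_norm \<phi> p j (div_tensor_ft u v \<tau>) \<le> 9 * c)"
    using c(2)
  proof (eventually_elim, intro impI allI)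
    fix \<tau> :: real and j
    let ?n = "\<lambda>\<xi>. ennreal (norm \<xi>) * nnconv (\<lambda>\<eta>. ennreal (norm (ft_time u \<tau> \<eta>))) (\<lambda>\<eta>. ennreal (norm (ft_time v \<tau> \<eta>))) \<xi>"
    assume \<tau>: "0 \<le> \<tau>" "0 \<le> \<tau> \<longrightarrow> (\<forall>j. pow2 (j * r) * block j ?n \<le> c)"
    have "block_norm \<phi> p j (div_tensor_ft u v \<tau>) \<le> block j (\<lambda>\<xi>. 9 * ?n \<xi>)"
      unfolding block_norm_eq
      by (rule block_mono_AE, measurable) (simp add: div_tensor_ft_eq ennreal_norm_div_tensor_le)
    also have "\<dots> \<le> 9 * block j ?n"
      by (rule block_cmult_le) measurable
    also have "\<dots> \<le> 9 * (pow2 (- (j * r)) * c)"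
      using \<tau> by (intro mult_left_mono) (auto simp: pow2_le_swap)
    finally have "block_norm \<phi> p j (div_tensor_ft u v \<tau>) \<le> pow2 (- (j * r)) * (9 * c)"
      by (simp only: mult.left_commute[of 9])
    then show "pow2 (j * r) * block_norm \<phi> p j (div_tensor_ft u v \<tau>) \<le> 9 * c"
      by (simp add: pow2_le_swap)
  qed
  moreover have "9 * c < top"
    using c(1) by (simp add: ennreal_mult_less_top)
  ultimately show thesis
    using m by (intro that[of "9 * c"]) (simp add: admissible_def)
qed

lemma ft_time_admissible:
  assumes F: "F \<in> LFB_space \<phi> r p q"
  shows "admissible (ft_time F) (LFB_norm \<phi> r p q F)"
  unfolding admissible_def using ft_time_measurable[OF F] LFB_spaceD(3)[OF F] LFB_ft_time_bound[OF F] by blast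

lemma admissible_add:
  assumes V: "admissible V c" and W: "admissible W d"
  shows "admissible (\<lambda>\<tau> \<xi>. V \<tau> \<xi> + W \<tau> \<xi>) (c + d)"
proof -
  have m: "case_prod V \<in> borel_measurable (lborel \<Otimes>\<^sub>M lborel)" "case_prod W \<in> borel_measurable (lborel \<Otimes>\<^sub>M lborel)"
    using V W by (auto simp: admissible_def)
  have "(\<lambda>x. case_prod V x + case_prod W x) \<in> borel_measurable (lborel \<Otimes>\<^sub>M lborel)"
    using m by measurable
  moreover have "AE \<tau> in lborel. 0 \<le> \<tau> \<longrightarrow> (\<forall>j. pow2 (j * r) * block_norm \<phi> p j (\<lambda>\<xi>. V \<tau> \<xi> + W \<tau> \<xi>) \<le> c + d)"
    using conjunct2[OF conjunct2[OF V[unfolded admissible_def]]] conjunct2[OF conjunct2[OF W[unfolded admissible_def]]]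
  proof (eventually_elim, intro impI allI)
    fix \<tau> :: real and j assume \<tau>: "0 \<le> \<tau>" "0 \<le> \<tau> \<longrightarrow> (\<forall>j. pow2 (j * r) * block_norm \<phi> p j (V \<tau>) \<le> c)"
      "0 \<le> \<tau> \<longrightarrow> (\<forall>j. pow2 (j * r) * block_norm \<phi> p j (W \<tau>) \<le> d)"
    have "block_norm \<phi> p j (\<lambda>\<xi>. V \<tau> \<xi> + W \<tau> \<xi>) \<le> block_norm \<phi> p j (V \<tau>) + block_norm \<phi> p j (W \<tau>)"
      using joint_measurableD(1)[OF m(1), of \<tau>] joint_measurableD(1)[OF m(2), of \<tau>]
      by (intro block_norm_le_add AE_I2 norm_triangle_ineq) auto
    then have "pow2 (j * r) * block_norm \<phi> p j (\<lambda>\<xi>. V \<tau> \<xi> + W \<tau> \<xi>) \<le> pow2 (j * r) * block_norm \<phi> p j (V \<tau>) + pow2 (j * r) * block_norm \<phi> p j (W \<tau>)"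
      unfolding distrib_left[symmetric] by (rule mult_left_mono) simp
    also have "\<dots> \<le> c + d"
      using \<tau> by (intro add_mono) auto
    finally show "pow2 (j * r) * block_norm \<phi> p j (\<lambda>\<xi>. V \<tau> \<xi> + W \<tau> \<xi>) \<le> c + d" .
  qed
  ultimately show ?thesis
    using V W by (simp add: admissible_def case_prod_beta')
qed

lemma bilinear_ft_eq_duh: "bilinear_ft \<nu> \<alpha> \<Omega> u v t \<xi> = - duh {0..t} (div_tensor_ft u v) t \<xi>"
  by (simp add: bilinear_ft_def duh_def kern_def)

lemma forcing_ft_eq_duh: "forcing_ft \<nu> \<alpha> \<Omega> F t \<xi> = duh {0..t} (ft_time F) t \<xi>"
  by (simp add: forcing_ft_def duh_def kern_def)

lemma duh_split_interval:
  assumes V: "admissible V c" and b: "0 \<le> b" "b \<le> t"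
  shows "AE \<xi> in lborel. duh {0..t} V t \<xi> = duh {0..b} V t \<xi> + duh {b..t} V t \<xi>"
  using admissible_time_integrable[OF V]
proof eventually_elim
  case (elim \<xi>)
  have m: "case_prod V \<in> borel_measurable (lborel \<Otimes>\<^sub>M lborel)"
    using V by (simp add: admissible_def)
  note [measurable] = joint_measurableD(2)[OF m, of \<xi>]
  let ?f = "\<lambda>\<tau>. kern (t - \<tau>) \<xi> (V \<tau> \<xi>)"
  have "(LINT \<tau>|lborel. indicat_real {0..t} \<tau> *\<^sub>R ?f \<tau>) =
      (LINT \<tau>|lborel. indicat_real {0..b} \<tau> *\<^sub>R ?f \<tau> + indicat_real {b..t} \<tau> *\<^sub>R ?f \<tau>)"
  proof (rule integral_cong_AE)
    show "AE \<tau> in lborel. indicat_real {0..t} \<tau> *\<^sub>R ?f \<tau> = indicat_real {0..b} \<tau> *\<^sub>R ?f \<tau> + indicat_real {b..t} \<tau> *\<^sub>R ?f \<tau>"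
      using AE_lborel_singleton[of b] by eventually_elim (use b in \<open>auto simp: indicator_def\<close>)
  qed measurable
  also have "\<dots> = (LINT \<tau>|lborel. indicat_real {0..b} \<tau> *\<^sub>R ?f \<tau>) + (LINT \<tau>|lborel. indicat_real {b..t} \<tau> *\<^sub>R ?f \<tau>)"
    using duh_integrable[OF m elim, of "{0..b}" t] duh_integrable[OF m elim, of "{b..t}" t] b
    by (intro Bochner_Integration.integral_add) (auto simp: set_integrable_def)
  finally show ?case
    by (simp add: duh_def set_lebesgue_integral_def)
qed

section \<open>Decay of the linear evolution, of past windows and of the forcing term\<close>

lemma norm_semigroup_ft_le:
  assumes "0 \<le> t" shows "norm (semigroup_ft \<nu> \<alpha> \<Omega> t f \<xi>) \<le> 18 * norm (ft f \<xi>)"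
proof -
  have "norm (semigroup_ft \<nu> \<alpha> \<Omega> t f \<xi>) \<le> 9 * (2 * exp (- \<nu> * norm \<xi> powr (2 * \<alpha>) * t)) * norm (ft f \<xi>)"
    unfolding semigroup_ft_def by (intro norm_mat_apply_le abs_semigroup_symbol_le)
  also have "\<dots> \<le> 18 * norm (ft f \<xi>)"
    using assms \<nu>_pos by (intro mult_right_mono) auto
  finally show ?thesis .
qed

lemma semigroup_ft_measurable:
  assumes "ft f \<in> borel_measurable borel"
  shows "semigroup_ft \<nu> \<alpha> \<Omega> t f \<in> borel_measurable borel"
  unfolding semigroup_ft_def[abs_def] using assms
  by (intro mat_apply_measurable semigroup_symbol_measurable) auto

lemma block_norm_add:
  assumes "f \<in> borel_measurable borel" "g \<in> borel_measurable borel"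
  shows "block_norm \<phi> p j (\<lambda>\<xi>. f \<xi> + g \<xi>) \<le> block_norm \<phi> p j f + block_norm \<phi> p j g"
  using assms by (intro block_norm_le_add AE_I2 norm_triangle_ineq) auto

lemma block_norm_uminus: "block_norm \<phi> p j (\<lambda>\<xi>. - f \<xi>) = block_norm \<phi> p j f"
  by (simp add: block_norm_eq)

text \<open>The weighted l^q norm of this sequence is the left-hand side of the assumed bilinear
  estimate.\<close>

definition bilinear_sup :: "(real \<Rightarrow> tdist) \<Rightarrow> (real \<Rightarrow> tdist) \<Rightarrow> int \<Rightarrow> ennreal" where
  "bilinear_sup u v j = esssup (lebesgue_on {0..}) (\<lambda>t. block_norm \<phi> p j (bilinear_ft \<nu> \<alpha> \<Omega> u v t))"

text \<open>The tails below are suprema over all late times, not essential ones, so the essential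
  bound is first carried over to every time.\<close>

lemma bilinear_sup_bound:
  assumes u: "u \<in> LFB_space \<phi> s p q" and v: "v \<in> LFB_space \<phi> s p q" and t: "0 \<le> t"
  shows "block_norm \<phi> p j (duh {0..t} (div_tensor_ft u v) t) \<le> bilinear_sup u v j"
proof -
  obtain c where c: "admissible (div_tensor_ft u v) c"
    by (rule div_tensor_ft_admissible[OF u v])
  have eq: "block_norm \<phi> p j (bilinear_ft \<nu> \<alpha> \<Omega> u v t) = block_norm \<phi> p j (duh {0..t} (div_tensor_ft u v) t)" for t
    using block_norm_uminus[of j "duh {0..t} (div_tensor_ft u v) t"] by (simp add: bilinear_ft_eq_duh[abs_def])
  have "AE t in lborel. 0 \<le> t \<longrightarrow> block_norm \<phi> p j (duh {0..t} (div_tensor_ft u v) t) \<le> bilinear_sup u v j"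
    using esssup_AE[of "\<lambda>t. block_norm \<phi> p j (bilinear_ft \<nu> \<alpha> \<Omega> u v t)" "lebesgue_on {0..}"]
    unfolding AE_time_iff bilinear_sup_def eq .
  then show ?thesis
    by (rule block_norm_duh_every_time[OF c t])
qed

text \<open>The supremum over time stands inside the l^q norm, so the limit hypothesis is used
  blockwise: it makes all blocks small at once. The majorant is 18 times the blocks of
  \<open>d\<close>, by boundedness of the symbol.\<close>

lemma semigroup_tail:
  assumes d: "d \<in> FB_space \<phi> s p q" and T: "0 \<le> T"
    and lim: "((\<lambda>t. FB_norm_ft \<phi> s p q (semigroup_ft \<nu> \<alpha> \<Omega> t d)) \<longlongrightarrow> 0) at_top"
  shows "(\<lambda>n. Lp_norm (count_space UNIV) q (\<lambda>j. SUP t\<in>{T + real n..}.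
    pow2 (j * s) * block_norm \<phi> p j (semigroup_ft \<nu> \<alpha> \<Omega> t d))) \<longlonglongrightarrow> 0"
proof (rule lq_tail_tendsto_zero[OF q])
  note [measurable] = FB_space_ft_measurable[OF d] semigroup_ft_measurable[OF FB_space_ft_measurable[OF d]]
  have "block_norm \<phi> p j (semigroup_ft \<nu> \<alpha> \<Omega> t d) \<le> ennreal 18 * block_norm \<phi> p j (ft d)" if "0 \<le> t" for t j
  proof -
    have "ennreal (norm (semigroup_ft \<nu> \<alpha> \<Omega> t d \<xi>)) \<le> ennreal 18 * ennreal (norm (ft d \<xi>))" for \<xi>
      unfolding ennreal_mult[OF zero_le_numeral norm_ge_zero, symmetric]
      by (intro ennreal_leI norm_semigroup_ft_le that)
    then have "block_norm \<phi> p j (semigroup_ft \<nu> \<alpha> \<Omega> t d) \<le> block j (\<lambda>\<xi>. ennreal 18 * ennreal (norm (ft d \<xi>)))"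
      unfolding block_norm_eq by (intro block_mono_AE AE_I2) auto
    also have "\<dots> \<le> ennreal 18 * block_norm \<phi> p j (ft d)"
      unfolding block_norm_eq by (rule block_cmult_le) measurable
    finally show ?thesis .
  qed
  then have "(SUP t\<in>{T..}. pow2 (j * s) * block_norm \<phi> p j (semigroup_ft \<nu> \<alpha> \<Omega> t d)) \<le> pow2 (j * s) * (ennreal 18 * block_norm \<phi> p j (ft d))" for j
    using T by (intro SUP_least mult_left_mono) auto
  then have "Lp_norm (count_space UNIV) q (\<lambda>j. SUP t\<in>{T..}. pow2 (j * s) * block_norm \<phi> p j (semigroup_ft \<nu> \<alpha> \<Omega> t d)) \<le>
      weighted_lq q s (\<lambda>j. ennreal 18 * block_norm \<phi> p j (ft d))"
    unfolding weighted_lq_def pow2_def[symmetric] by (intro Lp_norm_mono[OF q]) auto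
  also have "\<dots> \<le> ennreal 18 * FB_norm \<phi> s p q d"
    unfolding FB_norm_def FB_norm_ft_eq by (rule weighted_lq_cmult_le[OF q])
  also have "\<dots> < top"
    using d by (simp add: FB_space_def ennreal_mult_less_top)
  finally show "Lp_norm (count_space UNIV) q (\<lambda>j. SUP t\<in>{T..}. pow2 (j * s) * block_norm \<phi> p j (semigroup_ft \<nu> \<alpha> \<Omega> t d)) < top" .
  fix \<epsilon> :: real assume "0 < \<epsilon>"
  then have "\<forall>\<^sub>F t in at_top. FB_norm_ft \<phi> s p q (semigroup_ft \<nu> \<alpha> \<Omega> t d) < ennreal \<epsilon>"
    by (intro order_tendstoD(2)[OF lim]) simp
  then obtain t0 where t0: "\<And>t. t0 \<le> t \<Longrightarrow> FB_norm_ft \<phi> s p q (semigroup_ft \<nu> \<alpha> \<Omega> t d) < ennreal \<epsilon>"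
    by (auto simp: eventually_at_top_linorder)
  have "pow2 (j * s) * block_norm \<phi> p j (semigroup_ft \<nu> \<alpha> \<Omega> t d) \<le> ennreal \<epsilon>" if "t0 \<le> t" for t j
  proof -
    have "pow2 (j * s) * block_norm \<phi> p j (semigroup_ft \<nu> \<alpha> \<Omega> t d) \<le> FB_norm_ft \<phi> s p q (semigroup_ft \<nu> \<alpha> \<Omega> t d)"
      unfolding FB_norm_ft_eq pow2_def by (rule le_weighted_lq[OF q])
    with t0[OF that] show ?thesis
      by simp
  qed
  then show "\<exists>t0. \<forall>t\<ge>t0. \<forall>j. pow2 (j * s) * block_norm \<phi> p j (semigroup_ft \<nu> \<alpha> \<Omega> t d) \<le> ennreal \<epsilon>"
    by blast
qed

lemma duh_initial_decay:
  assumes V: "admissible V c" and T: "0 \<le> T" and \<epsilon>: "0 < (\<epsilon>::real)"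
  shows "\<exists>t0>T. \<forall>t\<ge>t0. \<forall>j. pow2 (j * s) * block_norm \<phi> p j (duh {0..T} V t) \<le> ennreal \<epsilon>"
proof -
  have Vm: "case_prod V \<in> borel_measurable (lborel \<Otimes>\<^sub>M lborel)" and "c < top"
    and Vb: "AE \<tau> in lborel. 0 \<le> \<tau> \<longrightarrow> (\<forall>j. pow2 (j * r) * block_norm \<phi> p j (V \<tau>) \<le> c)"
    using V by (auto simp: admissible_def)
  then obtain c' where c': "c = ennreal c'" "0 \<le> c'"
    by (cases c) auto
  \<comment> \<open>Obtained by solving
    \<open>heat_const * T * c' / (t - T) \<le> \<epsilon>\<close> for \<open>t\<close>; the added 1
    keeps \<open>t0\<close> beyond \<open>T\<close>.\<close>
  define t0 where "t0 = T + 1 + heat_const * T * c' / \<epsilon>"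
  have t0: "T + 1 \<le> t0"
    using T \<epsilon> c' heat_const_nonneg by (simp add: t0_def)
  have "pow2 (j * s) * block_norm \<phi> p j (duh {0..T} V t) \<le> ennreal \<epsilon>" if t: "t0 \<le> t" for t j
  proof -
    have tT: "T < t"
      using t t0 by linarith
    have "pow2 (j * s) * block_norm \<phi> p j (duh {0..T} V t) \<le> ennreal (heat_const * ((T - 0) / (t - T))) * c"
      by (rule duh_smoothing(2)[OF Vm T less_imp_le[OF tT] _ tT]) (use Vb in \<open>auto elim!: eventually_mono\<close>)
    also have "\<dots> = ennreal (heat_const * (T / (t - T)) * c')"
    proof -
      have "0 \<le> heat_const * (T / (t - T))"
        using heat_const_nonneg T tT by simp
      then show ?thesis
        unfolding c'(1) diff_zero by (rule ennreal_mult[OF _ c'(2), symmetric])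
    qed
    also have "\<dots> \<le> ennreal \<epsilon>"
    proof (rule ennreal_leI)
      have "heat_const * T * c' / \<epsilon> \<le> t - T"
        using t by (simp add: t0_def)
      then have "heat_const * T * c' \<le> \<epsilon> * (t - T)"
        using \<epsilon> by (simp add: pos_divide_le_eq mult.commute)
      then have "heat_const * T * c' / (t - T) \<le> \<epsilon>"
        using tT by (simp add: pos_divide_le_eq)
      then show "heat_const * (T / (t - T)) * c' \<le> \<epsilon>"
        by simp
    qed
    finally show ?thesis .
  qed
  moreover have "T < t0"
    using t0 by linarith
  ultimately show ?thesis
    by blast
qed

text \<open>Time is cut at \<open>b\<close>, after which the forcing is small. The part over [0, b]
  decays as a past window; the part after \<open>b\<close> is small because the smoothing constant
  does not depend on the window. The same constant gives the majorant from the essential suprema of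
  the forcing blocks.\<close>

lemma forcing_tail:
  assumes H: "H \<in> LFB_space \<phi> r p q" and T: "0 \<le> T"
    and lim: "((\<lambda>t. FB_norm \<phi> r p q (H t)) \<longlongrightarrow> 0) at_top"
  shows "(\<lambda>n. Lp_norm (count_space UNIV) q (\<lambda>j. SUP t\<in>{T + real n..}.
    pow2 (j * s) * block_norm \<phi> p j (duh {0..t} (ft_time H) t))) \<longlonglongrightarrow> 0"
proof (rule lq_tail_tendsto_zero[OF q])
  note Vm = ft_time_measurable[OF H]
  let ?h = "\<lambda>j. esssup (lebesgue_on {0..}) (\<lambda>t. block_norm \<phi> p j (ft (H t)))"
  have "pow2 (j * s) * block_norm \<phi> p j (duh {0..t} (ft_time H) t) \<le> ennreal heat_const * (pow2 (j * r) * ?h j)" if "0 \<le> t" for t j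
  proof (rule duh_smoothing(1)[OF Vm that order_refl])
    have "AE t in lborel. 0 \<le> t \<longrightarrow> block_norm \<phi> p j (ft (H t)) \<le> ?h j"
      unfolding AE_time_iff[symmetric] by (rule esssup_AE)
    then show "AE \<tau> in lborel. \<tau> \<in> {0..t} \<longrightarrow> pow2 (j * r) * block_norm \<phi> p j (ft_time H \<tau>) \<le> pow2 (j * r) * ?h j"
      using LFB_ft_time_block[OF H] by eventually_elim (auto intro: mult_left_mono)
  qed
  then have "(SUP t\<in>{T..}. pow2 (j * s) * block_norm \<phi> p j (duh {0..t} (ft_time H) t)) \<le> pow2 (j * r) * (ennreal heat_const * ?h j)" for j
    using T by (intro SUP_least) (auto simp: mult.left_commute)
  then have "Lp_norm (count_space UNIV) q (\<lambda>j. SUP t\<in>{T..}. pow2 (j * s) * block_norm \<phi> p j (duh {0..t} (ft_time H) t)) \<le>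
      weighted_lq q r (\<lambda>j. ennreal heat_const * ?h j)"
    unfolding weighted_lq_def pow2_def[symmetric] by (intro Lp_norm_mono[OF q]) auto
  also have "\<dots> \<le> ennreal heat_const * LFB_norm \<phi> r p q H"
    unfolding LFB_norm_eq by (rule weighted_lq_cmult_le[OF q])
  also have "\<dots> < top"
    using LFB_spaceD(3)[OF H] by (simp add: ennreal_mult_less_top)
  finally show "Lp_norm (count_space UNIV) q (\<lambda>j. SUP t\<in>{T..}. pow2 (j * s) * block_norm \<phi> p j (duh {0..t} (ft_time H) t)) < top" .
  fix \<epsilon> :: real assume \<epsilon>: "0 < \<epsilon>"
  \<comment> \<open>Chosen so that \<open>heat_const * \<delta>\<close> is at most half of
    \<epsilon>; the added 1 keeps the denominator positive.\<close>
  define \<delta> where "\<delta> = \<epsilon> / (2 * (heat_const + 1))"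
  have \<delta>: "0 < \<delta>" "heat_const * \<delta> \<le> \<epsilon> / 2"
    using \<epsilon> heat_const_nonneg by (auto simp: \<delta>_def field_simps)
  have "\<forall>\<^sub>F t in at_top. FB_norm \<phi> r p q (H t) < ennreal \<delta>"
    using \<delta> by (intro order_tendstoD(2)[OF lim]) simp
  then obtain t1 where t1: "\<And>t. t1 \<le> t \<Longrightarrow> FB_norm \<phi> r p q (H t) < ennreal \<delta>"
    by (auto simp: eventually_at_top_linorder)
  define b where "b = max 0 t1"
  have b: "0 \<le> b" "t1 \<le> b"
    by (auto simp: b_def)
  note V = ft_time_admissible[OF H]
  obtain t0 where t0: "b < t0" "\<And>t j. t0 \<le> t \<Longrightarrow> pow2 (j * s) * block_norm \<phi> p j (duh {0..b} (ft_time H) t) \<le> ennreal (\<epsilon> / 2)"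
    using duh_initial_decay[OF V b(1), of "\<epsilon> / 2"] \<epsilon> by auto
  have "pow2 (j * s) * block_norm \<phi> p j (duh {0..t} (ft_time H) t) \<le> ennreal \<epsilon>" if t: "t0 \<le> t" for t j
  proof -
    have bt: "b \<le> t"
      using t t0 by linarith
    note [measurable] = duh_measurable[OF Vm]
    have "block_norm \<phi> p j (duh {0..t} (ft_time H) t) \<le>
        block_norm \<phi> p j (duh {0..b} (ft_time H) t) + block_norm \<phi> p j (duh {b..t} (ft_time H) t)"
      by (rule block_norm_le_add)
        (use duh_split_interval[OF V b(1) bt] in \<open>auto elim!: eventually_mono intro: norm_triangle_ineq\<close>)
    then have "pow2 (j * s) * block_norm \<phi> p j (duh {0..t} (ft_time H) t) \<le>
        pow2 (j * s) * block_norm \<phi> p j (duh {0..b} (ft_time H) t) + pow2 (j * s) * block_norm \<phi> p j (duh {b..t} (ft_time H) t)"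
      unfolding distrib_left[symmetric] by (rule mult_left_mono) simp
    also have "pow2 (j * s) * block_norm \<phi> p j (duh {b..t} (ft_time H) t) \<le> ennreal heat_const * ennreal \<delta>"
    proof (rule duh_smoothing(1)[OF Vm bt order_refl])
      show "AE \<tau> in lborel. \<tau> \<in> {b..t} \<longrightarrow> pow2 (j * r) * block_norm \<phi> p j (ft_time H \<tau>) \<le> ennreal \<delta>"
        using LFB_ft_time_block[OF H]
      proof (eventually_elim, intro impI)
        fix \<tau> assume \<tau>: "0 \<le> \<tau> \<longrightarrow> (\<forall>j. block_norm \<phi> p j (ft_time H \<tau>) = block_norm \<phi> p j (ft (H \<tau>)))" "\<tau> \<in> {b..t}"
        have "pow2 (j * r) * block_norm \<phi> p j (ft (H \<tau>)) \<le> FB_norm \<phi> r p q (H \<tau>)"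
          unfolding FB_norm_def FB_norm_ft_eq pow2_def by (rule le_weighted_lq[OF q])
        also have "\<dots> \<le> ennreal \<delta>"
          using t1[of \<tau>] \<tau> b by auto
        finally show "pow2 (j * r) * block_norm \<phi> p j (ft_time H \<tau>) \<le> ennreal \<delta>"
          using \<tau> b by auto
      qed
    qed
    also have "pow2 (j * s) * block_norm \<phi> p j (duh {0..b} (ft_time H) t) \<le> ennreal (\<epsilon> / 2)"
      by (rule t0(2)[OF t])
    also have "ennreal heat_const * ennreal \<delta> = ennreal (heat_const * \<delta>)"
      using heat_const_nonneg \<delta> by (simp add: ennreal_mult)
    also have "ennreal (\<epsilon> / 2) + ennreal (heat_const * \<delta>) \<le> ennreal (\<epsilon> / 2) + ennreal (\<epsilon> / 2)"
      using \<delta> by (intro add_left_mono ennreal_leI)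
    also have "\<dots> = ennreal \<epsilon>"
      using \<epsilon> by (simp flip: ennreal_plus)
    finally show ?thesis
      by (simp add: add_mono)
  qed
  then show "\<exists>t0. \<forall>t\<ge>t0. \<forall>j. pow2 (j * s) * block_norm \<phi> p j (duh {0..t} (ft_time H) t) \<le> ennreal \<epsilon>"
    by blast
qed

lemma div_tensor_ft_diff:
  assumes u: "u \<in> LFB_space \<phi> s p q" and v: "v \<in> LFB_space \<phi> s p q"
  defines "w \<equiv> \<lambda>t. u t - v t"
  shows "AE \<tau> in lborel. 0 \<le> \<tau> \<longrightarrow> (AE \<xi> in lborel. div_tensor_ft u u \<tau> \<xi> =
    div_tensor_ft v v \<tau> \<xi> + (div_tensor_ft w u \<tau> \<xi> + div_tensor_ft v w \<tau> \<xi>))"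
  using ft_time_minus[OF u v] nnconv_ft_time_finite[OF u u] nnconv_ft_time_finite[OF v u] nnconv_ft_time_finite[OF v v]
proof (eventually_elim, intro impI)
  fix \<tau> :: real assume \<tau>: "0 \<le> \<tau>"
    and w: "0 \<le> \<tau> \<longrightarrow> (AE \<xi> in lborel. ft_time (\<lambda>t. u t - v t) \<tau> \<xi> = ft_time u \<tau> \<xi> - ft_time v \<tau> \<xi>)"
    and fin: "0 \<le> \<tau> \<longrightarrow> (AE \<xi> in lborel. nnconv (\<lambda>\<eta>. ennreal (norm (ft_time u \<tau> \<eta>))) (\<lambda>\<eta>. ennreal (norm (ft_time u \<tau> \<eta>))) \<xi> < top)"
      "0 \<le> \<tau> \<longrightarrow> (AE \<xi> in lborel. nnconv (\<lambda>\<eta>. ennreal (norm (ft_time v \<tau> \<eta>))) (\<lambda>\<eta>. ennreal (norm (ft_time u \<tau> \<eta>))) \<xi> < top)"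
      "0 \<le> \<tau> \<longrightarrow> (AE \<xi> in lborel. nnconv (\<lambda>\<eta>. ennreal (norm (ft_time v \<tau> \<eta>))) (\<lambda>\<eta>. ennreal (norm (ft_time v \<tau> \<eta>))) \<xi> < top)"
  show "AE \<xi> in lborel. div_tensor_ft u u \<tau> \<xi> =
    div_tensor_ft v v \<tau> \<xi> + (div_tensor_ft w u \<tau> \<xi> + div_tensor_ft v w \<tau> \<xi>)"
    using fin(1)[rule_format, OF \<tau>] fin(2)[rule_format, OF \<tau>] fin(3)[rule_format, OF \<tau>]
  proof eventually_elim
    case (elim \<xi>)
    show ?case
      unfolding div_tensor_ft_eq w_def
      by (rule div_tensor_diff[OF _ _ _ w[rule_format, OF \<tau>] elim])
        (use ft_time_measurable'[OF u] ft_time_measurable'[OF v] ft_time_measurable'[OF LFB_space_minus[OF u v]] in auto)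
  qed
qed

text \<open>\<open>ft_time\<close> chooses a representative for the cut-off function anew.
  Uniqueness of the transform relates it to the truncated representative of \<open>w\<close>, up to
  null sets.\<close>

lemma ft_time_split_zero:
  assumes w: "w \<in> LFB_space \<phi> s p q" and u: "u \<in> LFB_space \<phi> s p q"
  shows "AE \<tau> in lborel. 0 \<le> \<tau> \<longrightarrow> (AE \<xi> in lborel.
    ft_time (\<lambda>t. if T \<le> t then w t else u t - u t) \<tau> \<xi> = (if T \<le> \<tau> then ft_time w \<tau> \<xi> else 0))"
  using ft_time_has_ft[OF LFB_space_split[OF w LFB_space_minus[OF u u], of T]] ft_time_has_ft[OF w]
proof (eventually_elim, intro impI)
  fix \<tau> :: real assume \<tau>: "0 \<le> \<tau>"
    and h: "0 \<le> \<tau> \<longrightarrow> has_ft (if T \<le> \<tau> then w \<tau> else u \<tau> - u \<tau>) (ft_time (\<lambda>t. if T \<le> t then w t else u t - u t) \<tau>)"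
      "0 \<le> \<tau> \<longrightarrow> has_ft (w \<tau>) (ft_time w \<tau>)"
  show "AE \<xi> in lborel. ft_time (\<lambda>t. if T \<le> t then w t else u t - u t) \<tau> \<xi> = (if T \<le> \<tau> then ft_time w \<tau> \<xi> else 0)"
  proof (cases "T \<le> \<tau>")
    case True
    then show ?thesis
      using h \<tau> by (auto intro: has_ft_unique[OF cutoff])
  next
    case False
    have "has_ft (u \<tau> - u \<tau>) (\<lambda>\<xi>. ft (u \<tau>) \<xi> - ft (u \<tau>) \<xi>)"
      using FB_space_has_ft[OF LFB_spaceD(1)[OF u \<tau>]] by (intro has_ft_minus)
    then have "has_ft (u \<tau> - u \<tau>) (\<lambda>\<xi>. 0)"
      by simp
    then show ?thesis
      using h(1) \<tau> False by (auto intro: has_ft_unique[OF cutoff])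
  qed
qed

lemma div_tensor_ft_split_zero:
  fixes T :: real
  assumes w: "w \<in> LFB_space \<phi> s p q" and u: "u \<in> LFB_space \<phi> s p q"
  defines "w' \<equiv> \<lambda>t. if T \<le> t then w t else u t - u t"
  assumes v: "v \<in> LFB_space \<phi> s p q"
  shows "AE \<tau> in lborel. 0 \<le> \<tau> \<longrightarrow> (AE \<xi> in lborel. div_tensor_ft w' v \<tau> \<xi> = (if T \<le> \<tau> then div_tensor_ft w v \<tau> \<xi> else 0))"
    and "AE \<tau> in lborel. 0 \<le> \<tau> \<longrightarrow> (AE \<xi> in lborel. div_tensor_ft v w' \<tau> \<xi> = (if T \<le> \<tau> then div_tensor_ft v w \<tau> \<xi> else 0))"
proof -
  have w': "w' \<in> LFB_space \<phi> s p q"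
    unfolding w'_def by (intro LFB_space_split LFB_space_minus w u)
  note [measurable] = ft_time_measurable'[OF w] ft_time_measurable'[OF w'] ft_time_measurable'[OF v]
  note ae = ft_time_split_zero[OF w u, of T, folded w'_def]
  have eq: "AE \<tau> in lborel. 0 \<le> \<tau> \<longrightarrow> (\<forall>\<xi>. div_tensor_ft w' v \<tau> \<xi> = (if T \<le> \<tau> then div_tensor_ft w v \<tau> \<xi> else 0) \<and>
      div_tensor_ft v w' \<tau> \<xi> = (if T \<le> \<tau> then div_tensor_ft v w \<tau> \<xi> else 0))"
    using ae
  proof (eventually_elim, intro impI allI)
    fix \<tau> :: real and \<xi> assume \<tau>: "0 \<le> \<tau>" "0 \<le> \<tau> \<longrightarrow> (AE \<xi> in lborel. ft_time w' \<tau> \<xi> = (if T \<le> \<tau> then ft_time w \<tau> \<xi> else 0))"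
    define h where "h = (\<lambda>\<xi>. if T \<le> \<tau> then ft_time w \<tau> \<xi> else 0)"
    have [measurable]: "h \<in> borel_measurable borel"
      unfolding h_def by measurable
    have h: "AE \<xi> in lborel. ft_time w' \<tau> \<xi> = h \<xi>"
      using \<tau> by (simp add: h_def)
    have "div_tensor (ft_time w' \<tau>) (ft_time v \<tau>) \<xi> = div_tensor h (ft_time v \<tau>) \<xi>"
      "div_tensor (ft_time v \<tau>) (ft_time w' \<tau>) \<xi> = div_tensor (ft_time v \<tau>) h \<xi>"
      using h by (intro div_tensor_cong_AE; simp)+
    then show "div_tensor_ft w' v \<tau> \<xi> = (if T \<le> \<tau> then div_tensor_ft w v \<tau> \<xi> else 0) \<and>
      div_tensor_ft v w' \<tau> \<xi> = (if T \<le> \<tau> then div_tensor_ft v w \<tau> \<xi> else 0)"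
      unfolding div_tensor_ft_eq by (simp add: h_def)
  qed
  then show "AE \<tau> in lborel. 0 \<le> \<tau> \<longrightarrow> (AE \<xi> in lborel. div_tensor_ft w' v \<tau> \<xi> = (if T \<le> \<tau> then div_tensor_ft w v \<tau> \<xi> else 0))"
    by eventually_elim simp
  from eq show "AE \<tau> in lborel. 0 \<le> \<tau> \<longrightarrow> (AE \<xi> in lborel. div_tensor_ft v w' \<tau> \<xi> = (if T \<le> \<tau> then div_tensor_ft v w \<tau> \<xi> else 0))"
    by eventually_elim simp
qed

end

section \<open>Asymptotic stability\<close>

text \<open>Two solutions for one fixed \<Omega>. The bound 1/(4K) is 2\<epsilon> with \<epsilon> =
  1/(8K).\<close>

locale mild_pair = duhamel +
  fixes K :: real and u0 v0 :: tdist and F G u v :: "real \<Rightarrow> tdist"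
  assumes K: "0 < K"
    and bilinear: "\<And>a b. a \<in> LFB_space \<phi> s p q \<Longrightarrow> b \<in> LFB_space \<phi> s p q \<Longrightarrow>
      LFB_norm_ft \<phi> s p q (bilinear_ft \<nu> \<alpha> \<Omega> a b) \<le> ennreal K * LFB_norm \<phi> s p q a * LFB_norm \<phi> s p q b"
    and u0: "u0 \<in> FB_space \<phi> s p q" and v0: "v0 \<in> FB_space \<phi> s p q"
    and F: "F \<in> LFB_space \<phi> r p q" and G: "G \<in> LFB_space \<phi> r p q"
    and u: "u \<in> LFB_space \<phi> s p q" and v: "v \<in> LFB_space \<phi> s p q"
    and u_small: "LFB_norm \<phi> s p q u \<le> ennreal (1 / (4 * K))" and v_small: "LFB_norm \<phi> s p q v \<le> ennreal (1 / (4 * K))"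
    and u_mild: "mild_solution \<nu> \<alpha> \<Omega> u0 F u" and v_mild: "mild_solution \<nu> \<alpha> \<Omega> v0 G v"
    and data_lim: "((\<lambda>t. FB_norm_ft \<phi> s p q (semigroup_ft \<nu> \<alpha> \<Omega> t (u0 - v0))) \<longlongrightarrow> 0) at_top"
    and force_lim: "((\<lambda>t. FB_norm \<phi> r p q (F t - G t)) \<longlongrightarrow> 0) at_top"
begin

definition w :: "real \<Rightarrow> tdist" where
  "w t = u t - v t"

text \<open>The only operation declared on \<open>tdist\<close> is subtraction, so
  \<open>u t - u t\<close> stands for the zero distribution; written this way it is the difference
  of two members of the space.\<close>

definition late :: "real \<Rightarrow> real \<Rightarrow> tdist" where
  "late T t = (if T \<le> t then w t else u t - u t)"

definition H :: "real \<Rightarrow> tdist" where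
  "H t = F t - G t"

lemma w_LFB: "w \<in> LFB_space \<phi> s p q"
  unfolding w_def[abs_def] by (rule LFB_space_minus[OF u v])

lemma late_LFB: "late T \<in> LFB_space \<phi> s p q"
  unfolding late_def[abs_def] by (intro LFB_space_split LFB_space_minus w_LFB u)

lemma H_LFB: "H \<in> LFB_space \<phi> r p q"
  unfolding H_def[abs_def] by (rule LFB_space_minus[OF F G])

text \<open>Only the factor \<open>w\<close> is cut in time. The factors \<open>u\<close> and
  \<open>v\<close> stay whole, so their smallness on the half-line applies as it stands.\<close>

lemma difference_equation:
  assumes T: "0 \<le> T" "T \<le> t"
  shows "AE \<xi> in lborel. ft (w t) \<xi> = semigroup_ft \<nu> \<alpha> \<Omega> t (u0 - v0) \<xi> + (duh {0..t} (ft_time H) t \<xi> +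
    - ((duh {0..T} (div_tensor_ft w u) t \<xi> + duh {0..t} (div_tensor_ft (late T) u) t \<xi>) +
       (duh {0..T} (div_tensor_ft v w) t \<xi> + duh {0..t} (div_tensor_ft v (late T)) t \<xi>)))"
proof -
  have t: "0 \<le> t"
    using T by linarith
  obtain c1 where uu: "admissible (div_tensor_ft u u) c1"
    by (rule div_tensor_ft_admissible[OF u u])
  obtain c2 where vv: "admissible (div_tensor_ft v v) c2"
    by (rule div_tensor_ft_admissible[OF v v])
  obtain c3 where wu: "admissible (div_tensor_ft w u) c3"
    by (rule div_tensor_ft_admissible[OF w_LFB u])
  obtain c4 where vw: "admissible (div_tensor_ft v w) c4"
    by (rule div_tensor_ft_admissible[OF v w_LFB])
  obtain c5 where lu: "admissible (div_tensor_ft (late T) u) c5"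
    by (rule div_tensor_ft_admissible[OF late_LFB u])
  obtain c6 where vl: "admissible (div_tensor_ft v (late T)) c6"
    by (rule div_tensor_ft_admissible[OF v late_LFB])
  have e1: "AE \<xi> in lborel. \<forall>t. duh {0..t} (div_tensor_ft u u) t \<xi> = duh {0..t} (div_tensor_ft v v) t \<xi> +
      duh {0..t} (\<lambda>\<tau> \<xi>. div_tensor_ft w u \<tau> \<xi> + div_tensor_ft v w \<tau> \<xi>) t \<xi>"
    by (rule duh_add[OF uu vv admissible_add[OF wu vw] div_tensor_ft_diff[OF u v, folded w_def]])
  have e2: "AE \<xi> in lborel. \<forall>t. duh {0..t} (\<lambda>\<tau> \<xi>. div_tensor_ft w u \<tau> \<xi> + div_tensor_ft v w \<tau> \<xi>) t \<xi> =
      duh {0..t} (div_tensor_ft w u) t \<xi> + duh {0..t} (div_tensor_ft v w) t \<xi>"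
    by (rule duh_add[OF admissible_add[OF wu vw] wu vw]) simp
  have e3: "AE \<xi> in lborel. duh {0..t} (div_tensor_ft w u) t \<xi> = duh {0..T} (div_tensor_ft w u) t \<xi> + duh {0..t} (div_tensor_ft (late T) u) t \<xi>"
    by (rule duh_split[OF wu lu T]) (unfold late_def[abs_def], rule div_tensor_ft_split_zero(1)[OF w_LFB u u])
  have e4: "AE \<xi> in lborel. duh {0..t} (div_tensor_ft v w) t \<xi> = duh {0..T} (div_tensor_ft v w) t \<xi> + duh {0..t} (div_tensor_ft v (late T)) t \<xi>"
    by (rule duh_split[OF vw vl T]) (unfold late_def[abs_def], rule div_tensor_ft_split_zero(2)[OF w_LFB u v])
  have e5: "AE \<xi> in lborel. \<forall>t. duh {0..t} (ft_time F) t \<xi> = duh {0..t} (ft_time G) t \<xi> + duh {0..t} (ft_time H) t \<xi>"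
  proof (rule duh_add[OF ft_time_admissible[OF F] ft_time_admissible[OF G] ft_time_admissible[OF H_LFB]])
    show "AE \<tau> in lborel. 0 \<le> \<tau> \<longrightarrow> (AE \<xi> in lborel. ft_time F \<tau> \<xi> = ft_time G \<tau> \<xi> + ft_time H \<tau> \<xi>)"
      using ft_time_minus[OF F G, folded H_def] by eventually_elim (auto elim!: eventually_mono)
  qed
  note e6 = ft_minus_AE[OF u0 v0]
  note e7 = ft_minus_AE[OF LFB_spaceD(1)[OF u t] LFB_spaceD(1)[OF v t], folded w_def]
  have e8: "AE \<xi> in lborel. ft (u t) \<xi> = semigroup_ft \<nu> \<alpha> \<Omega> t u0 \<xi> + bilinear_ft \<nu> \<alpha> \<Omega> u u t \<xi> + forcing_ft \<nu> \<alpha> \<Omega> F t \<xi>"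
    using u_mild t by (simp add: mild_solution_def)
  have e9: "AE \<xi> in lborel. ft (v t) \<xi> = semigroup_ft \<nu> \<alpha> \<Omega> t v0 \<xi> + bilinear_ft \<nu> \<alpha> \<Omega> v v t \<xi> + forcing_ft \<nu> \<alpha> \<Omega> G t \<xi>"
    using v_mild t by (simp add: mild_solution_def)
  show ?thesis
    using e1 e2 e3 e4 e5 e6 e7 e8 e9
  proof eventually_elim
    case (elim \<xi>)
    have S: "semigroup_ft \<nu> \<alpha> \<Omega> t (u0 - v0) \<xi> = semigroup_ft \<nu> \<alpha> \<Omega> t u0 \<xi> - semigroup_ft \<nu> \<alpha> \<Omega> t v0 \<xi>"
      by (simp add: semigroup_ft_def elim(6) mat_apply_diff)
    show ?case
      unfolding elim(7) elim(8) elim(9) S bilinear_ft_eq_duh forcing_ft_eq_duh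
        elim(1)[rule_format] elim(2)[rule_format] elim(3) elim(4) elim(5)[rule_format]
      by (simp add: algebra_simps)
  qed
qed

section \<open>The contributions to the difference of the solutions\<close>

definition data_term :: "int \<Rightarrow> real \<Rightarrow> ennreal" where
  "data_term j t = pow2 (j * s) * block_norm \<phi> p j (semigroup_ft \<nu> \<alpha> \<Omega> t (u0 - v0))"

definition force_term :: "int \<Rightarrow> real \<Rightarrow> ennreal" where
  "force_term j t = pow2 (j * s) * block_norm \<phi> p j (duh {0..t} (ft_time H) t)"

definition early_term :: "(real \<Rightarrow> tdist) \<Rightarrow> (real \<Rightarrow> tdist) \<Rightarrow> real \<Rightarrow> int \<Rightarrow> real \<Rightarrow> ennreal" where
  "early_term a b T j t = pow2 (j * s) * block_norm \<phi> p j (duh {0..T} (div_tensor_ft a b) t)"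

text \<open>There is no time argument: the essential suprema bound the late integrals at every time.
  This contribution is absorbed by its factor 1/2 and need not decay.\<close>

definition late_term :: "real \<Rightarrow> int \<Rightarrow> ennreal" where
  "late_term T j = pow2 (j * s) * bilinear_sup (late T) u j + pow2 (j * s) * bilinear_sup v (late T) j"

lemma block_norm_w_le:
  assumes T: "0 \<le> T" "T \<le> t"
  shows "pow2 (j * s) * block_norm \<phi> p j (ft (w t)) \<le>
    data_term j t + force_term j t + early_term w u T j t + early_term v w T j t + late_term T j"
proof -
  have t: "0 \<le> t"
    using T by linarith
  note m = div_tensor_ft_measurable
  note [measurable] = duh_measurable[OF ft_time_measurable[OF H_LFB]] duh_measurable[OF m[OF w_LFB u]]
    duh_measurable[OF m[OF late_LFB u]] duh_measurable[OF m[OF v w_LFB]] duh_measurable[OF m[OF v late_LFB]]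
    semigroup_ft_measurable[OF FB_space_ft_measurable[OF FB_space_minus[OF u0 v0]]]
  let ?S = "semigroup_ft \<nu> \<alpha> \<Omega> t (u0 - v0)" and ?H = "duh {0..t} (ft_time H) t"
  let ?a = "duh {0..T} (div_tensor_ft w u) t" and ?b = "duh {0..t} (div_tensor_ft (late T) u) t"
  let ?c = "duh {0..T} (div_tensor_ft v w) t" and ?d = "duh {0..t} (div_tensor_ft v (late T)) t"
  have "block_norm \<phi> p j (ft (w t)) = block_norm \<phi> p j (\<lambda>\<xi>. ?S \<xi> + (?H \<xi> + - ((?a \<xi> + ?b \<xi>) + (?c \<xi> + ?d \<xi>))))"
    by (rule block_norm_cong_AE[OF FB_space_ft_measurable[OF LFB_spaceD(1)[OF w_LFB t]] _ difference_equation[OF T]]) measurable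
  also have "\<dots> \<le> block_norm \<phi> p j ?S + block_norm \<phi> p j (\<lambda>\<xi>. ?H \<xi> + - ((?a \<xi> + ?b \<xi>) + (?c \<xi> + ?d \<xi>)))"
    by (rule block_norm_add) measurable
  also have "block_norm \<phi> p j (\<lambda>\<xi>. ?H \<xi> + - ((?a \<xi> + ?b \<xi>) + (?c \<xi> + ?d \<xi>))) \<le>
      block_norm \<phi> p j ?H + block_norm \<phi> p j (\<lambda>\<xi>. - ((?a \<xi> + ?b \<xi>) + (?c \<xi> + ?d \<xi>)))"
    by (rule block_norm_add) measurable
  also have "block_norm \<phi> p j (\<lambda>\<xi>. - ((?a \<xi> + ?b \<xi>) + (?c \<xi> + ?d \<xi>))) = block_norm \<phi> p j (\<lambda>\<xi>. (?a \<xi> + ?b \<xi>) + (?c \<xi> + ?d \<xi>))"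
    by (rule block_norm_uminus)
  also have "\<dots> \<le> block_norm \<phi> p j (\<lambda>\<xi>. ?a \<xi> + ?b \<xi>) + block_norm \<phi> p j (\<lambda>\<xi>. ?c \<xi> + ?d \<xi>)"
    by (rule block_norm_add) measurable
  also have "block_norm \<phi> p j (\<lambda>\<xi>. ?a \<xi> + ?b \<xi>) \<le> block_norm \<phi> p j ?a + block_norm \<phi> p j ?b"
    by (rule block_norm_add) measurable
  also have "block_norm \<phi> p j (\<lambda>\<xi>. ?c \<xi> + ?d \<xi>) \<le> block_norm \<phi> p j ?c + block_norm \<phi> p j ?d"
    by (rule block_norm_add) measurable
  also have "block_norm \<phi> p j ?b \<le> bilinear_sup (late T) u j"
    by (rule bilinear_sup_bound[OF late_LFB u t])
  also have "block_norm \<phi> p j ?d \<le> bilinear_sup v (late T) j"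
    by (rule bilinear_sup_bound[OF v late_LFB t])
  finally have "block_norm \<phi> p j (ft (w t)) \<le> block_norm \<phi> p j ?S + (block_norm \<phi> p j ?H +
      (block_norm \<phi> p j ?a + bilinear_sup (late T) u j + (block_norm \<phi> p j ?c + bilinear_sup v (late T) j)))"
    by (simp add: add_mono)
  then have "pow2 (j * s) * block_norm \<phi> p j (ft (w t)) \<le> pow2 (j * s) * (block_norm \<phi> p j ?S + (block_norm \<phi> p j ?H +
      (block_norm \<phi> p j ?a + bilinear_sup (late T) u j + (block_norm \<phi> p j ?c + bilinear_sup v (late T) j))))"
    by (rule mult_left_mono) simp
  then show ?thesis
    by (simp add: data_term_def force_term_def early_term_def late_term_def distrib_left add_ac)
qed

abbreviation lq :: "(int \<Rightarrow> ennreal) \<Rightarrow> ennreal" where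
  "lq \<equiv> Lp_norm (count_space UNIV) q"

lemma lq_bilinear_sup:
  assumes "a \<in> LFB_space \<phi> s p q" "b \<in> LFB_space \<phi> s p q"
  shows "lq (\<lambda>j. pow2 (j * s) * bilinear_sup a b j) \<le> ennreal K * LFB_norm \<phi> s p q a * LFB_norm \<phi> s p q b"
  using bilinear[OF assms] unfolding LFB_norm_ft_eq weighted_lq_def pow2_def bilinear_sup_def .

lemma lq_bilinear_sup_finite:
  assumes "a \<in> LFB_space \<phi> s p q" "b \<in> LFB_space \<phi> s p q"
  shows "lq (\<lambda>j. pow2 (j * s) * bilinear_sup a b j) < top"
  using LFB_spaceD(3)[OF assms(1)] LFB_spaceD(3)[OF assms(2)]
  by (intro le_less_trans[OF lq_bilinear_sup[OF assms]]) (simp add: ennreal_mult_less_top)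

text \<open>Uniform decay alone does not control an l^q norm for finite \<open>q\<close>. The
  majorant comes from writing the integral over [0, T] as the complete integral minus the late one,
  both controlled by the assumed estimate. The pair \<open>a'\<close>, \<open>b'\<close> stands for
  the late integrand, so that the cut may fall on either factor.\<close>

lemma early_tail:
  assumes a: "a \<in> LFB_space \<phi> s p q" "b \<in> LFB_space \<phi> s p q" and a': "a' \<in> LFB_space \<phi> s p q" "b' \<in> LFB_space \<phi> s p q"
    and T: "0 \<le> T"
    and eq: "AE \<tau> in lborel. 0 \<le> \<tau> \<longrightarrow> (AE \<xi> in lborel. div_tensor_ft a' b' \<tau> \<xi> = (if T \<le> \<tau> then div_tensor_ft a b \<tau> \<xi> else 0))"
  shows "(\<lambda>n. lq (\<lambda>j. SUP t\<in>{T + real n..}. early_term a b T j t)) \<longlonglongrightarrow> 0"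
proof (rule lq_tail_tendsto_zero[OF q])
  obtain c where c: "admissible (div_tensor_ft a b) c"
    by (rule div_tensor_ft_admissible[OF a])
  obtain c' where c': "admissible (div_tensor_ft a' b') c'"
    by (rule div_tensor_ft_admissible[OF a'])
  note [measurable] = duh_measurable[OF div_tensor_ft_measurable[OF a]] duh_measurable[OF div_tensor_ft_measurable[OF a']]
  have "early_term a b T j t \<le> pow2 (j * s) * bilinear_sup a b j + pow2 (j * s) * bilinear_sup a' b' j" if t: "T \<le> t" for j t
  proof -
    have t0: "0 \<le> t"
      using t T by linarith
    have "block_norm \<phi> p j (duh {0..T} (div_tensor_ft a b) t) \<le>
        block_norm \<phi> p j (duh {0..t} (div_tensor_ft a b) t) + block_norm \<phi> p j (duh {0..t} (div_tensor_ft a' b') t)"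
    proof (rule block_norm_le_add)
      show "AE \<xi> in lborel. norm (duh {0..T} (div_tensor_ft a b) t \<xi>) \<le>
          norm (duh {0..t} (div_tensor_ft a b) t \<xi>) + norm (duh {0..t} (div_tensor_ft a' b') t \<xi>)"
        using duh_split[OF c c' T t eq]
      proof eventually_elim
        case (elim \<xi>)
        then show ?case
          using norm_triangle_ineq4[of "duh {0..t} (div_tensor_ft a b) t \<xi>" "duh {0..t} (div_tensor_ft a' b') t \<xi>"] by simp
      qed
    qed measurable
    also have "\<dots> \<le> bilinear_sup a b j + bilinear_sup a' b' j"
      by (intro add_mono bilinear_sup_bound a a' t0)
    finally show ?thesis
      unfolding early_term_def distrib_left[symmetric] by (rule mult_left_mono) simp
  qed
  then have "lq (\<lambda>j. SUP t\<in>{T..}. early_term a b T j t) \<le> lq (\<lambda>j. pow2 (j * s) * bilinear_sup a b j + pow2 (j * s) * bilinear_sup a' b' j)"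
    by (intro Lp_norm_mono[OF q] SUP_least) auto
  also have "\<dots> \<le> lq (\<lambda>j. pow2 (j * s) * bilinear_sup a b j) + lq (\<lambda>j. pow2 (j * s) * bilinear_sup a' b' j)"
    by (rule lq_add[OF q])
  also have "\<dots> < top"
    using lq_bilinear_sup_finite[OF a] lq_bilinear_sup_finite[OF a'] by simp
  finally show "lq (\<lambda>j. SUP t\<in>{T..}. early_term a b T j t) < top" .
  show "\<exists>t0. \<forall>t\<ge>t0. \<forall>j. early_term a b T j t \<le> ennreal \<epsilon>" if "0 < \<epsilon>" for \<epsilon>
    using duh_initial_decay[OF c T that] unfolding early_term_def by blast
qed

definition remainder :: "real \<Rightarrow> nat \<Rightarrow> ennreal" where
  "remainder T n = lq (\<lambda>j. SUP t\<in>{T + real n..}. data_term j t) + lq (\<lambda>j. SUP t\<in>{T + real n..}. force_term j t) +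
     lq (\<lambda>j. SUP t\<in>{T + real n..}. early_term w u T j t) + lq (\<lambda>j. SUP t\<in>{T + real n..}. early_term v w T j t)"

lemma remainder_tendsto_zero:
  assumes T: "0 \<le> T"
  shows "remainder T \<longlonglongrightarrow> 0"
proof -
  have 1: "(\<lambda>n. lq (\<lambda>j. SUP t\<in>{T + real n..}. data_term j t)) \<longlonglongrightarrow> 0"
    unfolding data_term_def by (rule semigroup_tail[OF FB_space_minus[OF u0 v0] T data_lim])
  have 2: "(\<lambda>n. lq (\<lambda>j. SUP t\<in>{T + real n..}. force_term j t)) \<longlonglongrightarrow> 0"
    unfolding force_term_def using force_lim by (intro forcing_tail[OF H_LFB T]) (simp add: H_def)
  have 3: "(\<lambda>n. lq (\<lambda>j. SUP t\<in>{T + real n..}. early_term w u T j t)) \<longlonglongrightarrow> 0"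
    by (rule early_tail[OF w_LFB u late_LFB u T, unfolded late_def[abs_def]])
      (rule div_tensor_ft_split_zero(1)[OF w_LFB u u])
  have 4: "(\<lambda>n. lq (\<lambda>j. SUP t\<in>{T + real n..}. early_term v w T j t)) \<longlonglongrightarrow> 0"
    by (rule early_tail[OF v w_LFB v late_LFB T, unfolded late_def[abs_def]])
      (rule div_tensor_ft_split_zero(2)[OF w_LFB u v])
  have "remainder T \<longlonglongrightarrow> 0 + 0 + 0 + 0"
    unfolding remainder_def[abs_def] by (intro tendsto_add 1 2 3 4)
  then show ?thesis
    by simp
qed

lemma lq_late_term: "lq (late_term T) \<le> ennreal (1/2) * LFB_norm \<phi> s p q (late T)"
proof -
  have K4: "ennreal K * ennreal (1 / (4 * K)) = ennreal (1/4)"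
    using K by (simp flip: ennreal_mult)
  have "lq (late_term T) \<le> lq (\<lambda>j. pow2 (j * s) * bilinear_sup (late T) u j) + lq (\<lambda>j. pow2 (j * s) * bilinear_sup v (late T) j)"
    unfolding late_term_def[abs_def] by (rule lq_add[OF q])
  also have "\<dots> \<le> ennreal K * LFB_norm \<phi> s p q (late T) * LFB_norm \<phi> s p q u + ennreal K * LFB_norm \<phi> s p q v * LFB_norm \<phi> s p q (late T)"
    by (intro add_mono lq_bilinear_sup late_LFB u v)
  also have "\<dots> \<le> ennreal K * LFB_norm \<phi> s p q (late T) * ennreal (1 / (4 * K)) + ennreal K * ennreal (1 / (4 * K)) * LFB_norm \<phi> s p q (late T)"
    by (intro add_mono mult_mono u_small v_small) auto
  also have "\<dots> = (ennreal K * ennreal (1 / (4 * K)) + ennreal K * ennreal (1 / (4 * K))) * LFB_norm \<phi> s p q (late T)"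
    unfolding distrib_right by (simp only: mult_ac)
  also have "\<dots> = ennreal (1/2) * LFB_norm \<phi> s p q (late T)"
    unfolding K4 by (simp flip: ennreal_plus)
  finally show ?thesis .
qed

section \<open>Contraction of the late norms and conclusion\<close>

definition majorant :: "real \<Rightarrow> nat \<Rightarrow> int \<Rightarrow> ennreal" where
  "majorant T n j = (SUP t\<in>{T + real n..}. data_term j t) + (SUP t\<in>{T + real n..}. force_term j t) +
    (SUP t\<in>{T + real n..}. early_term w u T j t) + (SUP t\<in>{T + real n..}. early_term v w T j t) + late_term T j"

lemma block_norm_w_le_majorant:
  assumes T: "0 \<le> T" "T + real n \<le> t"
  shows "pow2 (j * s) * block_norm \<phi> p j (ft (w t)) \<le> majorant T n j"
proof -
  have "T \<le> t"
    using T by linarith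
  from block_norm_w_le[OF T(1) this, of j] show ?thesis
    unfolding majorant_def
    by (rule order_trans) (use T(2) in \<open>intro add_mono order_refl SUP_upper; simp\<close>)
qed

lemma lq_majorant: "lq (majorant T n) \<le> remainder T n + ennreal (1/2) * LFB_norm \<phi> s p q (late T)"
  unfolding majorant_def[abs_def] remainder_def
  by (intro order_trans[OF lq_add[OF q]] add_mono lq_late_term order_refl)

lemma FB_norm_w_le:
  assumes T: "0 \<le> T" "T + real n \<le> t"
  shows "FB_norm \<phi> s p q (w t) \<le> remainder T n + ennreal (1/2) * LFB_norm \<phi> s p q (late T)"
proof -
  have "FB_norm \<phi> s p q (w t) \<le> lq (majorant T n)"
    unfolding FB_norm_def FB_norm_ft_eq weighted_lq_def
    using block_norm_w_le_majorant[OF T] by (intro Lp_norm_mono[OF q]) (auto simp: pow2_def)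
  also note lq_majorant
  finally show ?thesis .
qed

lemma late_contraction:
  assumes T: "0 \<le> T"
  shows "LFB_norm \<phi> s p q (late (T + real n)) \<le> remainder T n + ennreal (1/2) * LFB_norm \<phi> s p q (late T)"
\<comment> \<open>\<open>LFB_spaceI\<close> needs a finite majorant; if it is infinite, so is the
  right-hand side of the claim.\<close>
proof (cases "lq (majorant T n) < top")
  case True
  let ?b = "\<lambda>j. pow2 (- (j * s)) * majorant T n j"
  have b: "weighted_lq q s ?b = lq (majorant T n)"
    unfolding weighted_lq_def pow2_def[symmetric] by (simp add: pow2_mult_left)
  have "LFB_norm \<phi> s p q (late (T + real n)) \<le> weighted_lq q s ?b"
  proof (rule LFB_spaceI(2))
    show "late (T + real n) t \<in> FB_space \<phi> s p q" if "0 \<le> t" for t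
      using that by (rule LFB_spaceD(1)[OF late_LFB])
    show "bochner_measurable_FB \<phi> s p q (late (T + real n))"
      by (rule LFB_spaceD(2)[OF late_LFB])
    show "AE t in lebesgue_on {0..}. block_norm \<phi> p j (ft (late (T + real n) t)) \<le> ?b j" for j
      unfolding AE_time_iff
    proof (intro AE_I2 impI)
      fix t :: real assume t: "0 \<le> t"
      show "block_norm \<phi> p j (ft (late (T + real n) t)) \<le> ?b j"
      proof (cases "T + real n \<le> t")
        case True
        then show ?thesis
          using block_norm_w_le_majorant[OF T True, of j] by (simp add: late_def pow2_le_swap)
      next
        case False
        have "block_norm \<phi> p j (\<lambda>\<xi>. 0) = 0"
          unfolding block_norm_eq block_def by (subst Lp_norm_zero_AE[OF p]) auto
        then have "block_norm \<phi> p j (ft (u t - u t)) = 0"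
          using block_norm_minus[OF LFB_spaceD(1)[OF u t] LFB_spaceD(1)[OF u t], of j] by simp
        with False show ?thesis
          by (simp add: late_def)
      qed
    qed
    show "weighted_lq q s ?b < top"
      using True b by simp
  qed
  also note b
  also note lq_majorant
  finally show ?thesis .
next
  case False
  then have "lq (majorant T n) = top"
    by (simp add: less_top[symmetric])
  with lq_majorant[of T n] have "remainder T n + ennreal (1/2) * LFB_norm \<phi> s p q (late T) = top"
    by (simp only: top_unique)
  then show ?thesis
    by (simp only: top_greatest)
qed

lemma ex_late_small:
  assumes b: "0 < b"
  shows "\<exists>T\<ge>0. LFB_norm \<phi> s p q (late T) < b"
proof -
  let ?X = "\<lambda>T. LFB_norm \<phi> s p q (late T)"
  define L where "L = (INF T\<in>{0..}. ?X T)"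
  have L_le: "L \<le> ?X T" if "0 \<le> T" for T
    unfolding L_def using that by (intro INF_lower) simp
  \<comment> \<open>Here \<open>T\<close> is fixed and \<open>n\<close> tends to infinity:
    \<open>L\<close> is below the norm at every time \<open>T + real n\<close>.\<close>
  have "L \<le> ennreal (1/2) * ?X T" if T: "0 \<le> T" for T
  proof (rule LIMSEQ_le_const)
    show "(\<lambda>n. remainder T n + ennreal (1/2) * ?X T) \<longlonglongrightarrow> ennreal (1/2) * ?X T"
      using tendsto_add[OF remainder_tendsto_zero[OF T] tendsto_const] by simp
    show "\<exists>N. \<forall>n\<ge>N. L \<le> remainder T n + ennreal (1/2) * ?X T"
      using late_contraction[OF T] L_le[of "T + real _"] T by (meson add_nonneg_nonneg of_nat_0_le_iff order_trans)
  qed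
  then have "ennreal 2 * L \<le> ?X T" if "0 \<le> T" for T
  proof -
    have "ennreal 2 * L \<le> ennreal 2 * (ennreal (1/2) * ?X T)"
      using that \<open>\<And>T. 0 \<le> T \<Longrightarrow> L \<le> ennreal (1/2) * ?X T\<close> by (intro mult_left_mono) auto
    also have "\<dots> = (ennreal 2 * ennreal (1/2)) * ?X T"
      by (simp only: mult.assoc)
    also have "ennreal 2 * ennreal (1/2) = 1"
      by (simp only: ennreal_mult[symmetric]) simp
    finally show ?thesis
      by simp
  qed
  then have "ennreal 2 * L \<le> L"
    unfolding L_def by (intro INF_greatest) (auto simp: L_def)
  \<comment> \<open>Finiteness excludes infinity, the other solution of 2L \<le> L.\<close>
  moreover have "L < top"
    using L_le[of 0] LFB_spaceD(3)[OF late_LFB, of 0] by (simp add: le_less_trans)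
  then obtain l where l: "L = ennreal l" "0 \<le> l"
    by (cases L) auto
  ultimately have "ennreal (2 * l) \<le> ennreal l"
    by (simp only: l(1) ennreal_mult[OF zero_le_numeral l(2)])
  then have "L = 0"
    using l by (simp add: ennreal_le_iff)
  with b have "(INF T\<in>{0..}. ?X T) < b"
    by (simp add: L_def)
  then show ?thesis
    by (auto simp: INF_less_iff)
qed

lemma w_tendsto_zero: "((\<lambda>t. FB_norm \<phi> s p q (u t - v t)) \<longlongrightarrow> 0) at_top"
proof (rule order_tendstoI)
  fix a :: ennreal assume "0 < a"
  then obtain b where b: "0 < b" "b < a"
    using dense by blast
  then obtain d where d: "b = ennreal d" "0 < d"
    by (cases b) auto
  obtain T where T: "0 \<le> T" "LFB_norm \<phi> s p q (late T) < b"
    using ex_late_small[OF b(1)] by blast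
  \<comment> \<open>\<open>T\<close> is chosen before \<open>n\<close>, since the remainder tends to
    0 for fixed \<open>T\<close>, without uniformity in \<open>T\<close>.\<close>
  have "\<forall>\<^sub>F n in sequentially. remainder T n < ennreal (d / 2)"
    by (rule order_tendstoD(2)[OF remainder_tendsto_zero[OF T(1)]]) (use d in simp)
  then obtain n where n: "remainder T n < ennreal (d / 2)"
    by (auto simp: eventually_sequentially)
  have "FB_norm \<phi> s p q (u t - v t) < a" if t: "T + real n \<le> t" for t
  proof -
    have "FB_norm \<phi> s p q (u t - v t) \<le> remainder T n + ennreal (1/2) * LFB_norm \<phi> s p q (late T)"
      using FB_norm_w_le[OF T(1) t] by (simp add: w_def)
    also have "\<dots> \<le> ennreal (d / 2) + ennreal (1/2) * ennreal d"
      using n T(2) d by (intro add_mono mult_left_mono) auto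
    also have "ennreal (1/2) * ennreal d = ennreal (1/2 * d)"
      by (rule ennreal_mult[symmetric]) (use d in auto)
    also have "ennreal (d / 2) + ennreal (1/2 * d) = b"
      using d by (simp flip: ennreal_plus)
    finally show ?thesis
      using b by simp
  qed
  then show "\<forall>\<^sub>F t in at_top. FB_norm \<phi> s p q (u t - v t) < a"
    unfolding eventually_at_top_linorder by blast
qed simp

end

theorem theorem3p2:
  fixes \<phi> :: "real^3 \<Rightarrow> complex" and p q :: ennreal and \<alpha> \<nu> K s r :: real
  assumes \<phi>: "LP_cutoff \<phi>"
    and p: "1 < p" "p \<le> \<infinity>"
    and q: "1 \<le> q" "q \<le> \<infinity>"
    and \<alpha>: "1/2 < \<alpha>" "\<alpha> < 1/4 * (5 - enn2real (3 / p))"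
    and \<nu>: "0 < \<nu>"
    and s: "s = 4 - 2 * \<alpha> - enn2real (3 / p)"
    and r: "r = 4 - 4 * \<alpha> - enn2real (3 / p)"
    and K: "0 < K"
    and bilinear_estimate:
      "\<forall>\<Omega>. \<forall>u \<in> LFB_space \<phi> s p q. \<forall>v \<in> LFB_space \<phi> s p q.
         LFB_norm_ft \<phi> s p q (bilinear_ft \<nu> \<alpha> \<Omega> u v)
           \<le> ennreal K * LFB_norm \<phi> s p q u * LFB_norm \<phi> s p q v"
  shows "\<exists>\<epsilon>::real. 0 < \<epsilon> \<and> \<epsilon> < 1 / (4 * K) \<and>
    (\<forall>\<Omega>::real. \<forall>u0 \<in> FB_space \<phi> s p q. \<forall>v0 \<in> FB_space \<phi> s p q.
     \<forall>F \<in> LFB_space \<phi> r p q. \<forall>G \<in> LFB_space \<phi> r p q.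
     \<forall>u \<in> LFB_space \<phi> s p q. \<forall>v \<in> LFB_space \<phi> s p q.
       FB_norm \<phi> s p q u0 + LFB_norm \<phi> r p q F < ennreal \<epsilon> \<longrightarrow>
       FB_norm \<phi> s p q v0 + LFB_norm \<phi> r p q G < ennreal \<epsilon> \<longrightarrow>
       LFB_norm \<phi> s p q u \<le> ennreal (2 * \<epsilon>) \<longrightarrow>
       LFB_norm \<phi> s p q v \<le> ennreal (2 * \<epsilon>) \<longrightarrow>
       mild_solution \<nu> \<alpha> \<Omega> u0 F u \<longrightarrow>
       mild_solution \<nu> \<alpha> \<Omega> v0 G v \<longrightarrow>
       ((\<lambda>t. FB_norm_ft \<phi> s p q (semigroup_ft \<nu> \<alpha> \<Omega> t (u0 - v0))) \<longlongrightarrow> 0) at_top \<longrightarrow>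
       ((\<lambda>t. FB_norm \<phi> r p q (F t - G t)) \<longlongrightarrow> 0) at_top \<longrightarrow>
       ((\<lambda>t. FB_norm \<phi> s p q (u t - v t)) \<longlongrightarrow> 0) at_top)"
proof (intro exI[of _ "1 / (8 * K)"] conjI allI ballI impI)
  show "0 < 1 / (8 * K)" "1 / (8 * K) < 1 / (4 * K)"
    using K by (auto simp: field_simps)
  fix \<Omega> u0 v0 F G u v
  assume *: "u0 \<in> FB_space \<phi> s p q" "v0 \<in> FB_space \<phi> s p q" "F \<in> LFB_space \<phi> r p q" "G \<in> LFB_space \<phi> r p q"
    "u \<in> LFB_space \<phi> s p q" "v \<in> LFB_space \<phi> s p q"
    "LFB_norm \<phi> s p q u \<le> ennreal (2 * (1 / (8 * K)))" "LFB_norm \<phi> s p q v \<le> ennreal (2 * (1 / (8 * K)))"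
    "mild_solution \<nu> \<alpha> \<Omega> u0 F u" "mild_solution \<nu> \<alpha> \<Omega> v0 G v"
    "((\<lambda>t. FB_norm_ft \<phi> s p q (semigroup_ft \<nu> \<alpha> \<Omega> t (u0 - v0))) \<longlongrightarrow> 0) at_top"
    "((\<lambda>t. FB_norm \<phi> r p q (F t - G t)) \<longlongrightarrow> 0) at_top"
  have "2 * (1 / (8 * K)) = 1 / (4 * K)"
    by simp
  then interpret mild_pair \<phi> p q \<alpha> s r \<nu> \<Omega> K u0 v0 F G u v
    using \<phi> p q \<alpha> \<nu> s r K bilinear_estimate * by unfold_locales auto
  show "((\<lambda>t. FB_norm \<phi> s p q (u t - v t)) \<longlongrightarrow> 0) at_top"
    by (rule w_tendsto_zero)
qed

end
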